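(* Let $d\ge 1$, $\alpha\in(0,2)$, and let $f:\mathbb{R}^d\times\mathbb{R}^d\to[0,\infty]$ be a Borel function such that: (A.1) there is a constant $M>0$ with $f(x,y)\le M|y-x|^{-\alpha-d}$ for all $x,y\in\mathbb{R}^d$, $y\ne x$; (A.2) $f(x,x+h)=f(x,x-h)$ for all $x,h\in\mathbb{R}^d$, or $\alpha<1$; (A.3) $f(x,y)=f(y,x)$ for all $x,y\in\mathbb{R}^d$; (A.4) there is $a>0$ such that $\inf_{x\in\mathbb{R}^d}\int_{|y-x|>\varepsilon}f(x,y)\,dy\ge a\varepsilon^{-\alpha}$ for all $\varepsilon>0$. Then there exists a constant $C$, depending only on $\alpha,M,a,d$, such that for every nonnegative $\varphi\in B_b(\mathbb{R}^d)$, every $\varepsilon>0$ and every $t>0$, $$e^{t\mathcal{A}_\varepsilon}\varphi(x)\le C\int_{\mathbb{R}^d}\varphi(y)\min\left(t^{-d/\alpha},\frac{t}{|y-x|^{\alpha+d}}\right)dy+e^{-tb_\varepsilon(x)}\varphi(x),\quad x\in\mathbb{R}^d.$$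
   Context: $B_b(\mathbb{R}^d)$ is the set of bounded Borel measurable real functions on $\mathbb{R}^d$. For $\varepsilon>0$ put $b_\varepsilon(x)=\int_{|y-x|>\varepsilon}f(x,y)\,dy$ and $f_\varepsilon(x,y)=\mathbf{1}_{\{|y-x|\ge\varepsilon\}}f(x,y)$ (so $f_\varepsilon(x,y)=0$ if $|y-x|<\varepsilon$). Define the operator $\mathcal{A}_\varepsilon\varphi(x)=\int_{\mathbb{R}^d}(\varphi(y)-\varphi(x))f_\varepsilon(x,y)\,dy$ for $\varphi\in B_b(\mathbb{R}^d)$. By (A.1) it is bounded on $B_b(\mathbb{R}^d)$ with the supremum norm, and $e^{t\mathcal{A}_\varepsilon}=\sum_{n=0}^\infty t^n\mathcal{A}_\varepsilon^n/n!$. *)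

theory Defs
  imports "HOL-Analysis.Analysis"
begin

definition Bb :: "((real ^ 'n) \<Rightarrow> real) set"
  where "Bb = {\<phi>. \<phi> \<in> borel_measurable borel \<and> bounded (range \<phi>)}"

definition b_eps :: "(real ^ 'n \<Rightarrow> real ^ 'n \<Rightarrow> ennreal) \<Rightarrow> real \<Rightarrow> real ^ 'n \<Rightarrow> ennreal"
  where "b_eps f \<epsilon> x = (\<integral>\<^sup>+y\<in>{y. norm (y - x) > \<epsilon>}. f x y \<partial>lborel)"

definition f_eps :: "(real ^ 'n \<Rightarrow> real ^ 'n \<Rightarrow> ennreal) \<Rightarrow> real \<Rightarrow> real ^ 'n \<Rightarrow> real ^ 'n \<Rightarrow> ennreal"
  where "f_eps f \<epsilon> x y = (if norm (y - x) \<ge> \<epsilon> then f x y else 0)"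

text \<open>The truncated kernel vanishes near the diagonal and, for kernels bounded by a multiple of
  $|y - x|^{-\alpha-d}$ off the diagonal, is finite everywhere, so that the conversion to a real number
  loses nothing.\<close>

definition A_eps ::
    "(real ^ 'n \<Rightarrow> real ^ 'n \<Rightarrow> ennreal) \<Rightarrow> real \<Rightarrow> (real ^ 'n \<Rightarrow> real) \<Rightarrow> real ^ 'n \<Rightarrow> real"
  where "A_eps f \<epsilon> \<phi> x = (\<integral>y. (\<phi> y - \<phi> x) * enn2real (f_eps f \<epsilon> x y) \<partial>lborel)"

text \<open>The operator exponential, evaluated at a function and a point. For the operators considered here the
  series converges in operator norm on the bounded Borel functions: see the last lemma below.\<close>

definition exp_op ::
    "real \<Rightarrow> ((real ^ 'n \<Rightarrow> real) \<Rightarrow> real ^ 'n \<Rightarrow> real) \<Rightarrow> (real ^ 'n \<Rightarrow> real) \<Rightarrow> real ^ 'n \<Rightarrow> real"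
  where "exp_op t A \<phi> x = (\<Sum>n. t ^ n * (A ^^ n) \<phi> x / fact n)"


lemma tail_nn_integral_bound:
  fixes p :: real
  assumes p: "p > real CARD('n)" and e: "\<epsilon> > 0"
  obtains K :: real where "K \<ge> 0"
    "\<And>x :: real ^ 'n. (\<integral>\<^sup>+y\<in>{y. \<epsilon> \<le> norm (y - x)}. ennreal (norm (y - x) powr (- p)) \<partial>lborel) \<le> ennreal K"
proof -
  define d where "d = CARD('n)"
  define V where "V = unit_ball_vol (real d)"
  have V: "V \<ge> 0" by (simp add: V_def)
  define g where "g k = (2 ^ k * \<epsilon>) powr (- p) * (V * (2 * (2 ^ k * \<epsilon>)) ^ d)" for k :: nat
  define q where "q = 2 powr (real d - p)"
  have q: "0 < q" "q < 1"
    using p by (auto simp: q_def d_def powr_less_one)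
  have g_eq: "g k = (V * 2 ^ d * \<epsilon> powr (real d - p)) * q ^ k" for k
  proof -
    have "(2 ^ k * \<epsilon>) powr (- p) * (2 ^ k * \<epsilon>) ^ d = (2 ^ k * \<epsilon>) powr (real d - p)"
      using e by (simp add: powr_diff powr_minus powr_realpow field_simps)
    also have "\<dots> = (2 ^ k) powr (real d - p) * \<epsilon> powr (real d - p)"
      using e by (simp add: powr_mult)
    also have "(2 ^ k :: real) powr (real d - p) = q ^ k"
      by (simp add: q_def powr_powr powr_realpow[symmetric] mult.commute)
    finally show ?thesis
      unfolding g_def power_mult_distrib[of 2 "2 ^ k * \<epsilon>"] by (simp add: mult_ac)
  qed
  have g0: "g k \<ge> 0" for k using V e by (simp add: g_def)
  have sg: "summable g"
    unfolding g_eq using q by (intro summable_mult summable_geometric) auto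
  show thesis
  proof (rule that[of "suminf g"])
    show "suminf g \<ge> 0" using g0 sg by (simp add: suminf_nonneg)
    fix x :: "real ^ 'n"
    have single_le: "h k \<le> suminf h" for h :: "nat \<Rightarrow> ennreal" and k
      using sum_le_suminf[of h "{k}"] by simp
    define I where "I = (\<lambda>(k :: nat) y. ennreal ((2 ^ k * \<epsilon>) powr (- p)) * indicator (ball x (2 * (2 ^ k * \<epsilon>))) y)"
    have [measurable]: "I k \<in> borel_measurable lborel" for k
      unfolding I_def by (intro borel_measurable_times_ennreal borel_measurable_const borel_measurable_indicator) simp
    have pt: "ennreal (norm (y - x) powr (- p)) * indicator {y. \<epsilon> \<le> norm (y - x)} y \<le> (\<Sum>k. I k y)" for y
    proof (cases "\<epsilon> \<le> norm (y - x)")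
      case True
      let ?r = "norm (y - x)"
      define k where "k = nat \<lfloor>log 2 (?r / \<epsilon>)\<rfloor>"
      have r1: "?r / \<epsilon> \<ge> 1" using True e by simp
      have r0: "?r / \<epsilon> > 0" using r1 by linarith
      have l0: "log 2 (?r / \<epsilon>) \<ge> 0" using r1 by simp
      have k1: "real k \<le> log 2 (?r / \<epsilon>)" "log 2 (?r / \<epsilon>) < real (Suc k)"
        using l0 unfolding k_def by linarith+
      have "2 ^ k \<le> ?r / \<epsilon>" using k1(1) r0 by (simp add: le_log_iff powr_realpow)
      then have a: "2 ^ k * \<epsilon> \<le> ?r" using e by (simp add: field_simps)
      have "?r / \<epsilon> < 2 powr real (Suc k)" using k1(2) r0 by (subst (asm) log_less_iff) auto
      then have b: "?r < 2 * (2 ^ k * \<epsilon>)" using e by (simp add: powr_realpow field_simps powr_add)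
      have "?r powr (- p) \<le> (2 ^ k * \<epsilon>) powr (- p)"
        using a e p by (intro powr_mono2') auto
      then have "ennreal (?r powr (- p)) \<le> I k y"
        using b by (auto simp: I_def dist_norm norm_minus_commute ennreal_leI)
      also have "\<dots> \<le> (\<Sum>k. I k y)"
        by (rule single_le)
      finally show ?thesis using True by simp
    qed simp
    have "(\<integral>\<^sup>+y\<in>{y. \<epsilon> \<le> norm (y - x)}. ennreal (norm (y - x) powr (- p)) \<partial>lborel)
        \<le> (\<integral>\<^sup>+y. (\<Sum>k. I k y) \<partial>lborel)"
      by (rule nn_integral_mono) (rule pt)
    also have "\<dots> = (\<Sum>k. \<integral>\<^sup>+y. I k y \<partial>lborel)"
      by (rule nn_integral_suminf) simp
    also have "\<dots> = (\<Sum>k. ennreal (g k))"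
    proof (intro suminf_cong)
      fix k
      have "(\<integral>\<^sup>+y. I k y \<partial>lborel)
          = ennreal ((2 ^ k * \<epsilon>) powr (- p)) * emeasure lborel (ball x (2 * (2 ^ k * \<epsilon>)))"
        unfolding I_def by (rule nn_integral_cmult_indicator) simp
      also have "\<dots> = ennreal (g k)"
        using e V by (subst emeasure_ball) (auto simp: g_def V_def d_def ennreal_mult)
      finally show "(\<integral>\<^sup>+y. I k y \<partial>lborel) = ennreal (g k)" .
    qed
    also have "\<dots> = ennreal (suminf g)"
      using g0 sg by (intro suminf_ennreal2)
    finally show "(\<integral>\<^sup>+y\<in>{y. \<epsilon> \<le> norm (y - x)}. ennreal (norm (y - x) powr (- p)) \<partial>lborel) \<le> ennreal (suminf g)" .
  qed
qed

lemma f_eps_bounds: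
  fixes f :: "real ^ 'n \<Rightarrow> real ^ 'n \<Rightarrow> ennreal"
  assumes "0 < \<alpha>" "0 \<le> M"
    and ub: "\<And>x y. y \<noteq> x \<Longrightarrow> f x y \<le> ennreal (M * norm (y - x) powr (- \<alpha> - real CARD('n)))"
    and e: "\<epsilon> > 0"
  obtains K :: real where "K \<ge> 0" "\<And>x. (\<integral>\<^sup>+y. f_eps f \<epsilon> x y \<partial>lborel) \<le> ennreal K"
proof -
  obtain K where K: "K \<ge> 0"
    "\<And>x :: real ^ 'n. (\<integral>\<^sup>+y\<in>{y. \<epsilon> \<le> norm (y - x)}. ennreal (norm (y - x) powr (- (\<alpha> + real CARD('n)))) \<partial>lborel) \<le> ennreal K"
    by (rule tail_nn_integral_bound[of "\<alpha> + real CARD('n)" \<epsilon>]) (use assms in auto)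
  show thesis
  proof (rule that[of "M * K"])
    show "M * K \<ge> 0" using assms K by simp
    fix x :: "real ^ 'n"
    have "f_eps f \<epsilon> x y \<le> ennreal M * (ennreal (norm (y - x) powr (- (\<alpha> + real CARD('n)))) * indicator {y. \<epsilon> \<le> norm (y - x)} y)" for y
    proof (cases "\<epsilon> \<le> norm (y - x)")
      case True
      then have "y \<noteq> x" using e by auto
      then show ?thesis using ub[of y x] True \<open>0 \<le> M\<close> by (simp add: f_eps_def ennreal_mult)
    qed (simp add: f_eps_def)
    then have "(\<integral>\<^sup>+y. f_eps f \<epsilon> x y \<partial>lborel) \<le> (\<integral>\<^sup>+y. ennreal M * (ennreal (norm (y - x) powr (- (\<alpha> + real CARD('n)))) * indicator {y. \<epsilon> \<le> norm (y - x)} y) \<partial>lborel)"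
      by (rule nn_integral_mono)
    also have "\<dots> = ennreal M * (\<integral>\<^sup>+y\<in>{y. \<epsilon> \<le> norm (y - x)}. ennreal (norm (y - x) powr (- (\<alpha> + real CARD('n)))) \<partial>lborel)"
      by (rule nn_integral_cmult) measurable
    also have "\<dots> \<le> ennreal M * ennreal K" by (intro mult_left_mono K) simp
    finally show "(\<integral>\<^sup>+y. f_eps f \<epsilon> x y \<partial>lborel) \<le> ennreal (M * K)" using assms K by (simp add: ennreal_mult)
  qed
qed

text \<open>Under the upper bound on the kernel, the operator is bounded on the bounded Borel functions with the
  supremum norm; in particular, the integral defining it always converges.\<close>

lemma A_eps_bounded:
  fixes f :: "real ^ 'n \<Rightarrow> real ^ 'n \<Rightarrow> ennreal"
  assumes meas: "(\<lambda>(x, y). f x y) \<in> borel_measurable borel"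
    and "0 < \<alpha>" "0 \<le> M"
    and ub: "\<And>x y. y \<noteq> x \<Longrightarrow> f x y \<le> ennreal (M * norm (y - x) powr (- \<alpha> - real CARD('n)))"
    and e: "\<epsilon> > 0"
  obtains K :: real where "K \<ge> 0"
    and "\<And>\<phi> x. \<phi> \<in> Bb \<Longrightarrow> integrable lborel (\<lambda>y. (\<phi> y - \<phi> x) * enn2real (f_eps f \<epsilon> x y))"
    and "\<And>\<phi>. \<phi> \<in> Bb \<Longrightarrow> A_eps f \<epsilon> \<phi> \<in> Bb"
    and "\<And>\<phi> B x. \<phi> \<in> Bb \<Longrightarrow> (\<And>x. \<bar>\<phi> x\<bar> \<le> B) \<Longrightarrow> \<bar>A_eps f \<epsilon> \<phi> x\<bar> \<le> K * B"
proof -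
  obtain K where K: "K \<ge> 0" "\<And>x. (\<integral>\<^sup>+y. f_eps f \<epsilon> x y \<partial>lborel) \<le> ennreal K"
    by (rule f_eps_bounds[of \<alpha> M f \<epsilon>]) (use assms in auto)
  have [measurable]: "(\<lambda>(x, y). f x y) \<in> borel_measurable (borel \<Otimes>\<^sub>M borel)"
    using meas by (simp add: borel_prod)
  have mfe [measurable]: "(\<lambda>(x, y). f_eps f \<epsilon> x y) \<in> borel_measurable (borel \<Otimes>\<^sub>M borel)"
    unfolding f_eps_def by measurable
  have mfe1 [measurable]: "f_eps f \<epsilon> x \<in> borel_measurable borel" for x
    using measurable_compose[OF measurable_Pair1' mfe, of x] by simp
  have fin: "f_eps f \<epsilon> x y < \<infinity>" for x y
  proof (cases "\<epsilon> \<le> norm (y - x)")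
    case True
    then have "y \<noteq> x" using e by auto
    then show ?thesis using ub[of y x] True by (simp add: f_eps_def) (erule le_less_trans, simp)
  qed (simp add: f_eps_def)
  have int1: "integrable lborel (\<lambda>y. enn2real (f_eps f \<epsilon> x y))"
    and int2: "(\<integral>y. enn2real (f_eps f \<epsilon> x y) \<partial>lborel) \<le> K" for x
  proof -
    have eq: "(\<integral>\<^sup>+y. ennreal (enn2real (f_eps f \<epsilon> x y)) \<partial>lborel) = (\<integral>\<^sup>+y. f_eps f \<epsilon> x y \<partial>lborel)"
      using fin by (intro nn_integral_cong) (simp add: less_top)
    show i: "integrable lborel (\<lambda>y. enn2real (f_eps f \<epsilon> x y))"
      unfolding integrable_iff_bounded using K(2)[of x] eq
      by (auto intro: le_less_trans)
    show "(\<integral>y. enn2real (f_eps f \<epsilon> x y) \<partial>lborel) \<le> K"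
      using K(1) K(2)[of x] eq nn_integral_eq_integral[OF i] by (simp flip: ennreal_le_iff)
  qed
  have I: "integrable lborel (\<lambda>y. (\<phi> y - \<phi> x) * enn2real (f_eps f \<epsilon> x y))"
    and AB: "\<bar>A_eps f \<epsilon> \<phi> x\<bar> \<le> 2 * K * B"
    if "\<phi> \<in> Bb" and B: "\<And>x. \<bar>\<phi> x\<bar> \<le> B" for \<phi> B x
  proof -
    have [measurable]: "\<phi> \<in> borel_measurable borel" using that by (simp add: Bb_def)
    have B0: "B \<ge> 0" using B[of 0] by linarith
    have le: "\<bar>(\<phi> y - \<phi> x) * enn2real (f_eps f \<epsilon> x y)\<bar> \<le> 2 * B * enn2real (f_eps f \<epsilon> x y)" for y
    proof -
      have "\<bar>\<phi> y - \<phi> x\<bar> \<le> 2 * B" using B[of x] B[of y] by linarith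
      then show ?thesis by (simp add: abs_mult mult_right_mono)
    qed
    have i2: "integrable lborel (\<lambda>y. 2 * B * enn2real (f_eps f \<epsilon> x y))"
      using int1 by simp
    show i: "integrable lborel (\<lambda>y. (\<phi> y - \<phi> x) * enn2real (f_eps f \<epsilon> x y))"
      by (rule Bochner_Integration.integrable_bound[OF i2])
        (use le B0 in \<open>auto simp: abs_mult\<close>)
    have "\<bar>A_eps f \<epsilon> \<phi> x\<bar> \<le> (\<integral>y. \<bar>(\<phi> y - \<phi> x) * enn2real (f_eps f \<epsilon> x y)\<bar> \<partial>lborel)"
      unfolding A_eps_def by (rule integral_abs_bound)
    also have "\<dots> \<le> (\<integral>y. 2 * B * enn2real (f_eps f \<epsilon> x y) \<partial>lborel)"
      using i i2 le by (intro integral_mono) auto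
    also have "\<dots> = 2 * B * (\<integral>y. enn2real (f_eps f \<epsilon> x y) \<partial>lborel)" by simp
    also have "\<dots> \<le> 2 * B * K" using int2 B0 by (intro mult_left_mono) auto
    finally show "\<bar>A_eps f \<epsilon> \<phi> x\<bar> \<le> 2 * K * B" by (simp add: mult_ac)
  qed
  have ex: "\<exists>B. \<forall>x. \<bar>\<phi> x\<bar> \<le> B" if "\<phi> \<in> Bb" for \<phi>
    using that by (auto simp: Bb_def bounded_iff)
  show thesis
  proof (rule that[of "2 * K"])
    show "integrable lborel (\<lambda>y. (\<phi> y - \<phi> x) * enn2real (f_eps f \<epsilon> x y))" if "\<phi> \<in> Bb" for \<phi> x
      using I[OF that] ex[OF that] by blast
    show "A_eps f \<epsilon> \<phi> \<in> Bb" if "\<phi> \<in> Bb" for \<phi>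
    proof -
      have [measurable]: "\<phi> \<in> borel_measurable borel" using that by (simp add: Bb_def)
      have "A_eps f \<epsilon> \<phi> \<in> borel_measurable borel"
        unfolding A_eps_def by measurable
      moreover have "bounded (range (A_eps f \<epsilon> \<phi>))"
        using AB[OF that] ex[OF that] by (force simp: bounded_iff)
      ultimately show ?thesis by (simp add: Bb_def)
    qed
  qed (use K AB in auto)
qed

lemma b_eps_finite:
  fixes f :: "real ^ 'n \<Rightarrow> real ^ 'n \<Rightarrow> ennreal"
  assumes "0 < \<alpha>" "0 \<le> M"
    and ub: "\<And>x y. y \<noteq> x \<Longrightarrow> f x y \<le> ennreal (M * norm (y - x) powr (- \<alpha> - real CARD('n)))"
    and e: "\<epsilon> > 0"
  shows "b_eps f \<epsilon> x < \<infinity>"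
proof -
  obtain K where K: "\<And>x. (\<integral>\<^sup>+y. f_eps f \<epsilon> x y \<partial>lborel) \<le> ennreal K"
    by (rule f_eps_bounds[of \<alpha> M f \<epsilon>]) (use assms in auto)
  have "b_eps f \<epsilon> x \<le> (\<integral>\<^sup>+y. f_eps f \<epsilon> x y \<partial>lborel)"
    unfolding b_eps_def by (rule nn_integral_mono) (simp add: f_eps_def indicator_def)
  also have "\<dots> \<le> ennreal K" by (rule K)
  also have "\<dots> < \<infinity>" by simp
  finally show ?thesis .
qed

lemma integrable_stable_kernel:
  fixes x :: "real ^ 'n" and \<phi> :: "real ^ 'n \<Rightarrow> real"
  assumes "0 < \<alpha>" "t > 0" and phi: "\<phi> \<in> Bb"
  shows "integrable lborel (\<lambda>y. \<phi> y * min (t powr (- real CARD('n) / \<alpha>))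
    (t / norm (y - x) powr (\<alpha> + real CARD('n))))"
proof -
  let ?p = "\<alpha> + real CARD('n)" and ?c = "t powr (- real CARD('n) / \<alpha>)"
  let ?k = "\<lambda>y. min ?c (t / norm (y - x) powr ?p)"
  obtain K where K: "K \<ge> 0"
    "\<And>x :: real ^ 'n. (\<integral>\<^sup>+y\<in>{y. 1 \<le> norm (y - x)}. ennreal (norm (y - x) powr (- ?p)) \<partial>lborel) \<le> ennreal K"
    by (rule tail_nn_integral_bound[of ?p 1]) (use assms in auto)
  have k0: "?k y \<ge> 0" for y using assms by simp
  have mk [measurable]: "?k \<in> borel_measurable borel" by measurable
  have le: "ennreal (?k y) \<le> ennreal ?c * indicator (ball x 1) y
      + ennreal t * (ennreal (norm (y - x) powr (- ?p)) * indicator {y. 1 \<le> norm (y - x)} y)" for y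
  proof (cases "1 \<le> norm (y - x)")
    case True
    have "ennreal (?k y) \<le> ennreal (t * norm (y - x) powr (- ?p))"
      by (rule ennreal_leI) (simp only: powr_minus divide_inverse min.cobounded2)
    then show ?thesis using True assms by (simp add: ennreal_mult dist_norm norm_minus_commute)
  next
    case False
    then show ?thesis by (simp add: dist_norm norm_minus_commute ennreal_leI)
  qed
  have m1: "(\<lambda>y. ennreal ?c * indicator (ball x 1) y) \<in> borel_measurable lborel"
    by (intro borel_measurable_times_ennreal borel_measurable_const borel_measurable_indicator) simp
  have m2: "(\<lambda>y. ennreal t * (ennreal (norm (y - x) powr (- ?p)) * indicator {y. 1 \<le> norm (y - x)} y))
      \<in> borel_measurable lborel"
    by measurable
  have "(\<integral>\<^sup>+y. ennreal (?k y) \<partial>lborel) \<le> (\<integral>\<^sup>+y. ennreal ?c * indicator (ball x 1) y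
      + ennreal t * (ennreal (norm (y - x) powr (- ?p)) * indicator {y. 1 \<le> norm (y - x)} y) \<partial>lborel)"
    by (rule nn_integral_mono) (rule le)
  also have "\<dots> = (\<integral>\<^sup>+y. ennreal ?c * indicator (ball x 1) y \<partial>lborel)
      + (\<integral>\<^sup>+y. ennreal t * (ennreal (norm (y - x) powr (- ?p)) * indicator {y. 1 \<le> norm (y - x)} y) \<partial>lborel)"
    by (rule nn_integral_add[OF m1 m2])
  also have "(\<integral>\<^sup>+y. ennreal ?c * indicator (ball x 1) y \<partial>lborel) = ennreal ?c * emeasure lborel (ball x 1)"
    by (rule nn_integral_cmult_indicator) simp
  also have "(\<integral>\<^sup>+y. ennreal t * (ennreal (norm (y - x) powr (- ?p)) * indicator {y. 1 \<le> norm (y - x)} y) \<partial>lborel)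
      = ennreal t * (\<integral>\<^sup>+y\<in>{y. 1 \<le> norm (y - x)}. ennreal (norm (y - x) powr (- ?p)) \<partial>lborel)"
    by (rule nn_integral_cmult) measurable
  also have "ennreal ?c * emeasure lborel (ball x 1) + \<dots> < \<infinity>"
    using K(2)[of x] emeasure_bounded_finite[OF bounded_ball, of x 1]
    by (auto simp: ennreal_mult_less_top intro: le_less_trans)
  finally have ik: "integrable lborel ?k"
    using k0 by (intro integrableI_nonneg) auto
  obtain B where B: "\<And>y. \<bar>\<phi> y\<bar> \<le> B"
    using phi by (auto simp: Bb_def bounded_iff)
  have [measurable]: "\<phi> \<in> borel_measurable borel" using phi by (simp add: Bb_def)
  have iB: "integrable lborel (\<lambda>y. B * ?k y)" using ik by (rule integrable_mult_right)
  show ?thesis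
  proof (rule Bochner_Integration.integrable_bound[OF iB])
    show "(\<lambda>y. \<phi> y * ?k y) \<in> borel_measurable lborel" by measurable
    have "norm (\<phi> y * ?k y) \<le> norm (B * ?k y)" for y
      using B[of y] k0[of y] unfolding real_norm_def abs_mult by (intro mult_right_mono) auto
    then show "AE y in lborel. norm (\<phi> y * ?k y) \<le> norm (B * ?k y)" by simp
  qed
qed

text \<open>The partial sums of the exponential series, regarded as operators on the bounded Borel functions,
  converge uniformly on the unit ball of the supremum norm, i.e. in operator norm. Hence the pointwise
  series in the definition of exp_op is the value of the operator exponential.\<close>

lemma exp_op_operator_norm_limit:
  fixes f :: "real ^ 'n \<Rightarrow> real ^ 'n \<Rightarrow> ennreal"
  assumes meas: "(\<lambda>(x, y). f x y) \<in> borel_measurable borel"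
    and "0 < \<alpha>" "0 \<le> M"
    and ub: "\<And>x y. y \<noteq> x \<Longrightarrow> f x y \<le> ennreal (M * norm (y - x) powr (- \<alpha> - real CARD('n)))"
    and e: "\<epsilon> > 0"
  shows "uniform_limit ({\<phi> \<in> Bb. \<forall>x. \<bar>\<phi> x\<bar> \<le> 1} \<times> UNIV)
    (\<lambda>N (\<phi>, x). \<Sum>n<N. t ^ n * (A_eps f \<epsilon> ^^ n) \<phi> x / fact n)
    (\<lambda>(\<phi>, x). exp_op t (A_eps f \<epsilon>) \<phi> x) sequentially"
proof -
  obtain K where K: "K \<ge> 0" "\<And>\<phi>. \<phi> \<in> Bb \<Longrightarrow> A_eps f \<epsilon> \<phi> \<in> Bb"
    "\<And>\<phi> B x. \<phi> \<in> Bb \<Longrightarrow> (\<And>x. \<bar>\<phi> x\<bar> \<le> B) \<Longrightarrow> \<bar>A_eps f \<epsilon> \<phi> x\<bar> \<le> K * B"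
    by (rule A_eps_bounded[of f \<alpha> M \<epsilon>]) (use assms in auto)
  have it: "(A_eps f \<epsilon> ^^ n) \<phi> \<in> Bb \<and> (\<forall>x. \<bar>(A_eps f \<epsilon> ^^ n) \<phi> x\<bar> \<le> K ^ n)"
    if "\<phi> \<in> Bb" "\<forall>x. \<bar>\<phi> x\<bar> \<le> 1" for \<phi> n
    using that by (induction n) (auto intro!: K)
  have sm: "summable (\<lambda>n. (\<bar>t\<bar> * K) ^ n / fact n)"
    using summable_exp[of "\<bar>t\<bar> * K"] by (simp add: divide_inverse mult.commute)
  have "uniform_limit ({\<phi> \<in> Bb. \<forall>x. \<bar>\<phi> x\<bar> \<le> 1} \<times> UNIV)
      (\<lambda>N z. \<Sum>n<N. (\<lambda>n (\<phi>, x). t ^ n * (A_eps f \<epsilon> ^^ n) \<phi> x / fact n) n z)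
      (\<lambda>z. \<Sum>n. (\<lambda>n (\<phi>, x). t ^ n * (A_eps f \<epsilon> ^^ n) \<phi> x / fact n) n z) sequentially"
  proof (rule Weierstrass_m_test[OF _ sm])
    fix n and z :: "(real ^ 'n \<Rightarrow> real) \<times> (real ^ 'n)"
    assume "z \<in> {\<phi> \<in> Bb. \<forall>x. \<bar>\<phi> x\<bar> \<le> 1} \<times> UNIV"
    then obtain \<phi> x where z: "z = (\<phi>, x)" "\<phi> \<in> Bb" "\<forall>x. \<bar>\<phi> x\<bar> \<le> 1" by auto
    have "\<bar>t\<bar> ^ n * \<bar>(A_eps f \<epsilon> ^^ n) \<phi> x\<bar> \<le> \<bar>t\<bar> ^ n * K ^ n"
      using it[OF z(2,3)] by (intro mult_left_mono) auto
    then show "norm ((\<lambda>n (\<phi>, x). t ^ n * (A_eps f \<epsilon> ^^ n) \<phi> x / fact n) n z) \<le> (\<bar>t\<bar> * K) ^ n / fact n"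
      unfolding z by (simp add: abs_mult power_abs power_mult_distrib divide_right_mono)
  qed
  then show ?thesis by (simp add: exp_op_def case_prod_unfold)
qed

end

theory Submission
  imports Defs
begin

text \<open>With \<open>\<Lambda> = L \<epsilon> powr (- \<alpha>)\<close> dominating the total jump rate, \<open>A = \<Lambda> (S - 1)\<close> for a symmetric Markov operator
  \<open>S \<phi> = D \<phi> + \<integral> j(-, y) \<phi>(y) dy\<close> with \<open>D \<le> 1 - a < 1\<close>, and \<open>exp (t A)\<close> is the Poisson mixture of the powers
  \<open>S ^ n\<close>. So it suffices to bound \<open>S ^ n - D ^ n\<close> by a multiple of
  \<open>min (\<epsilon> powr (-d) * n powr (- d/\<alpha>), n * \<epsilon> powr \<alpha> / |x - y| powr (\<alpha> + d))\<close> and to take Poisson means.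

  On the diagonal, splitting off the jumps longer than \<open>r \<ge> \<epsilon>\<close> and using the lower bound on the tails
  gives a recursion for \<open>\<integral> (S ^ n \<phi>)\<^sup>2\<close> which, optimised over \<open>r\<close>, yields the decay
  \<open>n powr (- d/\<alpha>)\<close>; symmetry turns it into a supremum bound. Off the diagonal, jumps longer than \<open>\<rho>\<close>,
  proportional to \<open>|x - y|\<close>, contribute at most \<open>n\<close> times their maximal density. The tails of the truncated chain
  are controlled by the weight \<open>\<Sum>i. cosh (l (y i - x i))\<close>, which is an approximate supersolution by the reflection
  symmetry of the kernel, or by \<open>\<alpha> < 1\<close>.\<close>

section \<open>Integrals of powers of the norm\<close>

text \<open>The Poisson mixture always keeps an atom at x, so no bound by a density alone can hold,
  and the L2 norm is infinite when the chain starts at a point. The decay is therefore proved first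
  for the densities \<open>j x\<close> of a single jump. A Duhamel expansion over the first jump
  transfers it to everything except \<open>D x ^ n * \<phi> x\<close>, whose Poisson mean is the
  exponential summand of the theorem. Uniformity in \<epsilon> comes from scaling. Division of the
  kernel by \<Lambda> leaves the parameters \<open>M / L\<close> and \<open>a / L\<close>, free of
  \<epsilon>; these are the \<open>m\<close> and \<open>a\<close> of the chain estimates. Poisson
  averaging with mean \<open>L * \<epsilon> powr (- \<alpha>) * t\<close> cancels the remaining
  powers of \<epsilon>. Since every unspecified constant must be chosen before the kernel and
  \<epsilon>, the lemmas that produce one quantify over all instances of the chain locale instead of
  being proved inside it.\<close>

lemma nn_integral_lborel_shift:
  fixes F :: "'a::euclidean_space \<Rightarrow> ennreal"
  assumes [measurable]: "F \<in> borel_measurable borel"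
  shows "(\<integral>\<^sup>+y. F (x + y) \<partial>lborel) = (\<integral>\<^sup>+y. F y \<partial>lborel)"
  by (subst (2) lborel_distr_plus[of x, symmetric], subst nn_integral_distr) auto

lemma nn_integral_lborel_reflect:
  fixes F :: "'a::euclidean_space \<Rightarrow> ennreal"
  assumes [measurable]: "F \<in> borel_measurable borel"
  shows "(\<integral>\<^sup>+y. F (x - y) \<partial>lborel) = (\<integral>\<^sup>+y. F y \<partial>lborel)"
  by (subst (2) lborel_affine[of "- 1" x]) (auto simp: nn_integral_density nn_integral_distr)

text \<open>The exponents p and -d are estimated apart: \<open>c powr (- real d)\<close> will cancel
  against the volume of the ball of radius 2c, which leaves \<open>c powr p\<close> to be summed
  over the annuli. The factor \<open>2 powr \<bar>p\<bar>\<close> covers both signs of p.\<close>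

lemma powr_annulus_le:
  fixes c r p :: real
  assumes "c > 0" "c \<le> r" "r \<le> 2 * c"
  shows "r powr (p - real d) \<le> 2 powr \<bar>p\<bar> * c powr p * c powr (- real d)"
proof -
  have "r powr p \<le> 2 powr \<bar>p\<bar> * c powr p"
  proof (cases "p \<ge> 0")
    case True
    then show ?thesis using assms powr_mono2[of p r "2 * c"] by (simp add: powr_mult)
  next
    case False
    have "r powr p \<le> c powr p" using False assms by (intro powr_mono2') auto
    also have "\<dots> \<le> 2 powr \<bar>p\<bar> * c powr p" by (intro mult_le_cancel_right1[THEN iffD2]) (auto simp: ge_one_powr_ge_zero)
    finally show ?thesis .
  qed
  moreover have "r powr (- real d) \<le> c powr (- real d)" using assms by (intro powr_mono2') auto
  ultimately have "r powr p * r powr (- real d) \<le> (2 powr \<bar>p\<bar> * c powr p) * c powr (- real d)"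
    by (intro mult_mono) auto
  then show ?thesis by (simp flip: powr_add)
qed

text \<open>One covering by annuli serves both the complement of a ball (p < 0, growing radii) and
  the ball itself (p > 0, shrinking radii). The origin may stay uncovered because
  \<open>0 powr _ = 0\<close>.\<close>

lemma nn_integral_annuli_le:
  fixes c :: "nat \<Rightarrow> real" and p :: real and E :: "(real ^ 'n) set"
  assumes c: "\<And>k. c k > 0" and sm: "summable (\<lambda>k. c k powr p)"
    and E: "\<And>z. z \<in> E \<Longrightarrow> z \<noteq> 0 \<Longrightarrow> \<exists>k. c k \<le> norm z \<and> norm z \<le> 2 * c k"
  shows "(\<integral>\<^sup>+z\<in>E. ennreal (norm z powr (p - real CARD('n))) \<partial>lborel)
    \<le> ennreal (2 powr \<bar>p\<bar> * 2 ^ CARD('n) * unit_ball_vol (real CARD('n)) * (\<Sum>k. c k powr p))"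
proof -
  let ?d = "CARD('n)"
  define V where "V = unit_ball_vol (real ?d)"
  have V: "V \<ge> 0" by (simp add: V_def)
  define g where "g k = 2 powr \<bar>p\<bar> * c k powr p * c k powr (- real ?d)" for k
  define I where "I k z = ennreal (g k) * indicator (cball 0 (2 * c k)) z" for k and z :: "real ^ 'n"
  have [measurable]: "I k \<in> borel_measurable lborel" for k
    unfolding I_def by (intro borel_measurable_times_ennreal borel_measurable_const borel_measurable_indicator) simp
  have "ennreal (norm z powr (p - real ?d)) * indicator E z \<le> (\<Sum>k. I k z)" for z
  proof (cases "z \<in> E \<and> z \<noteq> 0")
    case True
    then obtain k where k: "c k \<le> norm z" "norm z \<le> 2 * c k" using E by blast
    have "ennreal (norm z powr (p - real ?d)) \<le> I k z"
      using k c[of k] powr_annulus_le[of "c k" "norm z" p ?d]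
      by (auto simp: I_def g_def intro!: ennreal_leI)
    also have "\<dots> \<le> (\<Sum>k. I k z)" using sum_le_suminf[of "\<lambda>k. I k z" "{k}"] by simp
    finally show ?thesis using True by simp
  qed auto
  then have "(\<integral>\<^sup>+z\<in>E. ennreal (norm z powr (p - real ?d)) \<partial>lborel) \<le> (\<integral>\<^sup>+z. (\<Sum>k. I k z) \<partial>lborel)"
    by (rule nn_integral_mono)
  also have "\<dots> = (\<Sum>k. \<integral>\<^sup>+z. I k z \<partial>lborel)" by (rule nn_integral_suminf) simp
  also have "\<dots> = (\<Sum>k. ennreal ((2 powr \<bar>p\<bar> * 2 ^ ?d * V) * c k powr p))"
  proof (intro suminf_cong)
    fix k
    have "(\<integral>\<^sup>+z. I k z \<partial>lborel) = ennreal (g k) * emeasure lborel (cball (0 :: real ^ 'n) (2 * c k))"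
      unfolding I_def by (rule nn_integral_cmult_indicator) simp
    also have "\<dots> = ennreal (g k * (V * (2 * c k) ^ ?d))"
      using c[of k] V by (subst emeasure_cball) (auto simp: V_def g_def ennreal_mult)
    also have "g k * (V * (2 * c k) ^ ?d) = (2 powr \<bar>p\<bar> * 2 ^ ?d * V) * c k powr p"
      using c[of k] by (simp add: g_def powr_minus powr_realpow power_mult_distrib field_simps)
    finally show "(\<integral>\<^sup>+z. I k z \<partial>lborel) = ennreal ((2 powr \<bar>p\<bar> * 2 ^ ?d * V) * c k powr p)" .
  qed
  also have "\<dots> = ennreal (\<Sum>k. (2 powr \<bar>p\<bar> * 2 ^ ?d * V) * c k powr p)"
    using V sm by (intro suminf_ennreal2 summable_mult) auto
  also have "(\<Sum>k. (2 powr \<bar>p\<bar> * 2 ^ ?d * V) * c k powr p) = (2 powr \<bar>p\<bar> * 2 ^ ?d * V) * (\<Sum>k. c k powr p)"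
    using sm by (rule suminf_mult)
  finally show ?thesis by (simp add: V_def)
qed

lemma dyadic_bracket:
  fixes r :: real
  assumes "r \<ge> 1"
  shows "2 ^ nat \<lfloor>log 2 r\<rfloor> \<le> r" "r < 2 ^ Suc (nat \<lfloor>log 2 r\<rfloor>)"
proof -
  let ?k = "nat \<lfloor>log 2 r\<rfloor>"
  have "0 \<le> log 2 r" using assms by simp
  then have k: "real ?k \<le> log 2 r" "log 2 r < real (Suc ?k)" by linarith+
  have r: "r > 0" using assms by simp
  show "2 ^ ?k \<le> r" using k(1) r by (simp add: le_log_iff powr_realpow)
  show "r < 2 ^ Suc ?k" using k(2) r by (subst (asm) log_less_iff) (auto simp del: power_Suc simp flip: powr_realpow)
qed

text \<open>Unlike in \<open>tail_nn_integral_bound\<close>, the dependence on the radius is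
  explicit: K is chosen before r. This is what makes the domination of the jump rate uniform in
  \<epsilon>.\<close>

lemma tail_powr_integral:
  fixes \<alpha> :: real
  assumes "\<alpha> > 0"
  obtains K :: real where "K > 0"
    "\<And>r. r > 0 \<Longrightarrow> (\<integral>\<^sup>+z\<in>{z :: real ^ 'n. r \<le> norm z}. ennreal (norm z powr (- \<alpha> - real CARD('n))) \<partial>lborel)
      \<le> ennreal (K * r powr (- \<alpha>))"
proof -
  define q where "q = 2 powr (- \<alpha>)"
  have q: "0 < q" "q < 1" using assms by (auto simp: q_def powr_less_one)
  define K where "K = 2 powr \<bar>- \<alpha>\<bar> * 2 ^ CARD('n) * unit_ball_vol (real CARD('n)) * (1 / (1 - q))"
  show thesis
  proof (rule that[of K])
    show "K > 0" using q by (auto simp: K_def intro!: mult_pos_pos)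
    fix r :: real assume r: "r > 0"
    have eq: "(2 ^ k * r) powr (- \<alpha>) = q ^ k * r powr (- \<alpha>)" for k :: nat
      using r by (simp add: q_def powr_mult powr_powr mult.commute flip: powr_realpow)
    have sums: "(\<lambda>k. (2 ^ k * r) powr (- \<alpha>)) sums (1 / (1 - q) * r powr (- \<alpha>))"
      unfolding eq using q by (intro sums_mult2 geometric_sums) auto
    have "(\<integral>\<^sup>+z\<in>{z :: real ^ 'n. r \<le> norm z}. ennreal (norm z powr (- \<alpha> - real CARD('n))) \<partial>lborel)
       \<le> ennreal (2 powr \<bar>- \<alpha>\<bar> * 2 ^ CARD('n) * unit_ball_vol (real CARD('n)) * (\<Sum>k. (2 ^ k * r) powr (- \<alpha>)))"
    proof (rule nn_integral_annuli_le)
      show "summable (\<lambda>k. (2 ^ k * r) powr (- \<alpha>))" using sums by (rule sums_summable)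
      fix z :: "real ^ 'n" assume "z \<in> {z. r \<le> norm z}"
      then have "norm z / r \<ge> 1" using r by simp
      then obtain k :: nat where "2 ^ k \<le> norm z / r" "norm z / r < 2 ^ Suc k" using dyadic_bracket by blast
      then show "\<exists>k. 2 ^ k * r \<le> norm z \<and> norm z \<le> 2 * (2 ^ k * r)" using r by (auto simp: field_simps)
    qed (use r in auto)
    also have "(\<Sum>k. (2 ^ k * r) powr (- \<alpha>)) = 1 / (1 - q) * r powr (- \<alpha>)"
      using sums by (rule sums_unique[symmetric])
    finally show "(\<integral>\<^sup>+z\<in>{z :: real ^ 'n. r \<le> norm z}. ennreal (norm z powr (- \<alpha> - real CARD('n))) \<partial>lborel)
      \<le> ennreal (K * r powr (- \<alpha>))" by (simp add: K_def mult.assoc)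
  qed
qed

lemma ball_powr_integral:
  fixes p :: real
  assumes "p > 0"
  obtains K :: real where "K > 0"
    "\<And>r. r > 0 \<Longrightarrow> (\<integral>\<^sup>+z\<in>{z :: real ^ 'n. norm z \<le> r}. ennreal (norm z powr (p - real CARD('n))) \<partial>lborel)
      \<le> ennreal (K * r powr p)"
proof -
  define q where "q = 2 powr (- p)"
  have q: "0 < q" "q < 1" using assms by (auto simp: q_def powr_less_one)
  define K where "K = 2 powr \<bar>p\<bar> * 2 ^ CARD('n) * unit_ball_vol (real CARD('n)) * (1 / (1 - q))"
  show thesis
  proof (rule that[of K])
    show "K > 0" using q by (auto simp: K_def intro!: mult_pos_pos)
    fix r :: real assume r: "r > 0"
    have eq: "(r / 2 ^ k) powr p = q ^ k * r powr p" for k :: nat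
      using r by (simp add: q_def powr_divide powr_powr powr_minus field_simps power_inverse flip: powr_realpow)
    have sums: "(\<lambda>k. (r / 2 ^ k) powr p) sums (1 / (1 - q) * r powr p)"
      unfolding eq using q by (intro sums_mult2 geometric_sums) auto
    have "(\<integral>\<^sup>+z\<in>{z :: real ^ 'n. norm z \<le> r}. ennreal (norm z powr (p - real CARD('n))) \<partial>lborel)
       \<le> ennreal (2 powr \<bar>p\<bar> * 2 ^ CARD('n) * unit_ball_vol (real CARD('n)) * (\<Sum>k. (r / 2 ^ k) powr p))"
    proof (rule nn_integral_annuli_le)
      show "summable (\<lambda>k. (r / 2 ^ k) powr p)" using sums by (rule sums_summable)
      fix z :: "real ^ 'n" assume "z \<in> {z. norm z \<le> r}" "z \<noteq> 0"
      then have "r / norm z \<ge> 1" and z: "norm z > 0" by auto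
      from this(1) obtain k :: nat where k: "2 ^ k \<le> r / norm z" "r / norm z < 2 ^ Suc k" using dyadic_bracket by blast
      show "\<exists>k. r / 2 ^ k \<le> norm z \<and> norm z \<le> 2 * (r / 2 ^ k)"
      proof (intro exI conjI)
        \<comment> \<open>The index is \<open>Suc k\<close> because the strict upper bracket of
          \<open>r / norm z\<close> becomes the lower bound on \<open>norm z\<close>.\<close>
        show "r / 2 ^ Suc k \<le> norm z" "norm z \<le> 2 * (r / 2 ^ Suc k)" using k z by (auto simp: field_simps)
      qed
    qed (use r in auto)
    also have "(\<Sum>k. (r / 2 ^ k) powr p) = 1 / (1 - q) * r powr p"
      using sums by (rule sums_unique[symmetric])
    finally show "(\<integral>\<^sup>+z\<in>{z :: real ^ 'n. norm z \<le> r}. ennreal (norm z powr (p - real CARD('n))) \<partial>lborel)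
      \<le> ennreal (K * r powr p)" by (simp add: K_def mult.assoc)
  qed
qed

section \<open>Real sequences and Poisson moments\<close>

lemma exp_minus_le:
  fixes x :: real
  assumes "0 \<le> x" "x \<le> 1"
  shows "exp (- x) \<le> 1 - x / 2"
proof -
  have "1 \<le> (1 - x / 2) * (1 + x)" using assms mult_left_mono[of x 1 x] by (simp add: algebra_simps)
  also have "\<dots> \<le> (1 - x / 2) * exp x" using assms by (intro mult_left_mono exp_ge_add_one_self) auto
  finally show ?thesis by (simp add: exp_minus field_simps)
qed

text \<open>The recursion produced by \<open>nash_step\<close>, where \<open>\<tau> = (r/\<epsilon>) powr \<alpha>\<close> is free; the decay comes from taking
  \<open>\<tau>\<close> proportional to \<open>n\<close>.\<close>

lemma nash_recursion:
  fixes c1 c2 \<beta> V :: real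
  assumes c1: "0 < c1" "c1 \<le> 1" and c2: "0 \<le> c2" and b: "0 < \<beta>" and V: "0 \<le> V"
  obtains C where "C > 0"
    "\<And>v n. (\<And>n. v n \<ge> 0) \<Longrightarrow> v 0 \<le> V \<Longrightarrow>
      (\<And>n \<tau>. \<tau> \<ge> 1 \<Longrightarrow> v (Suc n) \<le> (1 - c1 / \<tau>) * v n + c2 * \<tau> powr (- 1 - \<beta>)) \<Longrightarrow>
      v n \<le> C * (1 + real n) powr (- \<beta>)"
proof -
  \<comment> \<open>With \<tau> = N / \<delta> the contraction factor is 1 - (2\<beta> + 2) / N. Of
    this loss 2\<beta> / N pays for passing from \<open>(N - 1) powr (- \<beta>)\<close> to
    \<open>N powr (- \<beta>)\<close>, and the surplus 2 / N pays for the source term.\<close>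
  define \<delta> where "\<delta> = (2 * \<beta> + 2) / c1"
  \<comment> \<open>The choice \<tau> = 1 keeps v below V0 because \<open>c2 \<le> c1 * V0\<close>.
    This covers the early n, for which N / \<delta> would fall below the admissible value 1.\<close>
  define V0 where "V0 = max V (c2 / c1)"
  define C where "C = max (V0 * \<delta> powr \<beta>) (c2 * \<delta> powr (1 + \<beta>)) + 1"
  have d1: "\<delta> \<ge> 1" using c1 b by (simp add: \<delta>_def field_simps)
  have cd: "c1 * \<delta> = 2 * \<beta> + 2" using c1 by (simp add: \<delta>_def)
  have V0: "V0 \<ge> 0" "V \<le> V0" "c2 \<le> c1 * V0"
  proof -
    show "V0 \<ge> 0" "V \<le> V0" using V by (auto simp: V0_def)
    have "c1 * (c2 / c1) \<le> c1 * V0" using c1 by (intro mult_left_mono) (auto simp: V0_def)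
    then show "c2 \<le> c1 * V0" using c1 by simp
  qed
  have C: "C > 0" "V0 * \<delta> powr \<beta> \<le> C" "c2 * \<delta> powr (1 + \<beta>) \<le> C"
    using V0 by (auto simp: C_def intro!: add_nonneg_pos le_max_iff_disj[THEN iffD2])
  show thesis
  proof (rule that[of C])
    fix v :: "nat \<Rightarrow> real" and n
    assume v: "\<And>n. v n \<ge> 0" "v 0 \<le> V"
      "\<And>n \<tau>. \<tau> \<ge> 1 \<Longrightarrow> v (Suc n) \<le> (1 - c1 / \<tau>) * v n + c2 * \<tau> powr (- 1 - \<beta>)"
    have vV0: "v n \<le> V0" for n
    proof (induction n)
      case (Suc n)
      have "v (Suc n) \<le> (1 - c1) * v n + c2" using v(3)[of 1 n] by simp
      also have "\<dots> \<le> (1 - c1) * V0 + c1 * V0" using Suc c1 V0 by (intro add_mono mult_left_mono) auto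
      finally show ?case by (simp add: algebra_simps)
    qed (use v V0 in simp)
    have small: "v n \<le> C * (1 + real n) powr (- \<beta>)" if "1 + real n \<le> \<delta>" for n
    proof -
      have "V0 * 1 \<le> V0 * (\<delta> powr \<beta> * (1 + real n) powr (- \<beta>))"
      proof (intro mult_left_mono V0)
        have "(1 + real n) powr \<beta> \<le> \<delta> powr \<beta>" using that b by (intro powr_mono2) auto
        then show "1 \<le> \<delta> powr \<beta> * (1 + real n) powr (- \<beta>)" by (simp add: powr_minus field_simps)
      qed
      also have "\<dots> \<le> C * (1 + real n) powr (- \<beta>)"
        using C(2) by (simp add: mult_right_mono flip: mult.assoc)
      finally show ?thesis using vV0[of n] by simp
    qed
    show "v n \<le> C * (1 + real n) powr (- \<beta>)"
    proof (induction n)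
      case 0
      then show ?case using small[of 0] d1 by simp
    next
      case (Suc n)
      show ?case
      proof (cases "1 + real (Suc n) \<le> \<delta>")
        case True
        then show ?thesis by (rule small)
      next
        case False
        define N where "N = 1 + real (Suc n)"
        have N: "N \<ge> 2" "N > \<delta>" "1 + real n = N - 1" using False by (auto simp: N_def)
        define E where "E = N powr (- \<beta>)"
        have E: "E > 0" using N by (simp add: E_def)
        have "v (Suc n) \<le> (1 - c1 / (N / \<delta>)) * v n + c2 * (N / \<delta>) powr (- 1 - \<beta>)"
          using N d1 by (intro v) auto
        also have "c1 / (N / \<delta>) = (2 * \<beta> + 2) / N" using cd by simp
        also have "c2 * (N / \<delta>) powr (- 1 - \<beta>) = (c2 * \<delta> powr (1 + \<beta>)) * (E / N)"
        proof -
          have e: "- 1 - \<beta> = - (1 + \<beta>)" by simp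
          show ?thesis using N d1
            unfolding e E_def powr_minus by (simp add: powr_divide powr_add field_simps)
        qed
        also have "\<dots> \<le> C * (E / N)" using C E N by (intro mult_right_mono) auto
        also have "(1 - (2 * \<beta> + 2) / N) * v n \<le> exp (- ((2 * \<beta> + 2) / N)) * (C * (E * exp (2 * \<beta> / N)))"
        proof (intro mult_mono)
          show "1 - (2 * \<beta> + 2) / N \<le> exp (- ((2 * \<beta> + 2) / N))"
            using exp_ge_add_one_self[of "- ((2 * \<beta> + 2) / N)"] by simp
          have "(N / (N - 1)) powr \<beta> \<le> exp (2 * \<beta> / N)"
          proof -
            have "ln (N / (N - 1)) \<le> N / (N - 1) - 1" using N by (intro ln_le_minus_one) auto
            also have "\<dots> \<le> 2 / N" using N by (simp add: field_simps)
            finally have "\<beta> * ln (N / (N - 1)) \<le> \<beta> * (2 / N)" using b by (intro mult_left_mono) auto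
            then show ?thesis using N by (simp add: powr_def mult.commute)
          qed
          then have "E * (N / (N - 1)) powr \<beta> \<le> E * exp (2 * \<beta> / N)" using E by (intro mult_left_mono) auto
          moreover have "E * (N / (N - 1)) powr \<beta> = (1 + real n) powr (- \<beta>)"
            using N(1) unfolding N(3) by (simp add: E_def powr_minus powr_divide field_simps)
          ultimately have "C * (1 + real n) powr (- \<beta>) \<le> C * (E * exp (2 * \<beta> / N))"
            using C(1) by (intro mult_left_mono) auto
          with Suc show "v n \<le> C * (E * exp (2 * \<beta> / N))" by linarith
        qed (use v in auto)
        also have "exp (- ((2 * \<beta> + 2) / N)) * (C * (E * exp (2 * \<beta> / N))) = C * E * exp (- (2 / N))"
        proof -
          have "- ((2 * \<beta> + 2) / N) + 2 * \<beta> / N = - (2 / N)" using N by (simp add: field_simps)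
          then have "exp (- ((2 * \<beta> + 2) / N)) * exp (2 * \<beta> / N) = exp (- (2 / N))"
            by (simp flip: exp_add)
          then show ?thesis by (metis mult.assoc mult.commute)
        qed
        \<comment> \<open>Here 2 / N is at most 1. The gain C * E / N is exactly the bound on the
          source term.\<close>
        also have "C * E * exp (- (2 / N)) \<le> C * E * (1 - (2 / N) / 2)"
          using N C E by (intro mult_left_mono exp_minus_le) auto
        finally have "v (Suc n) \<le> C * E" using N by (simp add: field_simps)
        then show ?thesis by (simp add: E_def N_def)
      qed
    qed
  qed (fact C)
qed

lemma powr_le_geometric:
  fixes \<theta> \<beta> :: real
  assumes th: "0 < \<theta>" "\<theta> < 1" and b: "0 < \<beta>"
  obtains B where "B > 0" "\<And>i. (1 + real i) powr \<beta> * \<theta> ^ i \<le> B * sqrt \<theta> ^ i"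
proof -
  \<comment> \<open>Chosen so that \<open>exp (s * \<beta>) * \<theta> = sqrt \<theta>\<close>: half
    of the geometric decay absorbs the polynomial.\<close>
  define s where "s = - ln \<theta> / (2 * \<beta>)"
  have s: "s > 0" using th b by (simp add: s_def field_simps)
  show thesis
  proof (rule that[of "s powr (- \<beta>) * exp (s * \<beta>)"])
    fix i :: nat
    have "s * (1 + real i) \<le> exp (s * (1 + real i))"
      using exp_ge_add_one_self[of "s * (1 + real i)"] by linarith
    then have "(s * (1 + real i)) powr \<beta> \<le> exp (s * (1 + real i)) powr \<beta>"
      using s b by (intro powr_mono2) auto
    then have "s powr \<beta> * (1 + real i) powr \<beta> \<le> exp (s * \<beta> * (1 + real i))"
      using s by (simp add: powr_mult exp_powr_real mult_ac)
    then have "(1 + real i) powr \<beta> \<le> s powr (- \<beta>) * exp (s * \<beta>) * exp (s * \<beta>) ^ i"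
    proof -
      have "exp (s * \<beta> * (1 + real i)) = exp (s * \<beta>) * exp (s * \<beta>) ^ i"
        by (simp add: distrib_left exp_add exp_of_nat2_mult)
      then show ?thesis using \<open>s powr \<beta> * _ \<le> _\<close> s by (simp add: powr_minus field_simps)
    qed
    moreover have "exp (s * \<beta>) * \<theta> = sqrt \<theta>"
    proof -
      have "exp (s * \<beta>) * \<theta> = exp (ln \<theta> / 2)"
      proof -
        have "exp (s * \<beta>) * \<theta> = exp (s * \<beta> + ln \<theta>)" using th by (simp add: exp_add)
        also have "s * \<beta> + ln \<theta> = ln \<theta> / 2" using b by (simp add: s_def)
        finally show ?thesis .
      qed
      also have "\<dots> = sqrt \<theta>" using th by (simp flip: ln_sqrt)
      finally show ?thesis .
    qed
    ultimately have "(1 + real i) powr \<beta> * \<theta> ^ i \<le> s powr (- \<beta>) * exp (s * \<beta>) * exp (s * \<beta>) ^ i * \<theta> ^ i"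
      using th by (intro mult_right_mono) auto
    also have "\<dots> = s powr (- \<beta>) * exp (s * \<beta>) * (exp (s * \<beta>) * \<theta>) ^ i"
      by (simp add: power_mult_distrib)
    finally show "(1 + real i) powr \<beta> * \<theta> ^ i \<le> s powr (- \<beta>) * exp (s * \<beta>) * sqrt \<theta> ^ i"
      using \<open>exp (s * \<beta>) * \<theta> = sqrt \<theta>\<close> by simp
  qed (use s in auto)
qed

text \<open>For i < n one has n \<le> (1 + i)(n - i), so replacing n - i by n costs only a power of
  1 + i, which the geometric weight absorbs. The sum is the one that arises when a chain with
  staying probability at most \<theta> is expanded at its first jump.\<close>

lemma geometric_convolution_powr:
  fixes \<theta> \<beta> :: real
  assumes th: "0 < \<theta>" "\<theta> < 1" and b: "0 < \<beta>"
  obtains B where "B > 0" "\<And>n. \<theta> ^ n \<le> B * (1 + real n) powr (- \<beta>)"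
    "\<And>n. (\<Sum>i<n. \<theta> ^ i * real (n - i) powr (- \<beta>)) \<le> B * real n powr (- \<beta>)"
proof -
  obtain B0 where B0: "B0 > 0" "\<And>i. (1 + real i) powr \<beta> * \<theta> ^ i \<le> B0 * sqrt \<theta> ^ i"
    using powr_le_geometric[OF assms] by blast
  have q: "0 < sqrt \<theta>" "sqrt \<theta> < 1" using th by auto
  define B where "B = B0 * (1 / (1 - sqrt \<theta>))"
  have geo: "(\<Sum>i<n. sqrt \<theta> ^ i) \<le> 1 / (1 - sqrt \<theta>)" for n
    using sum_le_suminf[OF summable_geometric, of "sqrt \<theta>" "{..<n}"] suminf_geometric[of "sqrt \<theta>"] q by simp
  show thesis
  proof (rule that[of B])
    show "B > 0" using B0 q by (simp add: B_def)
    fix n :: nat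
    have "B0 * sqrt \<theta> ^ n \<le> B0 * (1 / (1 - sqrt \<theta>))"
    proof (intro mult_left_mono)
      have "sqrt \<theta> ^ n \<le> 1" using q by (intro power_le_one) auto
      also have "1 \<le> 1 / (1 - sqrt \<theta>)" using q by simp
      finally show "sqrt \<theta> ^ n \<le> 1 / (1 - sqrt \<theta>)" .
    qed (use B0 in auto)
    then have "(1 + real n) powr \<beta> * \<theta> ^ n \<le> B" using B0(2)[of n] by (simp add: B_def)
    then show "\<theta> ^ n \<le> B * (1 + real n) powr (- \<beta>)"
      by (simp add: powr_minus field_simps)
    have "(\<Sum>i<n. \<theta> ^ i * real (n - i) powr (- \<beta>)) \<le> (\<Sum>i<n. real n powr (- \<beta>) * (B0 * sqrt \<theta> ^ i))"
    proof (intro sum_mono)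
      fix i assume "i \<in> {..<n}"
      then have i: "i < n" by simp
      have "real n \<le> (1 + real i) * real (n - i)"
      proof -
        have "1 * real i \<le> real (n - i) * real i" using i by (intro mult_right_mono) auto
        then show ?thesis using i by (simp add: algebra_simps of_nat_diff)
      qed
      then have "real n powr \<beta> \<le> ((1 + real i) * real (n - i)) powr \<beta>" using b by (intro powr_mono2) auto
      then have "real (n - i) powr (- \<beta>) \<le> real n powr (- \<beta>) * (1 + real i) powr \<beta>"
        unfolding powr_mult using i by (simp add: powr_minus divide_simps mult_ac del: of_nat_diff)
      then have "\<theta> ^ i * real (n - i) powr (- \<beta>) \<le> \<theta> ^ i * (real n powr (- \<beta>) * (1 + real i) powr \<beta>)"
        using th by (intro mult_left_mono) auto
      also have "\<dots> = real n powr (- \<beta>) * ((1 + real i) powr \<beta> * \<theta> ^ i)" by (simp add: mult_ac)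
      also have "\<dots> \<le> real n powr (- \<beta>) * (B0 * sqrt \<theta> ^ i)" by (intro mult_left_mono B0) auto
      finally show "\<theta> ^ i * real (n - i) powr (- \<beta>) \<le> \<dots>" .
    qed
    also have "\<dots> = real n powr (- \<beta>) * (B0 * (\<Sum>i<n. sqrt \<theta> ^ i))" by (simp add: sum_distrib_left)
    also have "\<dots> \<le> real n powr (- \<beta>) * B" unfolding B_def using B0 by (intro mult_left_mono geo) auto
    finally show "(\<Sum>i<n. \<theta> ^ i * real (n - i) powr (- \<beta>)) \<le> B * real n powr (- \<beta>)" by (simp add: mult.commute)
  qed
qed

section \<open>Poisson moments\<close>

lemma poisson_sums: "(\<lambda>n. exp (- s) * s ^ n / fact n) sums (1 :: real)"
  using sums_mult[OF exp_converges[of s], of "exp (- s)"] by (simp add: exp_minus field_simps)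

lemma poisson_mean: "(\<lambda>n. exp (- s) * s ^ n / fact n * real n) sums (s :: real)"
proof -
  have "exp (- s) * s ^ Suc n / fact (Suc n) * real (Suc n) = s * (exp (- s) * s ^ n / fact n)" for n
    by (simp add: field_simps del: of_nat_Suc)
  then have "(\<lambda>n. exp (- s) * s ^ Suc n / fact (Suc n) * real (Suc n)) sums (s * 1)"
    by (simp only: sums_mult[OF poisson_sums])
  from sums_Suc[OF this] show ?thesis by simp
qed

lemma fact_add_le: "fact (n + m) \<le> (fact n * (real (n + m)) ^ m :: real)"
proof (induction m)
  case (Suc m)
  have "fact (n + Suc m) = real (n + Suc m) * fact (n + m)" by simp
  also have "\<dots> \<le> real (n + Suc m) * (fact n * real (n + m) ^ m)" by (intro mult_left_mono Suc) auto
  also have "\<dots> \<le> real (n + Suc m) * (fact n * real (n + Suc m) ^ m)"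
    by (intro mult_left_mono power_mono) auto
  finally show ?case by (simp add: mult_ac)
qed simp

text \<open>The term with \<open>n = 0\<close> vanishes since \<open>0 powr _ = 0\<close>.\<close>

lemma poisson_negative_moment:
  fixes \<beta> :: real
  assumes b: "0 < \<beta>"
  obtains C where "C > 0" "\<And>s. s > 0 \<Longrightarrow> summable (\<lambda>n. exp (- s) * s ^ n / fact n * real n powr (- \<beta>))"
    "\<And>s. s > 0 \<Longrightarrow> (\<Sum>n. exp (- s) * s ^ n / fact n * real n powr (- \<beta>)) \<le> C * s powr (- \<beta>)"
proof -
  define m where "m = nat \<lceil>\<beta>\<rceil>"
  have m: "\<beta> \<le> real m" using b by (simp add: m_def)
  define c where "c = real (m + 1) ^ m"
  have c: "c \<ge> 1" by (simp add: c_def)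
  have *: "summable (\<lambda>n. exp (- s) * s ^ n / fact n * real n powr (- \<beta>)) \<and>
    (\<Sum>n. exp (- s) * s ^ n / fact n * real n powr (- \<beta>)) \<le> (1 + c) * s powr (- \<beta>)" if s: "s > 0" for s
  proof -
    define p where "p n = exp (- s) * s ^ n / fact n" for n
    have p0: "p n \<ge> 0" for n using s by (simp add: p_def)
    have ps: "p sums 1" using poisson_sums[of s] by (simp add: p_def[abs_def])
    have sp: "summable p" using ps by (rule sums_summable)
    have sm: "summable (\<lambda>n. p (n + m))" using sp by (simp add: summable_iff_shift)
    have tail: "(\<Sum>n. p (n + m)) \<le> 1"
      using suminf_minus_initial_segment[OF sp, of m] sums_unique[OF ps] p0 sum_nonneg[of "{..<m}" p] by simp
    \<comment> \<open>The negative power equals \<open>s powr (- \<beta>)\<close> times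
      \<open>(s / n) powr \<beta>\<close>, and the latter is at most 1 + (s / n) ^ m. The m-th power
      merely shifts the Poisson weights: p n * (s / n) ^ m is p (n + m) times (n + m)! / (n! n ^ m),
      and this ratio is at most (m + 1) ^ m once n \<ge> 1.\<close>
    have le: "p n * real n powr (- \<beta>) \<le> s powr (- \<beta>) * (p n + c * p (n + m))" for n
    proof (cases "n = 0")
      case True
      then show ?thesis using p0 c by simp
    next
      case False
      have "(s / n) powr \<beta> \<le> 1 + (s / n) ^ m"
      proof (cases "s / n \<le> 1")
        case True
        then have "(s / n) powr \<beta> \<le> 1" using s b False by (intro powr_le1) auto
        moreover have "0 \<le> (s / n) ^ m" using s by simp
        ultimately show ?thesis by linarith
      next
        case f: False
        then have "(s / n) powr \<beta> \<le> (s / n) powr real m" using m by (intro powr_mono) auto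
        then show ?thesis using s f by (simp add: powr_realpow)
      qed
      note moment = this
      have mth: "p n * (s / n) ^ m \<le> c * p (n + m)"
      proof -
        have "fact (n + m) \<le> fact n * real (n + m) ^ m" by (rule fact_add_le)
        also have "\<dots> \<le> fact n * (real (m + 1) * real n) ^ m"
        proof (intro mult_left_mono power_mono)
          have "real m * 1 \<le> real m * real n" using False by (intro mult_left_mono) auto
          then show "real (n + m) \<le> real (m + 1) * real n" by (simp add: algebra_simps)
        qed auto
        finally have "fact (n + m) \<le> c * (fact n * real n ^ m)" by (simp add: c_def power_mult_distrib mult_ac)
        then have "exp (- s) * s ^ (n + m) * fact (n + m) \<le> exp (- s) * s ^ (n + m) * (c * (fact n * real n ^ m))"
          using s by (intro mult_left_mono) auto
        then show ?thesis using False unfolding p_def by (simp add: field_simps power_add)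
      qed
      have "p n * real n powr (- \<beta>) = s powr (- \<beta>) * p n * (s / n) powr \<beta>"
        using s False by (simp add: powr_divide powr_minus field_simps)
      also have "\<dots> \<le> s powr (- \<beta>) * p n * (1 + (s / n) ^ m)"
        using p0 by (intro mult_left_mono moment) auto
      also have "\<dots> = s powr (- \<beta>) * (p n + p n * (s / n) ^ m)"
        by (simp only: mult.assoc distrib_left mult_1_right)
      also have "\<dots> \<le> s powr (- \<beta>) * (p n + c * p (n + m))"
        using mth by (intro mult_left_mono add_left_mono) auto
      finally show ?thesis .
    qed
    have sR: "summable (\<lambda>n. s powr (- \<beta>) * (p n + c * p (n + m)))"
      by (intro summable_mult summable_add sp sm)
    have sL: "summable (\<lambda>n. p n * real n powr (- \<beta>))"
      by (rule summable_comparison_test'[OF sR, of 0]) (use le p0 in auto)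
    have "(\<Sum>n. p n * real n powr (- \<beta>)) \<le> (\<Sum>n. s powr (- \<beta>) * (p n + c * p (n + m)))"
      by (intro suminf_le le sL sR)
    also have "\<dots> = s powr (- \<beta>) * ((\<Sum>n. p n) + c * (\<Sum>n. p (n + m)))"
      by (simp add: suminf_mult suminf_add[symmetric] sp sm summable_mult summable_add)
    also have "\<dots> \<le> s powr (- \<beta>) * (1 + c * 1)"
      using tail c sums_unique[OF ps] by (intro mult_left_mono add_mono) auto
    finally show ?thesis using sL by (simp add: p_def mult_ac)
  qed
  show thesis by (rule that[of "1 + c"]) (use * c in auto)
qed

section \<open>Symmetric jump operators\<close>

lemma ennreal_two_mult_le: "2 * (x * y) \<le> x * x + y * (y :: ennreal)"
proof (cases "x = top \<or> y = top")
  case False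
  then obtain u v where "x = ennreal u" "y = ennreal v" "0 \<le> u" "0 \<le> v"
    by (cases x; cases y) auto
  moreover have "2 * (u * v) \<le> u * u + v * v"
    using sum_squares_bound[of u v] by (simp add: power2_eq_square)
  ultimately show ?thesis
    by (simp flip: ennreal_mult ennreal_plus ennreal_numeral add: ennreal_leI)
qed auto

text \<open>D is the weight of the atom at x, j the density of the rest. Values in
  \<open>ennreal\<close> make the operator meaningful on every nonnegative Borel function, including
  exponentially growing weights, without integrability conditions.\<close>

definition jump_op :: "('a::euclidean_space \<Rightarrow> ennreal) \<Rightarrow> ('a \<Rightarrow> 'a \<Rightarrow> ennreal) \<Rightarrow> ('a \<Rightarrow> ennreal) \<Rightarrow> 'a \<Rightarrow> ennreal"
  where "jump_op D j \<phi> x = D x * \<phi> x + (\<integral>\<^sup>+y. j x y * \<phi> y \<partial>lborel)"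

text \<open>The total mass is at most 1 rather than equal to 1, so that kernels with their long
  jumps removed are instances again.\<close>

locale symmetric_jump =
  fixes D :: "'a::euclidean_space \<Rightarrow> ennreal" and j :: "'a \<Rightarrow> 'a \<Rightarrow> ennreal"
  assumes D_measurable [measurable]: "D \<in> borel_measurable borel"
    and j_measurable [measurable]: "(\<lambda>(x, y). j x y) \<in> borel_measurable (borel \<Otimes>\<^sub>M borel)"
    and j_sym: "j x y = j y x"
    and mass_le_1: "D x + (\<integral>\<^sup>+y. j x y \<partial>lborel) \<le> 1"
begin

abbreviation T :: "('a \<Rightarrow> ennreal) \<Rightarrow> 'a \<Rightarrow> ennreal" where "T \<equiv> jump_op D j"

lemma j_measurable1 [measurable]: "j x \<in> borel_measurable borel"
  using measurable_compose[OF measurable_Pair1' j_measurable, of x] by simp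

lemma T_measurable [measurable]:
  assumes [measurable]: "\<phi> \<in> borel_measurable borel"
  shows "T \<phi> \<in> borel_measurable borel"
  unfolding jump_op_def by measurable

lemma Tn_measurable [measurable]:
  "\<phi> \<in> borel_measurable borel \<Longrightarrow> (T ^^ n) \<phi> \<in> borel_measurable borel"
  by (induction n) (auto intro: T_measurable)

lemma T_mono: "(\<And>y. \<phi> y \<le> \<psi> y) \<Longrightarrow> T \<phi> x \<le> T \<psi> x"
  unfolding jump_op_def by (intro add_mono mult_left_mono nn_integral_mono) auto

lemma Tn_mono: "(\<And>y. \<phi> y \<le> \<psi> y) \<Longrightarrow> (T ^^ n) \<phi> x \<le> (T ^^ n) \<psi> x"
  by (induction n arbitrary: x) (auto intro: T_mono)

lemma T_suminf:
  assumes [measurable]: "\<And>i. \<phi> i \<in> borel_measurable borel"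
  shows "T (\<lambda>y. \<Sum>i. \<phi> i y) x = (\<Sum>i. T (\<phi> i) x)"
  unfolding jump_op_def ennreal_suminf_cmult[symmetric]
  by (subst nn_integral_suminf) (auto simp: suminf_add summableI simp del: ennreal_suminf_cmult)

lemma Tn_suminf:
  assumes "\<And>i. \<phi> i \<in> borel_measurable borel"
  shows "(T ^^ n) (\<lambda>y. \<Sum>i. \<phi> i y) x = (\<Sum>i. (T ^^ n) (\<phi> i) x)"
proof (induction n arbitrary: x)
  case (Suc n)
  have "(T ^^ n) (\<lambda>y. \<Sum>i. \<phi> i y) = (\<lambda>y. \<Sum>i. (T ^^ n) (\<phi> i) y)"
    using Suc by auto
  then show ?case using assms by (simp add: T_suminf)
qed simp

lemma T_add:
  assumes [measurable]: "\<phi> \<in> borel_measurable borel" "\<psi> \<in> borel_measurable borel"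
  shows "T (\<lambda>y. \<phi> y + \<psi> y) x = T \<phi> x + T \<psi> x"
  unfolding jump_op_def by (simp add: distrib_left nn_integral_add add_ac)

lemma Tn_add:
  assumes "\<phi> \<in> borel_measurable borel" "\<psi> \<in> borel_measurable borel"
  shows "(T ^^ n) (\<lambda>y. \<phi> y + \<psi> y) x = (T ^^ n) \<phi> x + (T ^^ n) \<psi> x"
proof (induction n arbitrary: x)
  case (Suc n)
  have "(T ^^ n) (\<lambda>y. \<phi> y + \<psi> y) = (\<lambda>y. (T ^^ n) \<phi> y + (T ^^ n) \<psi> y)"
    using Suc by auto
  then show ?case using assms by (simp add: T_add)
qed simp

lemma T_cmult:
  assumes [measurable]: "\<phi> \<in> borel_measurable borel"
  shows "T (\<lambda>y. c * \<phi> y) x = c * T \<phi> x"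
proof -
  have "(\<integral>\<^sup>+y. j x y * (c * \<phi> y) \<partial>lborel) = c * (\<integral>\<^sup>+y. j x y * \<phi> y \<partial>lborel)"
    by (subst nn_integral_cmult[symmetric]) (auto simp: mult_ac)
  then show ?thesis unfolding jump_op_def by (simp add: distrib_left mult_ac)
qed

lemma Tn_cmult:
  assumes "\<phi> \<in> borel_measurable borel"
  shows "(T ^^ n) (\<lambda>y. c * \<phi> y) x = c * (T ^^ n) \<phi> x"
proof (induction n arbitrary: x)
  case (Suc n)
  have "(T ^^ n) (\<lambda>y. c * \<phi> y) = (\<lambda>y. c * (T ^^ n) \<phi> y)"
    using Suc by auto
  then show ?case using assms by (simp add: T_cmult)
qed simp

lemma T_le_const:
  assumes "\<And>y. \<phi> y \<le> c"
  shows "T \<phi> x \<le> c"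
proof -
  have "T \<phi> x \<le> D x * c + (\<integral>\<^sup>+y. j x y * c \<partial>lborel)"
    unfolding jump_op_def using assms by (intro add_mono mult_left_mono nn_integral_mono) auto
  also have "\<dots> = (D x + (\<integral>\<^sup>+y. j x y \<partial>lborel)) * c"
    by (simp add: nn_integral_multc distrib_right)
  also have "\<dots> \<le> 1 * c" using mass_le_1 by (rule mult_right_mono) simp
  finally show ?thesis by simp
qed

lemma Tn_le_const: "(\<And>y. \<phi> y \<le> c) \<Longrightarrow> (T ^^ n) \<phi> x \<le> c"
  by (induction n arbitrary: x) (auto intro: T_le_const)

lemma T_symmetric:
  assumes [measurable]: "\<phi> \<in> borel_measurable borel" "\<psi> \<in> borel_measurable borel"
  shows "(\<integral>\<^sup>+x. \<psi> x * T \<phi> x \<partial>lborel) = (\<integral>\<^sup>+x. \<phi> x * T \<psi> x \<partial>lborel)"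
proof -
  have *: "(\<integral>\<^sup>+x. \<psi> x * T \<phi> x \<partial>lborel) = (\<integral>\<^sup>+x. D x * \<phi> x * \<psi> x \<partial>lborel)
      + (\<integral>\<^sup>+x. \<integral>\<^sup>+y. \<psi> x * j x y * \<phi> y \<partial>lborel \<partial>lborel)"
    if [measurable]: "\<phi> \<in> borel_measurable borel" "\<psi> \<in> borel_measurable borel" for \<phi> \<psi>
    unfolding jump_op_def distrib_left
    by (subst nn_integral_add) (auto simp: mult_ac nn_integral_cmult[symmetric])
  have "(\<integral>\<^sup>+x. \<integral>\<^sup>+y. \<psi> x * j x y * \<phi> y \<partial>lborel \<partial>lborel) = (\<integral>\<^sup>+y. \<integral>\<^sup>+x. \<psi> x * j x y * \<phi> y \<partial>lborel \<partial>lborel)"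
    by (rule lborel_pair.Fubini'[symmetric]) measurable
  also have "\<dots> = (\<integral>\<^sup>+x. \<integral>\<^sup>+y. \<phi> x * j x y * \<psi> y \<partial>lborel \<partial>lborel)"
    by (simp add: mult_ac j_sym)
  finally show ?thesis using *[of \<phi> \<psi>] *[of \<psi> \<phi>] by (simp add: mult_ac)
qed

lemma Tn_symmetric:
  assumes "\<phi> \<in> borel_measurable borel" "\<psi> \<in> borel_measurable borel"
  shows "(\<integral>\<^sup>+x. \<psi> x * (T ^^ n) \<phi> x \<partial>lborel) = (\<integral>\<^sup>+x. \<phi> x * (T ^^ n) \<psi> x \<partial>lborel)"
  using assms
proof (induction n arbitrary: \<phi> \<psi>)
  case (Suc n)
  have "(\<integral>\<^sup>+x. \<psi> x * (T ^^ Suc n) \<phi> x \<partial>lborel) = (\<integral>\<^sup>+x. (T ^^ n) \<phi> x * T \<psi> x \<partial>lborel)"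
    using Suc.prems by (simp add: T_symmetric)
  also have "\<dots> = (\<integral>\<^sup>+x. T \<psi> x * (T ^^ n) \<phi> x \<partial>lborel)" by (simp add: mult.commute)
  also have "\<dots> = (\<integral>\<^sup>+x. \<phi> x * (T ^^ n) (T \<psi>) x \<partial>lborel)"
    using Suc.prems by (intro Suc.IH) auto
  finally show ?case by (simp add: funpow_swap1)
qed (simp add: mult.commute)

text \<open>Contraction in L1 is dual to contraction in the supremum norm: symmetry moves the powers
  of T onto the constant 1.\<close>

lemma nn_integral_Tn_le:
  assumes "\<phi> \<in> borel_measurable borel"
  shows "(\<integral>\<^sup>+x. (T ^^ n) \<phi> x \<partial>lborel) \<le> (\<integral>\<^sup>+x. \<phi> x \<partial>lborel)"
proof -
  have "(\<integral>\<^sup>+x. (T ^^ n) \<phi> x \<partial>lborel) = (\<integral>\<^sup>+x. \<phi> x * (T ^^ n) (\<lambda>_. 1) x \<partial>lborel)"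
    using Tn_symmetric[of \<phi> "\<lambda>_. 1" n] assms by simp
  also have "\<dots> \<le> (\<integral>\<^sup>+x. \<phi> x * 1 \<partial>lborel)"
    by (intro nn_integral_mono mult_left_mono Tn_le_const) auto
  finally show ?thesis by simp
qed

text \<open>Schur test for the form \<open>\<langle>T \<phi>, \<psi>\<rangle>\<close>.\<close>

lemma two_pairing_le:
  assumes [measurable]: "\<phi> \<in> borel_measurable borel" "\<psi> \<in> borel_measurable borel"
    and c: "\<And>x. D x + (\<integral>\<^sup>+y. j x y \<partial>lborel) \<le> c"
  shows "2 * (\<integral>\<^sup>+x. \<psi> x * T \<phi> x \<partial>lborel)
    \<le> c * ((\<integral>\<^sup>+x. \<phi> x * \<phi> x \<partial>lborel) + (\<integral>\<^sup>+x. \<psi> x * \<psi> x \<partial>lborel))"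
proof -
  let ?q = "\<lambda>x. \<phi> x * \<phi> x" and ?p = "\<lambda>x. \<psi> x * \<psi> x"
  have T1: "T (\<lambda>_. 1) x \<le> c" for x using c[of x] by (simp add: jump_op_def)
  have "2 * (\<psi> x * T \<phi> x) \<le> T ?q x + ?p x * T (\<lambda>_. 1) x" for x
  proof -
    have "2 * (\<psi> x * T \<phi> x) = D x * (2 * (\<phi> x * \<psi> x)) + (\<integral>\<^sup>+y. j x y * (2 * (\<phi> y * \<psi> x)) \<partial>lborel)"
      by (simp add: jump_op_def distrib_left mult_ac flip: nn_integral_cmult)
    also have "\<dots> \<le> D x * (?q x + ?p x) + (\<integral>\<^sup>+y. j x y * (?q y + ?p x) \<partial>lborel)"
      by (intro add_mono mult_left_mono nn_integral_mono ennreal_two_mult_le) auto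
    also have "\<dots> = T ?q x + ?p x * T (\<lambda>_. 1) x"
    proof -
      have "(\<integral>\<^sup>+y. j x y * (?q y + ?p x) \<partial>lborel)
          = (\<integral>\<^sup>+y. j x y * ?q y \<partial>lborel) + (\<integral>\<^sup>+y. j x y \<partial>lborel) * ?p x"
        unfolding distrib_left by (subst nn_integral_add) (auto simp: nn_integral_multc)
      then show ?thesis by (simp add: jump_op_def distrib_left add_ac mult.commute[of "?p x"] distrib_right)
    qed
    finally show ?thesis .
  qed
  then have "(\<integral>\<^sup>+x. 2 * (\<psi> x * T \<phi> x) \<partial>lborel) \<le> (\<integral>\<^sup>+x. T ?q x + ?p x * T (\<lambda>_. 1) x \<partial>lborel)"
    by (rule nn_integral_mono)
  also have "\<dots> = (\<integral>\<^sup>+x. 1 * T ?q x \<partial>lborel) + (\<integral>\<^sup>+x. ?p x * T (\<lambda>_. 1) x \<partial>lborel)"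
    by (subst nn_integral_add) auto
  \<comment> \<open>Symmetry makes the row bound c serve as the column bound as well.\<close>
  also have "(\<integral>\<^sup>+x. 1 * T ?q x \<partial>lborel) = (\<integral>\<^sup>+x. ?q x * T (\<lambda>_. 1) x \<partial>lborel)"
    by (rule T_symmetric) auto
  also have "\<dots> + (\<integral>\<^sup>+x. ?p x * T (\<lambda>_. 1) x \<partial>lborel) \<le> (\<integral>\<^sup>+x. ?q x * c \<partial>lborel) + (\<integral>\<^sup>+x. ?p x * c \<partial>lborel)"
    by (intro add_mono nn_integral_mono mult_left_mono T1) auto
  also have "\<dots> = c * ((\<integral>\<^sup>+x. ?q x \<partial>lborel) + (\<integral>\<^sup>+x. ?p x \<partial>lborel))"
    by (subst (1 2) nn_integral_multc) (auto simp: distrib_left mult.commute)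
  finally show ?thesis by (simp add: nn_integral_cmult)
qed

text \<open>The index i counts the stays at x before the first jump. Only the term without a jump is
  singular; in every other term the remaining powers are integrated against the density
  \<open>j x\<close>.\<close>

lemma Tn_Duhamel:
  "(T ^^ n) \<phi> x = D x ^ n * \<phi> x + (\<Sum>i<n. D x ^ i * (\<integral>\<^sup>+y. j x y * (T ^^ (n - Suc i)) \<phi> y \<partial>lborel))"
proof (induction n)
  case (Suc n)
  have "(T ^^ Suc n) \<phi> x = D x * (T ^^ n) \<phi> x + (\<integral>\<^sup>+y. j x y * (T ^^ n) \<phi> y \<partial>lborel)"
    by (simp add: jump_op_def)
  then show ?case
    unfolding Suc by (simp add: sum.lessThan_Suc_shift distrib_left sum_distrib_left mult_ac add_ac
        del: sum.lessThan_Suc)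
qed simp

end

section \<open>On-diagonal bound\<close>

text \<open>Lengths are measured in units of \<epsilon>: beyond \<epsilon> the majorant of j has
  mass of order one, so m and a are pure numbers. At r = \<epsilon> the lower bound on the tails
  keeps the staying probability below 1 - a, and at larger r it drives the L2 decay.\<close>

locale stable_jump = symmetric_jump D j
  for D :: "real ^ 'n \<Rightarrow> ennreal" and j :: "real ^ 'n \<Rightarrow> real ^ 'n \<Rightarrow> ennreal" +
  fixes \<alpha> m a \<epsilon> :: real
  assumes alpha: "0 < \<alpha>" "\<alpha> < 2" and m: "0 < m" and a: "0 < a" "a \<le> 1 / 2" and eps: "0 < \<epsilon>"
    and mass: "D x + (\<integral>\<^sup>+y. j x y \<partial>lborel) = 1"
    and j_near: "norm (y - x) < \<epsilon> \<Longrightarrow> j x y = 0"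
    and j_le: "\<epsilon> \<le> norm (y - x) \<Longrightarrow> j x y \<le> ennreal (m * \<epsilon> powr \<alpha> * norm (y - x) powr (- \<alpha> - real CARD('n)))"
    and tail_ge: "\<epsilon> \<le> r \<Longrightarrow> ennreal (a * (\<epsilon> / r) powr \<alpha>) \<le> (\<integral>\<^sup>+y\<in>{y. r < norm (y - x)}. j x y \<partial>lborel)"
    and balance: "(\<forall>x h. j x (x + h) = j x (x - h)) \<or> \<alpha> < 1"
begin

lemma j_le_radius:
  assumes "0 < r" "r \<le> norm (y - x)"
  shows "j x y \<le> ennreal (m * \<epsilon> powr \<alpha> * r powr (- \<alpha> - real CARD('n)))"
proof (cases "\<epsilon> \<le> norm (y - x)")
  case True
  have "norm (y - x) powr (- \<alpha> - real CARD('n)) \<le> r powr (- \<alpha> - real CARD('n))"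
    using assms alpha by (intro powr_mono2') auto
  then show ?thesis using m
    by (intro order.trans[OF j_le[OF True]] ennreal_leI mult_left_mono) auto
qed (simp add: j_near)

lemma j_bound: "j x y \<le> ennreal (m * \<epsilon> powr (- real CARD('n)))"
proof (cases "\<epsilon> \<le> norm (y - x)")
  case True
  have "\<epsilon> powr \<alpha> * \<epsilon> powr (- \<alpha> - real CARD('n)) = \<epsilon> powr (- real CARD('n))"
    by (simp flip: powr_add)
  then show ?thesis using j_le_radius[OF eps True] by (simp add: mult.assoc)
qed (simp add: j_near)

lemma D_le: "D x \<le> ennreal (1 - a)"
proof -
  have "ennreal a \<le> (\<integral>\<^sup>+y\<in>{y. \<epsilon> < norm (y - x)}. j x y \<partial>lborel)"
    using tail_ge[of \<epsilon> x] eps by simp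
  also have "\<dots> \<le> (\<integral>\<^sup>+y. j x y \<partial>lborel)"
    by (intro nn_integral_mono) (auto simp: indicator_def)
  finally have "D x + ennreal a \<le> 1" using mass[of x] by (metis add_left_mono)
  then have "D x + ennreal a \<le> ennreal (1 - a) + ennreal a"
    using a by (simp flip: ennreal_plus)
  then show ?thesis by simp
qed

lemma D_power_le: "D x ^ i \<le> ennreal ((1 - a) ^ i)"
  using power_mono[OF D_le, of x i] a by (simp add: ennreal_power)

text \<open>Splitting off the jumps longer than \<open>r\<close> leaves an operator whose \<open>L\<^sup>2\<close> norm is at most
  \<open>1 - a (\<epsilon>/r) powr \<alpha>\<close>, by the Schur test; the long jumps map \<open>L\<^sup>1\<close> to \<open>L\<^sup>\<infinity>\<close>. This takes the role
  of a Nash inequality.\<close>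

lemma nash_step:
  assumes r: "\<epsilon> \<le> r" and [measurable]: "\<phi> \<in> borel_measurable borel"
    and phi: "\<And>x. \<phi> x \<le> ennreal c" "(\<integral>\<^sup>+x. \<phi> x \<partial>lborel) \<le> 1"
  shows "(\<integral>\<^sup>+x. T \<phi> x * T \<phi> x \<partial>lborel) \<le> ennreal (1 - a * (\<epsilon> / r) powr \<alpha>) * (\<integral>\<^sup>+x. \<phi> x * \<phi> x \<partial>lborel)
    + ennreal (2 * (m * \<epsilon> powr \<alpha> * r powr (- \<alpha> - real CARD('n))))"
proof -
  define \<eta> where "\<eta> = a * (\<epsilon> / r) powr \<alpha>"
  define \<zeta> where "\<zeta> = m * \<epsilon> powr \<alpha> * r powr (- \<alpha> - real CARD('n))"
  have z0: "\<zeta> \<ge> 0" using m by (simp add: \<zeta>_def)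
  have r0: "r > 0" using r eps by simp
  have eta: "0 \<le> \<eta>" "\<eta> \<le> 1"
  proof -
    have "(\<epsilon> / r) powr \<alpha> \<le> 1" using r eps alpha by (intro powr_le1) auto
    then have "\<eta> \<le> a * 1" unfolding \<eta>_def using a by (intro mult_left_mono) auto
    with a have "\<eta> \<le> 1" by linarith
    then show "0 \<le> \<eta>" "\<eta> \<le> 1" using a by (auto simp: \<eta>_def)
  qed
  define j1 where "j1 x y = j x y * indicator {z. norm z \<le> r} (y - x)" for x y
  define j2 where "j2 x y = j x y * indicator {y. r < norm (y - x)} y" for x y
  have [measurable]: "(\<lambda>(x, y). j1 x y) \<in> borel_measurable (borel \<Otimes>\<^sub>M borel)"
    unfolding j1_def by measurable
  have [measurable]: "j1 x \<in> borel_measurable borel" "j2 x \<in> borel_measurable borel" for x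
    unfolding j1_def j2_def by measurable
  have j12: "j x y = j1 x y + j2 x y" for x y by (auto simp: j1_def j2_def indicator_def)
  have mass1: "D x + (\<integral>\<^sup>+y. j1 x y \<partial>lborel) \<le> ennreal (1 - \<eta>)" for x
  proof -
    have "(\<integral>\<^sup>+y. j x y \<partial>lborel) = (\<integral>\<^sup>+y. j1 x y \<partial>lborel) + (\<integral>\<^sup>+y. j2 x y \<partial>lborel)"
      unfolding j12 by (rule nn_integral_add) measurable
    moreover have "ennreal \<eta> \<le> (\<integral>\<^sup>+y. j2 x y \<partial>lborel)"
      using tail_ge[OF r, of x] by (simp add: \<eta>_def j2_def)
    ultimately have "D x + (\<integral>\<^sup>+y. j1 x y \<partial>lborel) + ennreal \<eta> \<le> 1"
      using mass[of x] by (metis add.assoc add_left_mono)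
    then have "D x + (\<integral>\<^sup>+y. j1 x y \<partial>lborel) + ennreal \<eta> \<le> ennreal (1 - \<eta>) + ennreal \<eta>"
      using eta by (simp flip: ennreal_plus)
    then show ?thesis by simp
  qed
  interpret N: symmetric_jump D j1
  proof
    show "j1 x y = j1 y x" for x y by (simp add: j1_def j_sym[of x y] norm_minus_commute indicator_def)
    show "D x + (\<integral>\<^sup>+y. j1 x y \<partial>lborel) \<le> 1" for x
      by (rule order.trans[OF mass1]) (use eta in \<open>simp flip: ennreal_1\<close>)
  qed measurable
  define g where "g = T \<phi>"
  have [measurable]: "g \<in> borel_measurable borel" by (simp add: g_def)
  have g1: "(\<integral>\<^sup>+x. g x \<partial>lborel) \<le> 1"
    using nn_integral_Tn_le[of \<phi> 1] phi(2) by (simp add: g_def)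
  have gc: "g x \<le> ennreal c" for x unfolding g_def by (rule T_le_const) (rule phi)
  \<comment> \<open>Finiteness of both square integrals is what permits the subtraction of G below,
    carried out in the reals.\<close>
  have sq_fin: "(\<integral>\<^sup>+x. h x * h x \<partial>lborel) < top"
    if [measurable]: "h \<in> borel_measurable borel" and "\<And>x. h x \<le> ennreal c" "(\<integral>\<^sup>+x. h x \<partial>lborel) \<le> 1" for h :: "real ^ 'n \<Rightarrow> ennreal"
  proof -
    have "(\<integral>\<^sup>+x. h x * h x \<partial>lborel) \<le> (\<integral>\<^sup>+x. ennreal c * h x \<partial>lborel)"
      using that by (intro nn_integral_mono mult_right_mono) auto
    also have "\<dots> = ennreal c * (\<integral>\<^sup>+x. h x \<partial>lborel)" by (rule nn_integral_cmult) simp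
    also have "\<dots> \<le> ennreal c * 1" using that by (intro mult_left_mono) auto
    also have "\<dots> < top" by simp
    finally show ?thesis .
  qed
  obtain G where G: "(\<integral>\<^sup>+x. g x * g x \<partial>lborel) = ennreal G" "G \<ge> 0"
    using sq_fin[of g] gc g1 by (cases "\<integral>\<^sup>+x. g x * g x \<partial>lborel") auto
  obtain F where F: "(\<integral>\<^sup>+x. \<phi> x * \<phi> x \<partial>lborel) = ennreal F" "F \<ge> 0"
    using sq_fin[of \<phi>] phi by (cases "\<integral>\<^sup>+x. \<phi> x * \<phi> x \<partial>lborel") auto
  have g_le: "g x \<le> N.T \<phi> x + ennreal \<zeta>" for x
  proof -
    have "g x = N.T \<phi> x + (\<integral>\<^sup>+y. j2 x y * \<phi> y \<partial>lborel)"
      unfolding g_def jump_op_def j12 distrib_right by (subst nn_integral_add) (auto simp: add_ac)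
    also have "(\<integral>\<^sup>+y. j2 x y * \<phi> y \<partial>lborel) \<le> (\<integral>\<^sup>+y. ennreal \<zeta> * \<phi> y \<partial>lborel)"
      using j_le_radius[OF r0] by (intro nn_integral_mono mult_right_mono) (auto simp: j2_def \<zeta>_def indicator_def)
    also have "\<dots> = ennreal \<zeta> * (\<integral>\<^sup>+y. \<phi> y \<partial>lborel)" by (rule nn_integral_cmult) simp
    also have "\<dots> \<le> ennreal \<zeta> * 1" using phi by (intro mult_left_mono) auto
    finally show ?thesis by (simp add: add_left_mono)
  qed
  have "2 * (\<integral>\<^sup>+x. g x * g x \<partial>lborel) \<le> 2 * (\<integral>\<^sup>+x. g x * N.T \<phi> x + ennreal \<zeta> * g x \<partial>lborel)"
  proof (intro mult_left_mono nn_integral_mono)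
    fix x
    have "g x * g x \<le> g x * (N.T \<phi> x + ennreal \<zeta>)" by (intro mult_left_mono g_le) auto
    then show "g x * g x \<le> g x * N.T \<phi> x + ennreal \<zeta> * g x" by (simp add: distrib_left mult.commute)
  qed simp
  also have "\<dots> = 2 * (\<integral>\<^sup>+x. g x * N.T \<phi> x \<partial>lborel) + 2 * (ennreal \<zeta> * (\<integral>\<^sup>+x. g x \<partial>lborel))"
    by (subst nn_integral_add) (auto simp: nn_integral_cmult distrib_left)
  also have "\<dots> \<le> ennreal (1 - \<eta>) * (ennreal F + ennreal G) + 2 * (ennreal \<zeta> * 1)"
    unfolding F(1)[symmetric] G(1)[symmetric]
    by (intro add_mono mult_left_mono g1 N.two_pairing_le mass1) auto
  finally have "ennreal (2 * G) \<le> ennreal ((1 - \<eta>) * (F + G) + 2 * \<zeta>)"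
    using F G eta z0 by (simp add: ennreal_mult ennreal_plus)
  then have "2 * G \<le> (1 - \<eta>) * (F + G) + 2 * \<zeta>"
    using F G eta z0 by (subst (asm) ennreal_le_iff) auto
  \<comment> \<open>The Schur test returns G on both sides. Moving it to the left leaves (1 +
    \<eta>) * G, and the part \<eta> * G is dropped.\<close>
  moreover have "\<eta> * G \<ge> 0" using eta G by simp
  ultimately have "G \<le> (1 - \<eta>) * F + 2 * \<zeta>" by (simp add: algebra_simps)
  then have "ennreal G \<le> ennreal (1 - \<eta>) * ennreal F + ennreal (2 * \<zeta>)"
    using F eta z0 by (simp flip: ennreal_mult ennreal_plus add: ennreal_leI)
  then show ?thesis using F G by (simp add: g_def \<eta>_def \<zeta>_def)
qed

end

text \<open>The starting data of the L2 recursion: a class that contains all jump densities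
  \<open>j x\<close> and is preserved by the chain, but excludes point masses, whose L2 norm is
  infinite. The height is the supremum bound on j.\<close>

definition subdensity :: "real \<Rightarrow> real \<Rightarrow> (real ^ 'n \<Rightarrow> ennreal) \<Rightarrow> bool"
  where "subdensity m \<epsilon> \<phi> \<longleftrightarrow> \<phi> \<in> borel_measurable borel \<and> (\<forall>y. \<phi> y \<le> ennreal (m * \<epsilon> powr (- real CARD('n))))
    \<and> (\<integral>\<^sup>+y. \<phi> y \<partial>lborel) \<le> 1"

lemma (in stable_jump) subdensity_j: "subdensity m \<epsilon> (j x)"
proof -
  have "(\<integral>\<^sup>+y. j x y \<partial>lborel) \<le> D x + (\<integral>\<^sup>+y. j x y \<partial>lborel)" by simp
  then show ?thesis using mass[of x] j_bound by (simp add: subdensity_def)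
qed

lemma (in stable_jump) subdensity_Tn: "subdensity m \<epsilon> \<phi> \<Longrightarrow> subdensity m \<epsilon> ((T ^^ n) \<phi>)"
  using nn_integral_Tn_le[of \<phi> n] by (auto simp: subdensity_def intro: Tn_le_const)

text \<open>\<open>nash_step\<close> keeps its threshold r free at each step. Once the powers of
  \<epsilon> are scaled out, the square integrals satisfy the recursion of
  \<open>nash_recursion\<close> with c1 = a, c2 = 2 * m and initial bound m, none of which involves
  the kernel or \<epsilon>.\<close>

lemma L2_decay:
  fixes \<alpha> m a :: real
  assumes "0 < \<alpha>" "0 < m" "0 < a" "a \<le> 1 / 2"
  obtains C where "C > 0" "\<And>(D :: real ^ 'n \<Rightarrow> ennreal) j \<epsilon> \<phi> n. stable_jump D j \<alpha> m a \<epsilon> \<Longrightarrow> subdensity m \<epsilon> \<phi> \<Longrightarrow>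
    (\<integral>\<^sup>+x. (jump_op D j ^^ n) \<phi> x * (jump_op D j ^^ n) \<phi> x \<partial>lborel)
      \<le> ennreal (C * \<epsilon> powr (- real CARD('n)) * (1 + real n) powr (- (real CARD('n) / \<alpha>)))"
proof -
  define d where "d = real CARD('n)"
  define \<beta> where "\<beta> = d / \<alpha>"
  have b: "\<beta> > 0" using assms by (simp add: \<beta>_def d_def)
  have ab: "\<alpha> * \<beta> = d" using assms by (simp add: \<beta>_def)
  obtain C where C: "C > 0" "\<And>v n. (\<And>n. v n \<ge> 0) \<Longrightarrow> v 0 \<le> m \<Longrightarrow>
      (\<And>n \<tau>. \<tau> \<ge> 1 \<Longrightarrow> v (Suc n) \<le> (1 - a / \<tau>) * v n + 2 * m * \<tau> powr (- 1 - \<beta>)) \<Longrightarrow>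
      v n \<le> C * (1 + real n) powr (- \<beta>)"
    by (rule nash_recursion[of a "2 * m" \<beta> m]) (use assms b in auto)
  show thesis
  proof (rule that[of C])
    fix D :: "real ^ 'n \<Rightarrow> ennreal" and j \<epsilon> n and \<phi> :: "real ^ 'n \<Rightarrow> ennreal"
    assume "stable_jump D j \<alpha> m a \<epsilon>" and nice: "subdensity m \<epsilon> \<phi>"
    then interpret stable_jump D j \<alpha> m a \<epsilon> by simp
    define E where "E = \<epsilon> powr (- d)"
    have E: "E > 0" using eps by (simp add: E_def)
    define s where "s n = (\<integral>\<^sup>+x. (T ^^ n) \<phi> x * (T ^^ n) \<phi> x \<partial>lborel)" for n
    \<comment> \<open>A squared density integrates to something of the size of a density, so
      division by \<open>\<epsilon> powr (- d)\<close> removes the scale.\<close>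
    define v where "v n = enn2real (s n) / E" for n
    have s_le: "s n \<le> ennreal (m * E)" for n
    proof -
      have n: "subdensity m \<epsilon> ((T ^^ n) \<phi>)" by (rule subdensity_Tn[OF nice])
      then have [measurable]: "(T ^^ n) \<phi> \<in> borel_measurable borel" by (simp add: subdensity_def)
      have "s n \<le> (\<integral>\<^sup>+x. ennreal (m * E) * (T ^^ n) \<phi> x \<partial>lborel)"
        unfolding s_def using n by (intro nn_integral_mono mult_right_mono) (auto simp: subdensity_def E_def d_def)
      also have "\<dots> = ennreal (m * E) * (\<integral>\<^sup>+x. (T ^^ n) \<phi> x \<partial>lborel)" by (rule nn_integral_cmult) simp
      also have "\<dots> \<le> ennreal (m * E) * 1" using n by (intro mult_left_mono) (auto simp: subdensity_def)
      finally show ?thesis by simp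
    qed
    have sv: "s n = ennreal (E * v n)" for n
    proof -
      have "s n < top" using s_le[of n] by (rule le_less_trans) simp
      then show ?thesis using E by (simp add: v_def)
    qed
    have "v n \<le> C * (1 + real n) powr (- \<beta>)" for n
    proof (rule C(2))
      show v0: "v n \<ge> 0" for n using E by (simp add: v_def)
      show "v 0 \<le> m" using s_le[of 0] sv[of 0] v0[of 0] E m by (simp add: mult.commute)
      fix n and \<tau> :: real assume \<tau>: "\<tau> \<ge> 1"
      \<comment> \<open>This threshold makes the escape probability proportional to 1 /
        \<tau>.\<close>
      define r where "r = \<epsilon> * \<tau> powr (1 / \<alpha>)"
      have r: "\<epsilon> \<le> r" using eps \<tau> alpha by (simp add: r_def ge_one_powr_ge_zero)
      have "(\<epsilon> / r) powr \<alpha> = 1 / \<tau>" 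
        using eps \<tau> alpha by (simp add: r_def powr_divide powr_powr)
      moreover have "\<epsilon> powr \<alpha> * r powr (- \<alpha> - d) = E * \<tau> powr (- 1 - \<beta>)"
      proof -
        have "r powr (- \<alpha> - d) = \<epsilon> powr (- \<alpha> - d) * \<tau> powr (- 1 - \<beta>)"
        proof -
          have "1 / \<alpha> * (- \<alpha> - d) = - 1 - \<beta>" using alpha by (simp add: \<beta>_def field_simps)
          then show ?thesis using eps \<tau> unfolding r_def powr_mult powr_powr by simp
        qed
        then show ?thesis by (simp add: E_def mult.assoc[symmetric] flip: powr_add)
      qed
      moreover have n: "subdensity m \<epsilon> ((T ^^ n) \<phi>)" by (rule subdensity_Tn[OF nice])
      ultimately have "s (Suc n) \<le> ennreal (1 - a * (1 / \<tau>)) * s n + ennreal (2 * (m * (E * \<tau> powr (- 1 - \<beta>))))"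
        using nash_step[OF r, of "(T ^^ n) \<phi>" "m * \<epsilon> powr (- real CARD('n))"]
        by (auto simp: s_def subdensity_def d_def mult.assoc)
      also have "\<dots> = ennreal ((1 - a / \<tau>) * (E * v n) + 2 * (m * (E * \<tau> powr (- 1 - \<beta>))))"
      proof -
        have "a / \<tau> \<le> 1" using a \<tau> by (simp add: divide_simps)
        then show ?thesis unfolding sv using E v0[of n] m
          by (subst ennreal_plus) (auto simp: ennreal_mult)
      qed
      finally have "E * v (Suc n) \<le> (1 - a / \<tau>) * (E * v n) + 2 * (m * (E * \<tau> powr (- 1 - \<beta>)))"
      proof (unfold sv, subst (asm) ennreal_le_iff)
        have "a / \<tau> \<le> 1" using a \<tau> by (simp add: divide_simps)
        then show "0 \<le> (1 - a / \<tau>) * (E * v n) + 2 * (m * (E * \<tau> powr (- 1 - \<beta>)))"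
          using E v0[of n] m by (intro add_nonneg_nonneg mult_nonneg_nonneg) auto
      qed
      also have "\<dots> = E * ((1 - a / \<tau>) * v n + 2 * m * \<tau> powr (- 1 - \<beta>))" by (simp add: algebra_simps)
      finally show "v (Suc n) \<le> (1 - a / \<tau>) * v n + 2 * m * \<tau> powr (- 1 - \<beta>)"
        using E by simp
    qed
    then have "E * v n \<le> E * (C * (1 + real n) powr (- \<beta>))" using E by (intro mult_left_mono) auto
    then have "s n \<le> ennreal (E * (C * (1 + real n) powr (- \<beta>)))" unfolding sv by (rule ennreal_leI)
    then show "(\<integral>\<^sup>+x. (T ^^ n) \<phi> x * (T ^^ n) \<phi> x \<partial>lborel)
      \<le> ennreal (C * \<epsilon> powr (- real CARD('n)) * (1 + real n) powr (- (real CARD('n) / \<alpha>)))"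
      by (simp add: s_def E_def \<beta>_def d_def mult_ac)
  qed (fact C)
qed

text \<open>By symmetry half of the steps can be moved to the other factor. The pairing of the two
  halves is at most the mean of their square integrals; this elementary inequality replaces
  Cauchy-Schwarz without loss, since both have the same bound. Each half has at least (n - 1) / 2
  steps, whence the factor \<open>2 powr \<beta>\<close>.\<close>

lemma pairing_decay:
  fixes \<alpha> m a :: real
  assumes "0 < \<alpha>" "0 < m" "0 < a" "a \<le> 1 / 2"
  obtains C where "C > 0" "\<And>(D :: real ^ 'n \<Rightarrow> ennreal) j \<epsilon> \<phi> \<psi> n. stable_jump D j \<alpha> m a \<epsilon> \<Longrightarrow> subdensity m \<epsilon> \<phi> \<Longrightarrow> subdensity m \<epsilon> \<psi> \<Longrightarrow>
    (\<integral>\<^sup>+x. \<psi> x * (jump_op D j ^^ n) \<phi> x \<partial>lborel)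
      \<le> ennreal (C * \<epsilon> powr (- real CARD('n)) * (1 + real n) powr (- (real CARD('n) / \<alpha>)))"
proof -
  define \<beta> where "\<beta> = real CARD('n) / \<alpha>"
  have b: "\<beta> > 0" using assms by (simp add: \<beta>_def)
  obtain C where C: "C > 0" "\<And>(D :: real ^ 'n \<Rightarrow> ennreal) j \<epsilon> \<phi> n. stable_jump D j \<alpha> m a \<epsilon> \<Longrightarrow> subdensity m \<epsilon> \<phi> \<Longrightarrow>
    (\<integral>\<^sup>+x. (jump_op D j ^^ n) \<phi> x * (jump_op D j ^^ n) \<phi> x \<partial>lborel)
      \<le> ennreal (C * \<epsilon> powr (- real CARD('n)) * (1 + real n) powr (- \<beta>))"
    unfolding \<beta>_def by (rule L2_decay[OF assms]) blast
  show thesis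
  proof (rule that[of "2 powr \<beta> * C"])
    fix D :: "real ^ 'n \<Rightarrow> ennreal" and j \<epsilon> n and \<phi> \<psi> :: "real ^ 'n \<Rightarrow> ennreal"
    assume sj: "stable_jump D j \<alpha> m a \<epsilon>" and nice: "subdensity m \<epsilon> \<phi>" "subdensity m \<epsilon> \<psi>"
    then interpret stable_jump D j \<alpha> m a \<epsilon> by simp
    define E where "E = \<epsilon> powr (- real CARD('n))"
    have [measurable]: "\<phi> \<in> borel_measurable borel" "\<psi> \<in> borel_measurable borel"
      using nice by (auto simp: subdensity_def)
    define B where "B = 2 powr \<beta> * C * E * (1 + real n) powr (- \<beta>)"
    have le: "C * E * (1 + real k) powr (- \<beta>) \<le> B" if "n \<le> 2 * k + 1" for k
    proof -
      have "(1 + real k) powr (- \<beta>) \<le> ((1 + real n) / 2) powr (- \<beta>)"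
        using that b by (intro powr_mono2') auto
      also have "\<dots> = 2 powr \<beta> * (1 + real n) powr (- \<beta>)" by (simp add: powr_divide powr_minus field_simps)
      finally have "C * E * (1 + real k) powr (- \<beta>) \<le> C * E * (2 powr \<beta> * (1 + real n) powr (- \<beta>))"
        using C(1) by (intro mult_left_mono) (auto simp: E_def)
      then show ?thesis by (simp add: B_def mult_ac)
    qed
    obtain k l where kl: "n = k + l" "n \<le> 2 * k + 1" "n \<le> 2 * l + 1"
    proof (rule that)
      show "n = n div 2 + (n - n div 2)" "n \<le> 2 * (n div 2) + 1" "n \<le> 2 * (n - n div 2) + 1" by auto
    qed
    let ?f = "(T ^^ l) \<phi>" and ?g = "(T ^^ k) \<psi>"
    have "2 * (\<integral>\<^sup>+x. \<psi> x * (T ^^ n) \<phi> x \<partial>lborel) = 2 * (\<integral>\<^sup>+x. ?f x * ?g x \<partial>lborel)"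
      using Tn_symmetric[of ?f \<psi> k] by (simp add: kl(1) funpow_add)
    also have "\<dots> = (\<integral>\<^sup>+x. 2 * (?f x * ?g x) \<partial>lborel)" by (simp add: nn_integral_cmult)
    also have "\<dots> \<le> (\<integral>\<^sup>+x. ?f x * ?f x + ?g x * ?g x \<partial>lborel)"
      by (intro nn_integral_mono ennreal_two_mult_le)
    also have "\<dots> = (\<integral>\<^sup>+x. ?f x * ?f x \<partial>lborel) + (\<integral>\<^sup>+x. ?g x * ?g x \<partial>lborel)"
      by (rule nn_integral_add) auto
    also have "\<dots> \<le> ennreal B + ennreal B"
      using C(2)[OF sj nice(1), of l] C(2)[OF sj nice(2), of k] le[OF kl(2)] le[OF kl(3)]
      by (intro add_mono) (auto simp: E_def elim!: order.trans intro!: ennreal_leI)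
    also have "\<dots> = 2 * ennreal B" by (simp add: mult_2)
    finally have "(\<integral>\<^sup>+x. \<psi> x * (T ^^ n) \<phi> x \<partial>lborel) \<le> ennreal B"
      by (subst (asm) ennreal_mult_le_mult_iff) auto
    then show "(\<integral>\<^sup>+x. \<psi> x * (T ^^ n) \<phi> x \<partial>lborel)
      \<le> ennreal (2 powr \<beta> * C * \<epsilon> powr (- real CARD('n)) * (1 + real n) powr (- (real CARD('n) / \<alpha>)))"
      by (simp add: B_def E_def \<beta>_def)
  qed (use C in simp)
qed

text \<open>Decay of the terms after the first jump implies decay of the whole non-atomic part, the
  random waiting time costing only the factor G. J is left abstract because it is applied with J = 1
  to a jump density and with the integral of \<phi> to a general function.\<close>

lemma (in stable_jump) Duhamel_bound:
  assumes q: "q \<ge> 0"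
    and B: "\<And>l. (\<integral>\<^sup>+y. j x y * (T ^^ l) \<phi> y \<partial>lborel) \<le> ennreal (q * (1 + real l) powr (- \<beta>)) * J"
    and conv: "(\<Sum>i<n. (1 - a) ^ i * real (n - i) powr (- \<beta>)) \<le> G * real n powr (- \<beta>)"
  shows "(T ^^ n) \<phi> x \<le> D x ^ n * \<phi> x + ennreal (q * G * real n powr (- \<beta>)) * J"
proof -
  have "(\<Sum>i<n. D x ^ i * (\<integral>\<^sup>+y. j x y * (T ^^ (n - Suc i)) \<phi> y \<partial>lborel))
      \<le> (\<Sum>i<n. ennreal (q * ((1 - a) ^ i * real (n - i) powr (- \<beta>))) * J)"
  proof (rule sum_mono)
    fix i assume "i \<in> {..<n}"
    then have i: "1 + real (n - Suc i) = real (n - i)" by auto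
    have "D x ^ i * (\<integral>\<^sup>+y. j x y * (T ^^ (n - Suc i)) \<phi> y \<partial>lborel)
        \<le> ennreal ((1 - a) ^ i) * (ennreal (q * (1 + real (n - Suc i)) powr (- \<beta>)) * J)"
      by (intro mult_mono D_power_le B) auto
    then show "D x ^ i * (\<integral>\<^sup>+y. j x y * (T ^^ (n - Suc i)) \<phi> y \<partial>lborel)
        \<le> ennreal (q * ((1 - a) ^ i * real (n - i) powr (- \<beta>))) * J"
      unfolding i using q a by (simp add: ennreal_mult mult_ac)
  qed
  also have "\<dots> = ennreal (q * (\<Sum>i<n. (1 - a) ^ i * real (n - i) powr (- \<beta>))) * J"
    using q a by (simp add: sum_distrib_left sum_ennreal flip: sum_distrib_right)
  also have "\<dots> \<le> ennreal (q * (G * real n powr (- \<beta>))) * J"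
    using conv q by (intro mult_right_mono ennreal_leI mult_left_mono) auto
  finally show ?thesis unfolding Tn_Duhamel[of n \<phi> x] by (simp add: add_left_mono mult.assoc)
qed

text \<open>Duhamel is applied twice. First, pairing \<open>j x\<close> with the evolution of
  \<open>j z\<close> gives a supremum bound for the evolved jump densities. Then symmetry moves the
  evolution from \<phi> onto \<open>j x\<close>, which that bound controls, so \<phi> enters only
  through its integral. At n = 0 the second term vanishes because
  \<open>0 powr _ = 0\<close>.\<close>

lemma on_diagonal_bound:
  fixes \<alpha> m a :: real
  assumes "0 < \<alpha>" "0 < m" "0 < a" "a \<le> 1 / 2"
  obtains C where "C > 0" "\<And>(D :: real ^ 'n \<Rightarrow> ennreal) j \<epsilon> \<phi> n x. stable_jump D j \<alpha> m a \<epsilon> \<Longrightarrow> \<phi> \<in> borel_measurable borel \<Longrightarrow>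
    (jump_op D j ^^ n) \<phi> x \<le> D x ^ n * \<phi> x +
      ennreal (C * \<epsilon> powr (- real CARD('n)) * real n powr (- (real CARD('n) / \<alpha>))) * (\<integral>\<^sup>+y. \<phi> y \<partial>lborel)"
proof -
  define \<beta> where "\<beta> = real CARD('n) / \<alpha>"
  have b: "\<beta> > 0" using assms by (simp add: \<beta>_def)
  obtain C where C: "C > 0" "\<And>(D :: real ^ 'n \<Rightarrow> ennreal) j \<epsilon> \<phi> \<psi> n. stable_jump D j \<alpha> m a \<epsilon> \<Longrightarrow> subdensity m \<epsilon> \<phi> \<Longrightarrow> subdensity m \<epsilon> \<psi> \<Longrightarrow>
    (\<integral>\<^sup>+x. \<psi> x * (jump_op D j ^^ n) \<phi> x \<partial>lborel)
      \<le> ennreal (C * \<epsilon> powr (- real CARD('n)) * (1 + real n) powr (- \<beta>))"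
    unfolding \<beta>_def by (rule pairing_decay[OF assms]) blast
  obtain B where B: "B > 0" "\<And>n. (1 - a) ^ n \<le> B * (1 + real n) powr (- \<beta>)"
    "\<And>n. (\<Sum>i<n. (1 - a) ^ i * real (n - i) powr (- \<beta>)) \<le> B * real n powr (- \<beta>)"
    by (rule geometric_convolution_powr[of "1 - a" \<beta>]) (use assms b in auto)
  \<comment> \<open>The first summand bounds the atom D ^ n acting on a jump density, the second the
    Duhamel sum; \<open>2 powr \<beta>\<close> replaces n by 1 + n.\<close>
  define C1 where "C1 = B * m + C * B * 2 powr \<beta>"
  have C1: "C1 > 0" using C B assms by (simp add: C1_def add_pos_pos)
  show thesis
  proof (rule that[of "C1 * B"])
    fix D :: "real ^ 'n \<Rightarrow> ennreal" and j \<epsilon> n x and \<phi> :: "real ^ 'n \<Rightarrow> ennreal"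
    assume sj: "stable_jump D j \<alpha> m a \<epsilon>" and [measurable]: "\<phi> \<in> borel_measurable borel"
    then interpret stable_jump D j \<alpha> m a \<epsilon> by simp
    define E where "E = \<epsilon> powr (- real CARD('n))"
    have E: "E > 0" using eps by (simp add: E_def)
    have nice_sup: "(T ^^ n) (j z) x \<le> ennreal (C1 * E * (1 + real n) powr (- \<beta>))" for n x z
    proof -
      have "(T ^^ n) (j z) x \<le> D x ^ n * j z x + ennreal ((C * E) * B * real n powr (- \<beta>)) * 1"
      proof (rule Duhamel_bound)
        show "(\<integral>\<^sup>+y. j x y * (T ^^ l) (j z) y \<partial>lborel) \<le> ennreal (C * E * (1 + real l) powr (- \<beta>)) * 1" for l
          using C(2)[OF sj subdensity_j subdensity_j, of x l z] by (simp add: E_def)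
      qed (use C E B in auto)
      also have "\<dots> \<le> ennreal (B * (1 + real n) powr (- \<beta>)) * ennreal (m * E)
          + ennreal (C * E * B * (2 powr \<beta> * (1 + real n) powr (- \<beta>))) * 1"
      proof (intro add_mono mult_mono ennreal_leI)
        show "D x ^ n \<le> ennreal (B * (1 + real n) powr (- \<beta>))"
          using D_power_le[of x n] B(2)[of n] by (meson ennreal_leI order.trans)
        show "j z x \<le> ennreal (m * E)" using j_bound by (simp add: E_def)
        show "real n powr (- \<beta>) \<le> 2 powr \<beta> * (1 + real n) powr (- \<beta>)"
        proof (cases "n = 0")
          case False
          then have "real n powr (- \<beta>) \<le> ((1 + real n) / 2) powr (- \<beta>)" using b by (intro powr_mono2') auto
          then show ?thesis by (simp add: powr_divide powr_minus field_simps)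
        qed simp
      qed (use C E B in auto)
      also have "\<dots> = ennreal (C1 * E * (1 + real n) powr (- \<beta>))"
        using C E B m unfolding C1_def by (simp add: algebra_simps flip: ennreal_mult ennreal_plus)
      finally show ?thesis .
    qed
    have "(T ^^ n) \<phi> x \<le> D x ^ n * \<phi> x + ennreal ((C1 * E) * B * real n powr (- \<beta>)) * (\<integral>\<^sup>+y. \<phi> y \<partial>lborel)"
    proof (rule Duhamel_bound)
      fix l
      have "(\<integral>\<^sup>+y. j x y * (T ^^ l) \<phi> y \<partial>lborel) = (\<integral>\<^sup>+y. \<phi> y * (T ^^ l) (j x) y \<partial>lborel)"
        by (rule Tn_symmetric) auto
      also have "\<dots> \<le> (\<integral>\<^sup>+y. \<phi> y * ennreal (C1 * E * (1 + real l) powr (- \<beta>)) \<partial>lborel)"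
        by (intro nn_integral_mono mult_left_mono nice_sup) auto
      also have "\<dots> = ennreal (C1 * E * (1 + real l) powr (- \<beta>)) * (\<integral>\<^sup>+y. \<phi> y \<partial>lborel)"
        by (subst nn_integral_multc) (auto simp: mult.commute)
      finally show "(\<integral>\<^sup>+y. j x y * (T ^^ l) \<phi> y \<partial>lborel) \<le> \<dots>" .
    qed (use C1 E B in auto)
    then show "(T ^^ n) \<phi> x \<le> D x ^ n * \<phi> x +
      ennreal (C1 * B * \<epsilon> powr (- real CARD('n)) * real n powr (- (real CARD('n) / \<alpha>))) * (\<integral>\<^sup>+y. \<phi> y \<partial>lborel)"
      by (simp add: E_def \<beta>_def mult_ac)
  qed (use C1 B in simp)
qed

section \<open>Truncated chain and off-diagonal bound\<close>

context stable_jump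
begin

definition trunc :: "real \<Rightarrow> real ^ 'n \<Rightarrow> real ^ 'n \<Rightarrow> ennreal"
  where "trunc \<rho> x y = j x y * indicator {z. norm z \<le> \<rho>} (y - x)"

abbreviation R :: "real \<Rightarrow> (real ^ 'n \<Rightarrow> ennreal) \<Rightarrow> real ^ 'n \<Rightarrow> ennreal"
  where "R \<rho> \<equiv> jump_op D (trunc \<rho>)"

lemma trunc_le: "trunc \<rho> x y \<le> j x y"
  by (simp add: trunc_def indicator_def)

lemma symmetric_jump_trunc: "symmetric_jump D (trunc \<rho>)"
proof
  show "trunc \<rho> x y = trunc \<rho> y x" for x y
    by (simp add: trunc_def j_sym[of x y] norm_minus_commute indicator_def)
  have "D x + (\<integral>\<^sup>+y. trunc \<rho> x y \<partial>lborel) \<le> D x + (\<integral>\<^sup>+y. j x y \<partial>lborel)" for x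
    by (intro add_left_mono nn_integral_mono trunc_le)
  then show "D x + (\<integral>\<^sup>+y. trunc \<rho> x y \<partial>lborel) \<le> 1" for x by (simp add: mass)
  show "(\<lambda>(x, y). trunc \<rho> x y) \<in> borel_measurable (borel \<Otimes>\<^sub>M borel)"
    unfolding trunc_def by measurable
qed measurable

lemma Rn_le_Tn: "(R \<rho> ^^ n) \<phi> x \<le> (T ^^ n) \<phi> x"
proof (induction n arbitrary: x)
  case (Suc n)
  have "R \<rho> ((R \<rho> ^^ n) \<phi>) x \<le> T ((R \<rho> ^^ n) \<phi>) x"
    unfolding jump_op_def by (intro add_left_mono nn_integral_mono mult_right_mono trunc_le) auto
  also have "\<dots> \<le> T ((T ^^ n) \<phi>) x" by (rule T_mono) (rule Suc)
  finally show ?case by simp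
qed simp

text \<open>Meyer's decomposition.\<close>

lemma Tn_le_Rn:
  assumes rho: "\<rho> > 0" and [measurable]: "\<phi> \<in> borel_measurable borel"
  shows "(T ^^ n) \<phi> x \<le> (R \<rho> ^^ n) \<phi> x
    + ennreal (real n * (m * \<epsilon> powr \<alpha> * \<rho> powr (- \<alpha> - real CARD('n)))) * (\<integral>\<^sup>+y. \<phi> y \<partial>lborel)"
proof (induction n arbitrary: x)
  case (Suc n)
  interpret R: symmetric_jump D "trunc \<rho>" by (rule symmetric_jump_trunc)
  define q where "q = m * \<epsilon> powr \<alpha> * \<rho> powr (- \<alpha> - real CARD('n))"
  have q: "q \<ge> 0" using m by (simp add: q_def)
  let ?J = "\<integral>\<^sup>+y. \<phi> y \<partial>lborel"
  have "T ((T ^^ n) \<phi>) x \<le> R \<rho> ((T ^^ n) \<phi>) x + ennreal q * ?J"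
  proof -
    have "(\<integral>\<^sup>+y. j x y * (T ^^ n) \<phi> y \<partial>lborel)
        \<le> (\<integral>\<^sup>+y. trunc \<rho> x y * (T ^^ n) \<phi> y + ennreal q * (T ^^ n) \<phi> y \<partial>lborel)"
    proof (rule nn_integral_mono)
      fix y
      have "j x y \<le> trunc \<rho> x y + ennreal q"
        using j_le_radius[OF rho, of y x] by (cases "norm (y - x) \<le> \<rho>") (auto simp: trunc_def q_def)
      from mult_right_mono[OF this, of "(T ^^ n) \<phi> y"]
      show "j x y * (T ^^ n) \<phi> y \<le> trunc \<rho> x y * (T ^^ n) \<phi> y + ennreal q * (T ^^ n) \<phi> y"
        by (simp add: distrib_right)
    qed
    also have "\<dots> = (\<integral>\<^sup>+y. trunc \<rho> x y * (T ^^ n) \<phi> y \<partial>lborel) + ennreal q * (\<integral>\<^sup>+y. (T ^^ n) \<phi> y \<partial>lborel)"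
      by (subst nn_integral_add) (auto simp: nn_integral_cmult)
    also have "\<dots> \<le> (\<integral>\<^sup>+y. trunc \<rho> x y * (T ^^ n) \<phi> y \<partial>lborel) + ennreal q * ?J"
      by (intro add_left_mono mult_left_mono nn_integral_Tn_le) auto
    finally show ?thesis unfolding jump_op_def by (simp add: add_left_mono add.assoc)
  qed
  also have "R \<rho> ((T ^^ n) \<phi>) x \<le> R \<rho> (\<lambda>y. (R \<rho> ^^ n) \<phi> y + ennreal (real n * q) * ?J) x"
    by (rule R.T_mono) (use Suc in \<open>simp add: q_def\<close>)
  also have "\<dots> = R \<rho> ((R \<rho> ^^ n) \<phi>) x + R \<rho> (\<lambda>_. ennreal (real n * q) * ?J) x"
    by (rule R.T_add) auto
  also have "\<dots> \<le> R \<rho> ((R \<rho> ^^ n) \<phi>) x + ennreal (real n * q) * ?J"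
    by (intro add_left_mono R.T_le_const) simp
  also have "\<dots> + ennreal q * ?J = R \<rho> ((R \<rho> ^^ n) \<phi>) x + ennreal (real (Suc n) * q) * ?J"
  proof -
    have "ennreal (real (Suc n) * q) = ennreal (real n * q) + ennreal q"
      using q by (simp add: distrib_right flip: ennreal_plus)
    then show ?thesis by (simp add: add.assoc distrib_right)
  qed
  finally show ?case by (simp add: q_def add_right_mono)
qed simp

end

text \<open>A substitute for exp (l |y - x|) that is smooth at x and even in each coordinate
  difference, so that opposite jumps cancel to first order, and that still grows exponentially with
  the distance.\<close>

definition cosh_weight :: "real \<Rightarrow> real ^ 'n \<Rightarrow> real ^ 'n \<Rightarrow> real"
  where "cosh_weight l x y = (\<Sum>i\<in>UNIV. cosh (l * (y $ i - x $ i)))"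

lemma cosh_weight_nonneg: "cosh_weight l x y \<ge> 0"
  unfolding cosh_weight_def by (intro sum_nonneg) (simp add: cosh_real_nonneg)

lemma cosh_weight_measurable [measurable]: "cosh_weight l x \<in> borel_measurable borel"
proof -
  have "continuous_on UNIV (cosh_weight l x)"
    unfolding cosh_weight_def cosh_def by (intro continuous_intros) auto
  then show ?thesis by (rule borel_measurable_continuous_onI)
qed

lemma cosh_weight_refl: "cosh_weight l x (x :: real ^ 'n) = real CARD('n)"
  by (simp add: cosh_weight_def)

section \<open>Growth of the weight under a single jump\<close>

lemma cosh_add_le: "cosh (u + v) \<le> cosh u * exp \<bar>v :: real\<bar>"
proof -
  have "exp (u + v) \<le> exp u * exp \<bar>v\<bar>" "exp (- (u + v)) \<le> exp (- u) * exp \<bar>v\<bar>"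
    by (auto simp flip: exp_add)
  then show ?thesis by (simp add: cosh_def field_simps)
qed

lemma cosh_weight_shift_le:
  assumes "l \<ge> 0"
  shows "cosh_weight l x z \<le> cosh_weight l x y * exp (l * norm (z - y))"
  unfolding cosh_weight_def sum_distrib_right
proof (rule sum_mono)
  fix i
  have "cosh (l * (y $ i - x $ i) + l * ((z - y) $ i)) \<le> cosh (l * (y $ i - x $ i)) * exp \<bar>l * ((z - y) $ i)\<bar>"
    by (rule cosh_add_le)
  also have "\<dots> \<le> cosh (l * (y $ i - x $ i)) * exp (l * norm (z - y))"
    using assms component_le_norm_cart[of "z - y" i]
    by (intro mult_left_mono) (auto simp: abs_mult cosh_real_nonneg intro!: mult_left_mono)
  finally show "cosh (l * (z $ i - x $ i)) \<le> cosh (l * (y $ i - x $ i)) * exp (l * norm (z - y))"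
    by (simp add: algebra_simps)
qed

text \<open>The parts odd in w cancel between opposite displacements. What remains grows by cosh (l
  |w|), whose excess over 1 is quadratic in w and hence integrable at the origin against |w| to the
  power -\<alpha> - d for every \<alpha> < 2.\<close>

lemma cosh_weight_symmetric_le:
  assumes "l \<ge> 0"
  shows "cosh_weight l x (y + w) + cosh_weight l x (y - w) \<le> 2 * (cosh_weight l x y * cosh (l * norm w))"
  unfolding cosh_weight_def sum_distrib_right sum_distrib_left sum.distrib[symmetric]
proof (rule sum_mono)
  fix i
  let ?u = "l * (y $ i - x $ i)" and ?v = "l * (w $ i)"
  have "cosh (l * ((y + w) $ i - x $ i)) + cosh (l * ((y - w) $ i - x $ i)) = cosh (?u + ?v) + cosh (?u - ?v)"
    by (simp add: algebra_simps)
  also have "\<dots> = 2 * (cosh ?u * cosh ?v)" by (simp add: cosh_add cosh_diff)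
  also have "cosh ?v \<le> cosh (l * norm w)"
  proof -
    have "\<bar>?v\<bar> \<le> l * norm w" using assms by (auto simp: abs_mult intro!: mult_left_mono component_le_norm_cart)
    then have "cosh \<bar>?v\<bar> \<le> cosh (l * norm w)" by (subst cosh_real_nonneg_le_iff) auto
    then show ?thesis by simp
  qed
  finally show "cosh (l * ((y + w) $ i - x $ i)) + cosh (l * ((y - w) $ i - x $ i)) \<le> 2 * (cosh ?u * cosh (l * norm w))"
    by (simp add: cosh_real_nonneg mult_left_mono)
qed

text \<open>Some coordinate carries at least the average of the l1 norm, which dominates the
  Euclidean norm. The loss of the factor \<open>CARD('n)\<close> in the exponent is compensated by
  the radius in \<open>trunc_tail\<close>.\<close>

lemma cosh_weight_far:
  fixes x y :: "real ^ 'n"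
  assumes "l \<ge> 0" "r \<le> norm (y - x)"
  shows "exp (l * r / real CARD('n)) \<le> 2 * cosh_weight l x y"
proof -
  have "\<exists>i. r / real CARD('n) \<le> \<bar>(y - x) $ i\<bar>"
  proof (rule ccontr)
    assume "\<not> ?thesis"
    then have "(\<Sum>i\<in>UNIV. \<bar>(y - x) $ i\<bar>) < (\<Sum>i\<in>(UNIV :: 'n set). r / real CARD('n))"
      by (intro sum_strict_mono) (auto simp: not_le)
    then show False using norm_le_l1_cart[of "y - x"] assms(2) by simp
  qed
  then obtain i where i: "r / real CARD('n) \<le> \<bar>y $ i - x $ i\<bar>" by auto
  have "exp (l * r / real CARD('n)) \<le> exp \<bar>l * (y $ i - x $ i)\<bar>"
    using mult_left_mono[OF i assms(1)] assms(1) by (simp add: abs_mult)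
  also have "\<dots> \<le> 2 * cosh (l * (y $ i - x $ i))"
    by (simp add: cosh_def abs_if)
  also have "\<dots> \<le> 2 * cosh_weight l x y"
    unfolding cosh_weight_def by (intro mult_left_mono member_le_sum) (auto simp: cosh_real_nonneg)
  finally show ?thesis .
qed

text \<open>One factor exp (l \<rho>) absorbs l \<rho> and a second one bounds exp (l s). In this
  form the growth depends on l only through exp (2 l \<rho>), the quantity that will be
  prescribed.\<close>

lemma exp_increment_le:
  fixes l s \<rho> :: real
  assumes "0 \<le> l" "0 \<le> s" "s \<le> \<rho>" "0 < \<rho>"
  shows "exp (l * s) \<le> 1 + (s / \<rho>) * exp (2 * l * \<rho>)"
proof -
  have "exp (l * s) - 1 \<le> l * s * exp (l * s)"
    using mult_right_mono[OF exp_ge_add_one_self[of "- (l * s)"], of "exp (l * s)"]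
    by (simp add: exp_minus algebra_simps)
  also have "\<dots> = (s / \<rho>) * (l * \<rho>) * exp (l * s)" using assms by simp
  also have "\<dots> \<le> (s / \<rho>) * exp (l * \<rho>) * exp (l * \<rho>)"
  proof (intro mult_mono)
    show "l * \<rho> \<le> exp (l * \<rho>)" using exp_ge_add_one_self[of "l * \<rho>"] by linarith
  qed (use assms in \<open>auto intro!: mult_left_mono\<close>)
  also have "\<dots> = (s / \<rho>) * exp (2 * l * \<rho>)" by (simp flip: exp_add)
  finally show ?thesis by simp
qed

lemma sinh_le: "0 \<le> v \<Longrightarrow> sinh v \<le> v * exp (v :: real)"
proof -
  assume "0 \<le> v"
  have e: "exp v - exp (- v) \<le> 2 * (v * exp v)"
  proof -
    have "1 - 2 * v \<le> exp (- 2 * v)" using exp_ge_add_one_self[of "- 2 * v"] by simp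
    then have "(1 - 2 * v) * exp v \<le> exp (- 2 * v) * exp v" by (intro mult_right_mono) auto
    also have "\<dots> = exp (- v)" by (simp flip: exp_add)
    finally show ?thesis by (simp add: algebra_simps)
  qed
  then show ?thesis by (simp add: sinh_def)
qed

text \<open>The second-order counterpart for balanced kernels. The identity cosh (2 v) = 1 + 2 *
  (sinh v) ^ 2 exposes the quadratic increment.\<close>

lemma cosh_increment_le:
  fixes l s \<rho> :: real
  assumes "0 \<le> l" "0 \<le> s" "s \<le> \<rho>" "0 < \<rho>"
  shows "cosh (l * s) \<le> 1 + (s / \<rho>) ^ 2 * exp (2 * l * \<rho>)"
proof -
  let ?v = "l * s / 2"
  have v: "?v \<ge> 0" using assms by simp
  have "cosh (l * s) = 1 + 2 * sinh ?v ^ 2"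
    using cosh_double[of ?v] cosh_square_eq[of ?v] by simp
  also have "sinh ?v ^ 2 \<le> (?v * exp ?v) ^ 2"
    using v by (intro power_mono sinh_le) (auto simp: sinh_real_nonneg_iff)
  also have "2 * (?v * exp ?v) ^ 2 = (s / \<rho>) ^ 2 * ((l * \<rho>) ^ 2 / 2) * exp (l * s)"
  proof -
    have "(exp ?v) ^ 2 = exp (l * s)" by (simp add: power2_eq_square flip: exp_add)
    then show ?thesis using assms unfolding power_mult_distrib by (simp add: power_divide power_mult_distrib)
  qed
  also have "\<dots> \<le> (s / \<rho>) ^ 2 * exp (l * \<rho>) * exp (l * \<rho>)"
  proof (intro mult_mono)
    have "1 + l * \<rho> + (l * \<rho>) ^ 2 / 2 \<le> exp (l * \<rho>)" using assms by (intro exp_lower_Taylor_quadratic) auto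
    then show "(l * \<rho>) ^ 2 / 2 \<le> exp (l * \<rho>)" using mult_nonneg_nonneg[of l \<rho>] assms by linarith
  qed (use assms in \<open>auto intro!: mult_left_mono\<close>)
  also have "\<dots> = (s / \<rho>) ^ 2 * exp (2 * l * \<rho>)" by (simp flip: exp_add)
  finally show ?thesis by simp
qed

text \<open>The value at y is averaged with total mass at most 1, and only the increment is
  integrated against the majorant of j. It has order p in the jump length, where p > \<alpha>
  ensures convergence at the origin uniformly in \<epsilon>: first order suffices when \<alpha> < 1,
  otherwise the reflection symmetry supplies second order.\<close>

lemma (in stable_jump) trunc_step:
  assumes l: "0 \<le> l" and rho: "0 < \<rho>" and K: "0 \<le> K"
    and p: "p = (if \<alpha> < 1 then 1 else 2)"
    and int: "(\<integral>\<^sup>+z\<in>{z :: real ^ 'n. norm z \<le> \<rho>}. ennreal (norm z powr (p - \<alpha> - real CARD('n))) \<partial>lborel) \<le> ennreal (K * \<rho> powr (p - \<alpha>))"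
  shows "R \<rho> (\<lambda>y. ennreal (cosh_weight l x y)) y
    \<le> ennreal (1 + K * m * (\<epsilon> / \<rho>) powr \<alpha> * exp (2 * l * \<rho>)) * ennreal (cosh_weight l x y)"
proof -
  let ?H = "cosh_weight l x" and ?N = "\<lambda>z. norm (z - y)"
  interpret R: symmetric_jump D "trunc \<rho>" by (rule symmetric_jump_trunc)
  \<comment> \<open>The factor by which a jump of length s enlarges the weight: directly when
    \<alpha> < 1, and after averaging over opposite jumps otherwise.\<close>
  define E where "E s = (if \<alpha> < 1 then exp (l * s) else cosh (l * s))" for s
  have E0: "E s \<ge> 0" for s by (simp add: E_def cosh_real_nonneg)
  have [measurable]: "E \<in> borel_measurable borel"
  proof -
    have "continuous_on UNIV E" unfolding E_def cosh_def by (cases "\<alpha> < 1") (auto intro!: continuous_intros)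
    then show ?thesis by (rule borel_measurable_continuous_onI)
  qed
  have E_le: "E s \<le> 1 + (s / \<rho>) powr p * exp (2 * l * \<rho>)" if "0 < s" "s \<le> \<rho>" for s
    using exp_increment_le[of l s \<rho>] cosh_increment_le[of l s \<rho>] that l rho
    by (auto simp: E_def p powr_numeral)
  define q where "q = m * \<epsilon> powr \<alpha> * exp (2 * l * \<rho>) * \<rho> powr (- p)"
  have q: "q \<ge> 0" using m by (simp add: q_def)
  have jE: "trunc \<rho> y z * ennreal (E (?N z)) \<le> trunc \<rho> y z + ennreal q * (ennreal (?N z powr (p - \<alpha> - real CARD('n))) * indicator {z. norm z \<le> \<rho>} (z - y))" for z
  proof (cases "\<epsilon> \<le> ?N z \<and> ?N z \<le> \<rho>")
    case True
    let ?s = "?N z"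
    have s: "0 < ?s" "?s \<le> \<rho>" using True eps by auto
    have "trunc \<rho> y z * ennreal (E ?s) \<le> j y z * ennreal (1 + (?s / \<rho>) powr p * exp (2 * l * \<rho>))"
      using E_le[OF s] by (intro mult_mono trunc_le ennreal_leI) auto
    also have "\<dots> = j y z + j y z * ennreal ((?s / \<rho>) powr p * exp (2 * l * \<rho>))"
      by (simp add: distrib_left)
    also have "\<dots> \<le> j y z + ennreal (m * \<epsilon> powr \<alpha> * ?s powr (- \<alpha> - real CARD('n))) * ennreal ((?s / \<rho>) powr p * exp (2 * l * \<rho>))"
      using True by (intro add_left_mono mult_right_mono j_le) auto
    also have "\<dots> = j y z + ennreal (q * ?s powr (p - \<alpha> - real CARD('n)))"
    proof -
      have "?s powr (- \<alpha> - real CARD('n)) * ?s powr p = ?s powr (p - \<alpha> - real CARD('n))"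
        by (simp add: algebra_simps flip: powr_add)
      then have "m * \<epsilon> powr \<alpha> * ?s powr (- \<alpha> - real CARD('n)) * ((?s / \<rho>) powr p * exp (2 * l * \<rho>)) = q * ?s powr (p - \<alpha> - real CARD('n))"
        using s rho by (simp add: q_def powr_divide powr_minus field_simps)
      then show ?thesis using m by (simp flip: ennreal_mult)
    qed
    finally show ?thesis using True q by (simp add: trunc_def ennreal_mult)
  qed (auto simp: trunc_def j_near not_le)
  have "(\<integral>\<^sup>+z. trunc \<rho> y z * ennreal (E (?N z)) \<partial>lborel)
      \<le> (\<integral>\<^sup>+z. trunc \<rho> y z \<partial>lborel) + ennreal q * (\<integral>\<^sup>+z. ennreal (?N z powr (p - \<alpha> - real CARD('n))) * indicator {z. norm z \<le> \<rho>} (z - y) \<partial>lborel)"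
    by (subst nn_integral_cmult[symmetric], measurable, subst nn_integral_add[symmetric], measurable)
      (intro nn_integral_mono jE)
  also have "(\<integral>\<^sup>+z. ennreal (?N z powr (p - \<alpha> - real CARD('n))) * indicator {z. norm z \<le> \<rho>} (z - y) \<partial>lborel)
      = (\<integral>\<^sup>+z\<in>{z :: real ^ 'n. norm z \<le> \<rho>}. ennreal (norm z powr (p - \<alpha> - real CARD('n))) \<partial>lborel)"
    by (subst nn_integral_lborel_shift[of _ y, symmetric]) auto
  also have "(\<integral>\<^sup>+z. trunc \<rho> y z \<partial>lborel) + ennreal q * \<dots> \<le> (\<integral>\<^sup>+z. trunc \<rho> y z \<partial>lborel) + ennreal q * ennreal (K * \<rho> powr (p - \<alpha>))"
    by (intro add_left_mono mult_left_mono int) auto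
  also have "ennreal q * ennreal (K * \<rho> powr (p - \<alpha>)) = ennreal (K * m * (\<epsilon> / \<rho>) powr \<alpha> * exp (2 * l * \<rho>))"
  proof -
    have "\<rho> powr (- p) * \<rho> powr (p - \<alpha>) = \<rho> powr (- \<alpha>)" by (simp flip: powr_add)
    then have eq: "q * (K * \<rho> powr (p - \<alpha>)) = K * m * (\<epsilon> / \<rho>) powr \<alpha> * exp (2 * l * \<rho>)"
      using rho eps by (simp add: q_def powr_divide powr_minus field_simps)
    show ?thesis unfolding eq[symmetric] using q K by (intro ennreal_mult[symmetric]) auto
  qed
  finally have jE_int: "(\<integral>\<^sup>+z. trunc \<rho> y z * ennreal (E (?N z)) \<partial>lborel)
    \<le> (\<integral>\<^sup>+z. trunc \<rho> y z \<partial>lborel) + ennreal (K * m * (\<epsilon> / \<rho>) powr \<alpha> * exp (2 * l * \<rho>))" .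
  have main: "(\<integral>\<^sup>+z. trunc \<rho> y z * ennreal (?H z) \<partial>lborel) \<le> ennreal (?H y) * (\<integral>\<^sup>+z. trunc \<rho> y z * ennreal (E (?N z)) \<partial>lborel)"
  proof (cases "\<alpha> < 1")
    case True
    have "(\<integral>\<^sup>+z. trunc \<rho> y z * ennreal (?H z) \<partial>lborel) \<le> (\<integral>\<^sup>+z. ennreal (?H y) * (trunc \<rho> y z * ennreal (E (?N z))) \<partial>lborel)"
    proof (rule nn_integral_mono)
      fix z
      have "trunc \<rho> y z * ennreal (?H z) \<le> trunc \<rho> y z * ennreal (?H y * E (?N z))"
        using cosh_weight_shift_le[OF l, of x z y] True by (intro mult_left_mono ennreal_leI) (auto simp: E_def)
      then show "trunc \<rho> y z * ennreal (?H z) \<le> ennreal (?H y) * (trunc \<rho> y z * ennreal (E (?N z)))"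
        by (simp add: ennreal_mult cosh_weight_nonneg E0 mult_ac)
    qed
    then show ?thesis by (simp add: nn_integral_cmult)
  next
    case False
    then have "j y (y + w) = j y (y - w)" for w using balance by blast
    then have even: "trunc \<rho> y (y - w) = trunc \<rho> y (y + w)" for w by (simp add: trunc_def indicator_def)
    let ?g = "\<lambda>z. trunc \<rho> y z * ennreal (?H z)"
    \<comment> \<open>Twice the integral is written once by translation and once by reflection,
      which places the displacements w and -w under one integral.\<close>
    have "2 * (\<integral>\<^sup>+z. ?g z \<partial>lborel) = (\<integral>\<^sup>+w. ?g (y + w) \<partial>lborel) + (\<integral>\<^sup>+w. ?g (y - w) \<partial>lborel)"
      by (subst nn_integral_lborel_shift, measurable, subst nn_integral_lborel_reflect, measurable) (simp add: mult_2)
    also have "\<dots> = (\<integral>\<^sup>+w. ?g (y + w) + ?g (y - w) \<partial>lborel)"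
      by (rule nn_integral_add[symmetric]) measurable
    also have "\<dots> \<le> (\<integral>\<^sup>+w. (2 * ennreal (?H y)) * (trunc \<rho> y (y + w) * ennreal (E (?N (y + w)))) \<partial>lborel)"
    proof (rule nn_integral_mono)
      fix w
      have "?g (y + w) + ?g (y - w) = trunc \<rho> y (y + w) * ennreal (?H (y + w) + ?H (y - w))"
        by (simp add: cosh_weight_nonneg even distrib_left)
      also have "\<dots> \<le> trunc \<rho> y (y + w) * ennreal (2 * (?H y * E (norm w)))"
        using cosh_weight_symmetric_le[OF l, of x y w] False by (intro mult_left_mono ennreal_leI) (auto simp: E_def)
      also have "\<dots> = (2 * ennreal (?H y)) * (trunc \<rho> y (y + w) * ennreal (E (?N (y + w))))"
        by (simp add: ennreal_mult cosh_weight_nonneg E0 mult_ac)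
      finally show "?g (y + w) + ?g (y - w) \<le> \<dots>" .
    qed
    also have "\<dots> = (2 * ennreal (?H y)) * (\<integral>\<^sup>+w. trunc \<rho> y (y + w) * ennreal (E (?N (y + w))) \<partial>lborel)"
      by (rule nn_integral_cmult) measurable
    also have "(\<integral>\<^sup>+w. trunc \<rho> y (y + w) * ennreal (E (?N (y + w))) \<partial>lborel) = (\<integral>\<^sup>+z. trunc \<rho> y z * ennreal (E (?N z)) \<partial>lborel)"
      by (rule nn_integral_lborel_shift[of "\<lambda>z. trunc \<rho> y z * ennreal (E (?N z))"]) measurable
    finally show ?thesis by (simp add: mult.assoc ennreal_mult_le_mult_iff)
  qed
  have "R \<rho> (\<lambda>y. ennreal (?H y)) y \<le> D y * ennreal (?H y) + ennreal (?H y) * ((\<integral>\<^sup>+z. trunc \<rho> y z \<partial>lborel) + ennreal (K * m * (\<epsilon> / \<rho>) powr \<alpha> * exp (2 * l * \<rho>)))"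
    unfolding jump_op_def by (intro add_left_mono order.trans[OF main] mult_left_mono jE_int) auto
  also have "\<dots> = ((D y + (\<integral>\<^sup>+z. trunc \<rho> y z \<partial>lborel)) + ennreal (K * m * (\<epsilon> / \<rho>) powr \<alpha> * exp (2 * l * \<rho>))) * ennreal (?H y)"
    by (simp add: distrib_left distrib_right mult.commute add.assoc)
  also have "\<dots> \<le> (1 + ennreal (K * m * (\<epsilon> / \<rho>) powr \<alpha> * exp (2 * l * \<rho>))) * ennreal (?H y)"
    by (intro mult_right_mono add_right_mono R.mass_le_1) auto
  also have "1 + ennreal (K * m * (\<epsilon> / \<rho>) powr \<alpha> * exp (2 * l * \<rho>)) = ennreal (1 + K * m * (\<epsilon> / \<rho>) powr \<alpha> * exp (2 * l * \<rho>))"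
    using K m by (subst ennreal_plus) auto
  finally show ?thesis .
qed

text \<open>A Chernoff bound with the exponential weight. The exponent 1 + d / \<alpha> is the one
  for which the product of the tail with the on-diagonal bound is of order n * \<epsilon> powr
  \<alpha> * \<rho> powr (- \<alpha> - d). The radius is chosen so that the weight reaches exp (2 l
  \<rho>) to this exponent there. The number k of steps is separate from n because parts of an
  n-step path are estimated with the scale of n.\<close>

lemma trunc_tail:
  fixes \<alpha> m :: real
  assumes "0 < \<alpha>" "\<alpha> < 2" "0 < m"
  obtains C where "C > 0" "\<And>(D :: real ^ 'n \<Rightarrow> ennreal) j a \<epsilon> \<rho> k n x. stable_jump D j \<alpha> m a \<epsilon> \<Longrightarrow> 0 < \<rho> \<Longrightarrow>
    k \<le> n \<Longrightarrow> 1 \<le> n \<Longrightarrow> real n * \<epsilon> powr \<alpha> \<le> \<rho> powr \<alpha> \<Longrightarrow>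
    (jump_op D (stable_jump.trunc j \<rho>) ^^ k)
      (indicator {y. 2 * real CARD('n) * (1 + real CARD('n) / \<alpha>) * \<rho> \<le> norm (y - x)}) x
    \<le> ennreal (C * (real n * \<epsilon> powr \<alpha> / \<rho> powr \<alpha>) powr (1 + real CARD('n) / \<alpha>))"
proof -
  define d where "d = real CARD('n)"
  define \<beta> where "\<beta> = d / \<alpha>"
  define p :: real where "p = (if \<alpha> < 1 then 1 else 2)"
  have "p - \<alpha> > 0" using assms by (auto simp: p_def)
  then obtain K where K: "K > 0"
    "\<And>r. r > 0 \<Longrightarrow> (\<integral>\<^sup>+z\<in>{z :: real ^ 'n. norm z \<le> r}. ennreal (norm z powr (p - \<alpha> - real CARD('n))) \<partial>lborel)
      \<le> ennreal (K * r powr (p - \<alpha>))"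
    using ball_powr_integral[of "p - \<alpha>"] by blast
  show thesis
  proof (rule that[of "2 * exp (K * m) * d"])
    show "2 * exp (K * m) * d > 0" by (simp add: d_def)
    fix D :: "real ^ 'n \<Rightarrow> ennreal" and j a \<epsilon> \<rho> and k n :: nat and x :: "real ^ 'n"
    assume "stable_jump D j \<alpha> m a \<epsilon>" and rho: "0 < \<rho>" and n: "k \<le> n" "1 \<le> n" and small: "real n * \<epsilon> powr \<alpha> \<le> \<rho> powr \<alpha>"
    then interpret stable_jump D j \<alpha> m a \<epsilon> by simp
    interpret R: symmetric_jump D "trunc \<rho>" by (rule symmetric_jump_trunc)
    define q where "q = \<rho> powr \<alpha> / (real n * \<epsilon> powr \<alpha>)"
    have q: "q \<ge> 1" using small n eps by (simp add: q_def)
    \<comment> \<open>The choice \<open>exp (2 l \<rho>) = q\<close> makes \<open>n\<close> steps multiply the weight by at most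
      \<open>exp (K m)\<close>, while the weight gains a factor \<open>q powr (1 + \<beta>)\<close> at the distance considered.\<close>
    define l where "l = ln q / (2 * \<rho>)"
    have l: "l \<ge> 0" using q rho by (simp add: l_def)
    have eq: "exp (2 * l * \<rho>) = q" using q rho by (simp add: l_def)
    define H where "H y = ennreal (cosh_weight l x y)" for y :: "real ^ 'n"
    have [measurable]: "H \<in> borel_measurable borel" unfolding H_def by measurable
    define \<kappa> where "\<kappa> = K * m / real n"
    have \<kappa>: "\<kappa> \<ge> 0" using K m by (simp add: \<kappa>_def)
    have step: "R \<rho> H y \<le> ennreal (1 + \<kappa>) * H y" for y
    proof -
      have "(\<epsilon> / \<rho>) powr \<alpha> * q = 1 / real n" using eps rho n by (simp add: q_def powr_divide)
      then have "K * m * (\<epsilon> / \<rho>) powr \<alpha> * exp (2 * l * \<rho>) = \<kappa>"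
        unfolding eq \<kappa>_def by (simp only: mult.assoc) simp
      then show ?thesis
        using trunc_step[OF l rho _ p_def K(2)[OF rho], of x y] K by (simp add: H_def[abs_def])
    qed
    have "(R \<rho> ^^ k) H y \<le> ennreal ((1 + \<kappa>) ^ k) * H y" for y
    proof (induction k arbitrary: y)
      case (Suc k)
      have "R \<rho> ((R \<rho> ^^ k) H) y \<le> R \<rho> (\<lambda>y. ennreal ((1 + \<kappa>) ^ k) * H y) y" by (rule R.T_mono) (rule Suc)
      also have "\<dots> = ennreal ((1 + \<kappa>) ^ k) * R \<rho> H y" by (rule R.T_cmult) simp
      also have "\<dots> \<le> ennreal ((1 + \<kappa>) ^ k) * (ennreal (1 + \<kappa>) * H y)" by (intro mult_left_mono step) auto
      finally show ?case using \<kappa> by (simp add: ennreal_mult mult_ac)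
    qed simp
    then have Hk: "(R \<rho> ^^ k) H x \<le> ennreal ((1 + \<kappa>) ^ k) * H x" .
    have pw: "(1 + \<kappa>) ^ k \<le> exp (K * m)"
    proof -
      have "(1 + \<kappa>) ^ k \<le> (1 + \<kappa>) ^ n" using \<kappa> n by (intro power_increasing) auto
      also have "\<dots> \<le> exp \<kappa> ^ n" using \<kappa> by (intro power_mono) auto
      also have "\<dots> = exp (K * m)" using n by (simp add: \<kappa>_def flip: exp_of_nat_mult)
      finally show ?thesis .
    qed
    let ?A = "{y. 2 * real CARD('n) * (1 + real CARD('n) / \<alpha>) * \<rho> \<le> norm (y - x)}"
    have ind: "indicator ?A y \<le> ennreal (2 * q powr (- (1 + \<beta>))) * H y" for y
    proof (cases "y \<in> ?A")
      case True
      have "exp (l * (2 * d * (1 + \<beta>) * \<rho>) / d) \<le> 2 * cosh_weight l x y"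
        unfolding d_def by (rule cosh_weight_far[OF l]) (use True in \<open>simp add: \<beta>_def d_def\<close>)
      also have "exp (l * (2 * d * (1 + \<beta>) * \<rho>) / d) = q powr (1 + \<beta>)"
        using q rho by (simp add: l_def d_def powr_def mult.commute)
      finally have "q powr (- (1 + \<beta>)) * q powr (1 + \<beta>) \<le> q powr (- (1 + \<beta>)) * (2 * cosh_weight l x y)"
        by (intro mult_left_mono) auto
      moreover have "q powr (- (1 + \<beta>)) * q powr (1 + \<beta>) = 1"
        using q by (simp flip: powr_add)
      ultimately have "1 \<le> 2 * q powr (- (1 + \<beta>)) * cosh_weight l x y" by simp
      then have "ennreal 1 \<le> ennreal (2 * q powr (- (1 + \<beta>)) * cosh_weight l x y)" by (rule ennreal_leI)
      also have "\<dots> = ennreal (2 * q powr (- (1 + \<beta>))) * H y" unfolding H_def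
        by (rule ennreal_mult) (auto simp: cosh_weight_nonneg)
      finally show ?thesis using True by simp
    qed simp
    have "(R \<rho> ^^ k) (indicator ?A) x \<le> (R \<rho> ^^ k) (\<lambda>y. ennreal (2 * q powr (- (1 + \<beta>))) * H y) x"
      by (rule R.Tn_mono) (rule ind)
    also have "\<dots> = ennreal (2 * q powr (- (1 + \<beta>))) * (R \<rho> ^^ k) H x" by (rule R.Tn_cmult) simp
    also have "\<dots> \<le> ennreal (2 * q powr (- (1 + \<beta>))) * (ennreal (exp (K * m)) * ennreal d)"
    proof (intro mult_left_mono order.trans[OF Hk] mult_mono ennreal_leI pw)
      show "H x \<le> ennreal d" by (simp add: H_def cosh_weight_refl d_def)
    qed auto
    also have "\<dots> = ennreal (2 * exp (K * m) * d * (real n * \<epsilon> powr \<alpha> / \<rho> powr \<alpha>) powr (1 + \<beta>))"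
    proof -
      have "(real n * \<epsilon> powr \<alpha> / \<rho> powr \<alpha>) = 1 / q" by (simp add: q_def)
      then have "q powr (- (1 + \<beta>)) = (real n * \<epsilon> powr \<alpha> / \<rho> powr \<alpha>) powr (1 + \<beta>)"
        using powr_minus_divide[of q "1 + \<beta>"] by (simp add: powr_divide)
      then show ?thesis by (simp add: d_def mult_ac flip: ennreal_mult)
    qed
    finally show "(R \<rho> ^^ k) (indicator ?A) x
      \<le> ennreal (2 * exp (K * m) * d * (real n * \<epsilon> powr \<alpha> / \<rho> powr \<alpha>) powr (1 + real CARD('n) / \<alpha>))"
      by (simp add: \<beta>_def d_def)
  qed
qed

text \<open>Write \<open>n = k + l\<close> and split at the ball of half the distance. Apart from terms controlled by
  the on-diagonal bound times a tail, the atoms \<open>D ^ k\<close> and \<open>D ^ l\<close> reproduce the quantity at \<open>l\<close> and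
  \<open>k\<close> steps; since \<open>D \<le> 1 - a < 1\<close>, induction on \<open>n\<close> absorbs them.\<close>

lemma off_diagonal_bound_trunc:
  fixes \<alpha> m a :: real
  assumes "0 < \<alpha>" "\<alpha> < 2" "0 < m" "0 < a" "a \<le> 1 / 2"
  obtains C where "C > 0" "\<And>(D :: real ^ 'n \<Rightarrow> ennreal) j \<epsilon> \<rho> \<phi> n x. stable_jump D j \<alpha> m a \<epsilon> \<Longrightarrow> 0 < \<rho> \<Longrightarrow>
    real n * \<epsilon> powr \<alpha> \<le> \<rho> powr \<alpha> \<Longrightarrow> \<phi> \<in> borel_measurable borel \<Longrightarrow>
    (\<And>y. norm (y - x) < 4 * real CARD('n) * (1 + real CARD('n) / \<alpha>) * \<rho> \<Longrightarrow> \<phi> y = 0) \<Longrightarrow>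
    (jump_op D (stable_jump.trunc j \<rho>) ^^ n) \<phi> x
      \<le> ennreal (C * (real n * \<epsilon> powr \<alpha> * \<rho> powr (- \<alpha> - real CARD('n)))) * (\<integral>\<^sup>+y. \<phi> y \<partial>lborel)"
proof -
  define d where "d = real CARD('n)"
  define \<beta> where "\<beta> = d / \<alpha>"
  have b: "\<beta> > 0" using assms by (simp add: \<beta>_def d_def)
  have ab: "\<alpha> * \<beta> = d" using assms by (simp add: \<beta>_def)
  obtain C1 where C1: "C1 > 0" "\<And>(D :: real ^ 'n \<Rightarrow> ennreal) j \<epsilon> \<phi> n x. stable_jump D j \<alpha> m a \<epsilon> \<Longrightarrow> \<phi> \<in> borel_measurable borel \<Longrightarrow>
    (jump_op D j ^^ n) \<phi> x \<le> D x ^ n * \<phi> x + ennreal (C1 * \<epsilon> powr (- d) * real n powr (- \<beta>)) * (\<integral>\<^sup>+y. \<phi> y \<partial>lborel)"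
    unfolding \<beta>_def d_def by (rule on_diagonal_bound[of \<alpha> m a]) (use assms in blast)+
  obtain Ct where Ct: "Ct > 0" "\<And>(D :: real ^ 'n \<Rightarrow> ennreal) j a \<epsilon> \<rho> k n x. stable_jump D j \<alpha> m a \<epsilon> \<Longrightarrow> 0 < \<rho> \<Longrightarrow>
    k \<le> n \<Longrightarrow> 1 \<le> n \<Longrightarrow> real n * \<epsilon> powr \<alpha> \<le> \<rho> powr \<alpha> \<Longrightarrow>
    (jump_op D (stable_jump.trunc j \<rho>) ^^ k) (indicator {y. 2 * d * (1 + \<beta>) * \<rho> \<le> norm (y - x)}) x
    \<le> ennreal (Ct * (real n * \<epsilon> powr \<alpha> / \<rho> powr \<alpha>) powr (1 + \<beta>))"
    unfolding \<beta>_def d_def by (rule trunc_tail[of \<alpha> m]) (use assms in blast)+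
  define Q where "Q = 2 * C1 * 3 powr \<beta> * Ct"
  have Q: "Q > 0" using C1 Ct by (simp add: Q_def)
  \<comment> \<open>The fixed point of C = (1 - a) * C + Q: the atoms reproduce at most (1 - a) * C
    of the induction hypothesis, and Q bounds the two tail terms. In Q,
    \<open>3 powr \<beta>\<close> accounts for halves of length at least n / 3.\<close>
  define C where "C = Q / a"
  have C: "C > 0" "(1 - a) * C + Q = C" using Q assms by (auto simp: C_def field_simps)
  show thesis
  proof (rule that[of C])
    fix D :: "real ^ 'n \<Rightarrow> ennreal" and j \<epsilon> \<rho> n and \<phi> :: "real ^ 'n \<Rightarrow> ennreal" and x :: "real ^ 'n"
    assume sj: "stable_jump D j \<alpha> m a \<epsilon>" and rho: "0 < \<rho>"
      and small: "real n * \<epsilon> powr \<alpha> \<le> \<rho> powr \<alpha>" and [measurable]: "\<phi> \<in> borel_measurable borel"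
      and supp: "\<And>y. norm (y - x) < 4 * real CARD('n) * (1 + real CARD('n) / \<alpha>) * \<rho> \<Longrightarrow> \<phi> y = 0"
    interpret stable_jump D j \<alpha> m a \<epsilon> by (rule sj)
    interpret R: symmetric_jump D "trunc \<rho>" by (rule symmetric_jump_trunc)
    define r where "r = 2 * d * (1 + \<beta>) * \<rho>"
    have d1: "d \<ge> 1" by (simp add: d_def)
    have rr: "\<rho> < r"
    proof -
      have "1 * 1 \<le> d * (1 + \<beta>)" using d1 b by (intro mult_mono) auto
      then have "1 * \<rho> < 2 * d * (1 + \<beta>) * \<rho>" using rho by (intro mult_strict_right_mono) auto
      then show ?thesis by (simp add: r_def)
    qed
    have supp': "\<phi> y = 0" if "norm (y - x) < 2 * r" for y
      using supp[of y] that by (simp add: r_def d_def \<beta>_def mult.assoc)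
    define F where "F = \<epsilon> powr \<alpha> * \<rho> powr (- \<alpha> - d)"
    have F: "F \<ge> 0" by (simp add: F_def)
    let ?J = "\<integral>\<^sup>+y. \<phi> y \<partial>lborel"
    let ?B = "{z. norm (z - x) < r}"
    have [measurable]: "?B \<in> sets borel" by measurable
    have "(R \<rho> ^^ n) \<phi> x \<le> ennreal (C * (real n * F)) * ?J" using small
    proof (induction n rule: less_induct)
      case (less n)
      consider "n = 0" | "n = 1" | "2 \<le> n" by linarith
      then show ?case
      proof cases
        case 1
        then show ?thesis using supp'[of x] rr rho by simp
      next
        \<comment> \<open>A single step cannot be divided into two shorter nonempty parts. It is
          harmless, since one jump of length at most \<rho> does not reach the support of
          \<phi>.\<close>
        case 2
        have "trunc \<rho> x y * \<phi> y = 0" for y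
          using supp'[of y] rr rho by (cases "norm (y - x) \<le> \<rho>") (auto simp: trunc_def)
        then have "(\<integral>\<^sup>+y. trunc \<rho> x y * \<phi> y \<partial>lborel) = (\<integral>\<^sup>+y. 0 \<partial>(lborel :: (real ^ 'n) measure))"
          by (intro nn_integral_cong)
        then show ?thesis using supp'[of x] rr rho 2 by (simp add: jump_op_def)
      next
        case 3
        define k where "k = n div 2"
        define l where "l = n - k"
        have kl: "k + l = n" "1 \<le> k" "1 \<le> l" "k < n" "l < n" "n \<le> 3 * k" "n \<le> 3 * l" "k \<le> n" "l \<le> n"
          using 3 by (auto simp: k_def l_def)
        define \<tau> where "\<tau> = Ct * (real n * \<epsilon> powr \<alpha> / \<rho> powr \<alpha>) powr (1 + \<beta>)"
        have tau: "\<tau> \<ge> 0" using Ct by (simp add: \<tau>_def)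
        have tail: "(R \<rho> ^^ i) (indicator {z. r \<le> norm (z - y)}) y \<le> ennreal \<tau>" if "i \<le> n" for i y
          using Ct(2)[OF sj rho that _ less.prems, of y] 3 by (simp add: \<tau>_def r_def)
        define P where "P i = C1 * \<epsilon> powr (- d) * real i powr (- \<beta>)" for i :: nat
        have P: "P i \<ge> 0" for i using C1 by (simp add: P_def)
        \<comment> \<open>On-diagonal bound times tail: the powers of n combine to n itself, those
          of \<epsilon> to \<alpha>, those of \<rho> to -\<alpha> - d.\<close>
        have PQ: "2 * (P i * \<tau>) \<le> Q * (real n * F)" if "n \<le> 3 * i" "1 \<le> i" for i
        proof -
          have "real i powr (- \<beta>) \<le> (real n / 3) powr (- \<beta>)" using that b 3 by (intro powr_mono2') auto
          also have "\<dots> = 3 powr \<beta> * real n powr (- \<beta>)" by (simp add: powr_divide powr_minus field_simps)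
          finally have "2 * (P i * \<tau>) \<le> 2 * (C1 * \<epsilon> powr (- d) * (3 powr \<beta> * real n powr (- \<beta>)) * \<tau>)"
            unfolding P_def using C1 tau by (intro mult_left_mono mult_right_mono) auto
          also have "\<dots> = Q * (real n powr (- \<beta>) * real n powr (1 + \<beta>) * (\<epsilon> powr (- d) * (\<epsilon> powr \<alpha>) powr (1 + \<beta>)) * (\<rho> powr \<alpha>) powr (- (1 + \<beta>)))"
            by (simp only: \<tau>_def Q_def powr_divide powr_mult) (simp only: powr_minus divide_inverse mult_ac)
          also have "real n powr (- \<beta>) * real n powr (1 + \<beta>) = real n" using 3 by (simp flip: powr_add)
          also have "\<epsilon> powr (- d) * (\<epsilon> powr \<alpha>) powr (1 + \<beta>) = \<epsilon> powr \<alpha>"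
            by (simp add: powr_powr distrib_left ab flip: powr_add)
          also have "(\<rho> powr \<alpha>) powr (- (1 + \<beta>)) = \<rho> powr (- \<alpha> - d)"
            unfolding powr_powr by (simp add: algebra_simps ab)
          finally show ?thesis by (simp add: F_def mult.assoc)
        qed
        have IH: "(R \<rho> ^^ i) \<phi> x \<le> ennreal (C * (real i * F)) * ?J" if "i < n" for i
        proof (rule less.IH[OF that])
          have "real i * \<epsilon> powr \<alpha> \<le> real n * \<epsilon> powr \<alpha>" using that by (intro mult_right_mono) auto
          then show "real i * \<epsilon> powr \<alpha> \<le> \<rho> powr \<alpha>" using less.prems by linarith
        qed
        let ?\<psi> = "(R \<rho> ^^ l) \<phi>"
        \<comment> \<open>Paths within r of x after k steps. The last l steps must still cover a
          distance r to the support, a tail event when viewed backwards from y by symmetry. The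
          on-diagonal bound for the first k steps provides the density, and its atom leaves l steps
          from x to the induction hypothesis.\<close>
        have near: "(R \<rho> ^^ k) (\<lambda>z. indicator ?B z * ?\<psi> z) x \<le> ennreal ((1 - a) ^ k * (C * (real l * F)) + P k * \<tau>) * ?J"
        proof -
          \<comment> \<open>The support starts at distance 2r from x, so all of the ball of radius r
            about x is at distance more than r from any such y.\<close>
          have B_le: "indicator ?B z \<le> (indicator {z. r \<le> norm (z - y)} z :: ennreal)" if "\<phi> y \<noteq> 0" for y z
          proof -
            have "2 * r \<le> norm (y - x)" using that supp'[of y] by force
            moreover have "norm (y - x) \<le> norm (z - y) + norm (z - x)"
              using norm_triangle_ineq[of "y - z" "z - x"] by (simp add: norm_minus_commute)
            ultimately show ?thesis by (auto simp: indicator_def)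
          qed
          have "(\<integral>\<^sup>+z. indicator ?B z * ?\<psi> z \<partial>lborel) = (\<integral>\<^sup>+y. \<phi> y * (R \<rho> ^^ l) (indicator ?B) y \<partial>lborel)"
            by (rule R.Tn_symmetric) auto
          also have "\<dots> \<le> (\<integral>\<^sup>+y. \<phi> y * ennreal \<tau> \<partial>lborel)"
          proof (rule nn_integral_mono)
            fix y show "\<phi> y * (R \<rho> ^^ l) (indicator ?B) y \<le> \<phi> y * ennreal \<tau>"
            proof (cases "\<phi> y = 0")
              case False
              show ?thesis
                by (intro mult_left_mono order.trans[OF R.Tn_mono tail[of l y]] B_le False) (use kl in auto)
            qed simp
          qed
          also have "\<dots> = ?J * ennreal \<tau>" by (rule nn_integral_multc) simp
          finally have J: "(\<integral>\<^sup>+z. indicator ?B z * ?\<psi> z \<partial>lborel) \<le> ?J * ennreal \<tau>" .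
          have "(R \<rho> ^^ k) (\<lambda>z. indicator ?B z * ?\<psi> z) x \<le> (T ^^ k) (\<lambda>z. indicator ?B z * ?\<psi> z) x"
            by (rule Rn_le_Tn)
          also have "\<dots> \<le> D x ^ k * (indicator ?B x * ?\<psi> x) + ennreal (P k) * (\<integral>\<^sup>+z. indicator ?B z * ?\<psi> z \<partial>lborel)"
            unfolding P_def by (rule C1(2)[OF sj]) measurable
          also have "\<dots> \<le> ennreal ((1 - a) ^ k) * (1 * (ennreal (C * (real l * F)) * ?J)) + ennreal (P k) * (?J * ennreal \<tau>)"
            by (intro add_mono mult_mono D_power_le IH J) (auto simp: indicator_def kl)
          also have "\<dots> = ennreal ((1 - a) ^ k * (C * (real l * F)) + P k * \<tau>) * ?J"
            using a C F P tau by (subst ennreal_plus) (auto simp: ennreal_mult algebra_simps)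
          finally show ?thesis .
        qed
        \<comment> \<open>The roles are exchanged: the first k steps leave the ball, which is the
          tail event, and the last l steps provide the density. Their atom at z leaves k steps from
          x to the induction hypothesis.\<close>
        have far: "(R \<rho> ^^ k) (\<lambda>z. indicator (- ?B) z * ?\<psi> z) x \<le> ennreal ((1 - a) ^ l * (C * (real k * F)) + P l * \<tau>) * ?J"
        proof -
          have "(R \<rho> ^^ k) (\<lambda>z. indicator (- ?B) z * ?\<psi> z) x
              \<le> (R \<rho> ^^ k) (\<lambda>z. ennreal ((1 - a) ^ l) * \<phi> z + (ennreal (P l) * ?J) * indicator (- ?B) z) x"
          proof (rule R.Tn_mono)
            fix z
            have "?\<psi> z \<le> (T ^^ l) \<phi> z" by (rule Rn_le_Tn)
            also have "\<dots> \<le> D z ^ l * \<phi> z + ennreal (P l) * ?J"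
              unfolding P_def by (rule C1(2)[OF sj]) measurable
            also have "\<dots> \<le> ennreal ((1 - a) ^ l) * \<phi> z + ennreal (P l) * ?J"
              by (intro add_right_mono mult_right_mono D_power_le) auto
            finally show "indicator (- ?B) z * ?\<psi> z \<le> ennreal ((1 - a) ^ l) * \<phi> z + (ennreal (P l) * ?J) * indicator (- ?B) z"
              by (auto simp: indicator_def)
          qed
          also have "\<dots> = ennreal ((1 - a) ^ l) * (R \<rho> ^^ k) \<phi> x + (ennreal (P l) * ?J) * (R \<rho> ^^ k) (indicator (- ?B)) x"
            by (subst R.Tn_add, measurable) (simp add: R.Tn_cmult)
          also have "\<dots> \<le> ennreal ((1 - a) ^ l) * (ennreal (C * (real k * F)) * ?J) + (ennreal (P l) * ?J) * ennreal \<tau>"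
          proof (intro add_mono mult_left_mono IH kl)
            have "- ?B = {z. r \<le> norm (z - x)}" by auto
            then show "(R \<rho> ^^ k) (indicator (- ?B)) x \<le> ennreal \<tau>" using tail[of k x] kl by simp
          qed auto
          also have "\<dots> = ennreal ((1 - a) ^ l * (C * (real k * F)) + P l * \<tau>) * ?J"
            using a C F P tau by (subst ennreal_plus) (auto simp: ennreal_mult algebra_simps)
          finally show ?thesis .
        qed
        have "(R \<rho> ^^ n) \<phi> x = (R \<rho> ^^ k) (\<lambda>z. indicator ?B z * ?\<psi> z + indicator (- ?B) z * ?\<psi> z) x"
        proof -
          have "(\<lambda>z. indicator ?B z * ?\<psi> z + indicator (- ?B) z * ?\<psi> z) = ?\<psi>"
            by (auto simp: indicator_def)
          then show ?thesis by (simp add: kl(1)[symmetric] funpow_add)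
        qed
        also have "\<dots> = (R \<rho> ^^ k) (\<lambda>z. indicator ?B z * ?\<psi> z) x + (R \<rho> ^^ k) (\<lambda>z. indicator (- ?B) z * ?\<psi> z) x"
          by (rule R.Tn_add) measurable
        also have "\<dots> \<le> ennreal ((1 - a) ^ k * (C * (real l * F)) + P k * \<tau>) * ?J + ennreal ((1 - a) ^ l * (C * (real k * F)) + P l * \<tau>) * ?J"
          by (rule add_mono[OF near far])
        also have "\<dots> = ennreal (((1 - a) ^ k * (C * (real l * F)) + P k * \<tau>) + ((1 - a) ^ l * (C * (real k * F)) + P l * \<tau>)) * ?J"
          using a C F P tau by (subst ennreal_plus) (auto simp: distrib_right)
        also have "\<dots> \<le> ennreal (C * (real n * F)) * ?J"
        proof (intro mult_right_mono ennreal_leI)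
          have th: "(1 - a) ^ i \<le> 1 - a" if "1 \<le> i" for i
            using power_decreasing[of 1 i "1 - a"] that a by simp
          have "(1 - a) ^ k * (C * (real l * F)) \<le> (1 - a) * (C * (real l * F))"
            "(1 - a) ^ l * (C * (real k * F)) \<le> (1 - a) * (C * (real k * F))"
            using kl C F by (auto intro!: mult_right_mono th)
          moreover have "(1 - a) * (C * (real l * F)) + (1 - a) * (C * (real k * F)) = (1 - a) * C * (real n * F)"
            by (simp add: kl(1)[symmetric] algebra_simps)
          moreover have "P k * \<tau> + P l * \<tau> \<le> Q * (real n * F)" using PQ[of k] PQ[of l] kl by auto
          ultimately have "((1 - a) ^ k * (C * (real l * F)) + P k * \<tau>) + ((1 - a) ^ l * (C * (real k * F)) + P l * \<tau>)
              \<le> ((1 - a) * C + Q) * (real n * F)" unfolding distrib_right[of "(1 - a) * C" Q] by linarith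
          then show "((1 - a) ^ k * (C * (real l * F)) + P k * \<tau>) + ((1 - a) ^ l * (C * (real k * F)) + P l * \<tau>) \<le> C * (real n * F)"
            by (simp only: C(2))
        qed simp
        finally show ?thesis .
      qed
    qed
    then show "(R \<rho> ^^ n) \<phi> x \<le> ennreal (C * (real n * \<epsilon> powr \<alpha> * \<rho> powr (- \<alpha> - real CARD('n)))) * ?J"
      by (simp add: F_def d_def mult.assoc)
  qed (fact C)
qed

text \<open>In the regime of the truncated bound, restoring the long jumps costs at most a term of
  the same form. For larger n the on-diagonal bound is already the smaller one, its atom vanishing
  because \<phi> x = 0.\<close>

lemma off_diagonal_bound:
  fixes \<alpha> m a :: real
  assumes "0 < \<alpha>" "\<alpha> < 2" "0 < m" "0 < a" "a \<le> 1 / 2"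
  obtains C where "C > 0" "\<And>(D :: real ^ 'n \<Rightarrow> ennreal) j \<epsilon> r \<phi> n x. stable_jump D j \<alpha> m a \<epsilon> \<Longrightarrow> 0 < r \<Longrightarrow>
    \<phi> \<in> borel_measurable borel \<Longrightarrow> (\<And>y. norm (y - x) < r \<Longrightarrow> \<phi> y = 0) \<Longrightarrow>
    (jump_op D j ^^ n) \<phi> x \<le> ennreal (C * (real n * \<epsilon> powr \<alpha> * r powr (- \<alpha> - real CARD('n)))) * (\<integral>\<^sup>+y. \<phi> y \<partial>lborel)"
proof -
  define d where "d = real CARD('n)"
  define \<beta> where "\<beta> = d / \<alpha>"
  have b: "\<beta> > 0" using assms by (simp add: \<beta>_def d_def)
  have ab: "\<alpha> * \<beta> = d" using assms by (simp add: \<beta>_def)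
  obtain C1 where C1: "C1 > 0" "\<And>(D :: real ^ 'n \<Rightarrow> ennreal) j \<epsilon> \<phi> n x. stable_jump D j \<alpha> m a \<epsilon> \<Longrightarrow> \<phi> \<in> borel_measurable borel \<Longrightarrow>
    (jump_op D j ^^ n) \<phi> x \<le> D x ^ n * \<phi> x + ennreal (C1 * \<epsilon> powr (- d) * real n powr (- \<beta>)) * (\<integral>\<^sup>+y. \<phi> y \<partial>lborel)"
    unfolding \<beta>_def d_def by (rule on_diagonal_bound[of \<alpha> m a]) (use assms in blast)+
  obtain C2 where C2: "C2 > 0" "\<And>(D :: real ^ 'n \<Rightarrow> ennreal) j \<epsilon> \<rho> \<phi> n x. stable_jump D j \<alpha> m a \<epsilon> \<Longrightarrow> 0 < \<rho> \<Longrightarrow>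
    real n * \<epsilon> powr \<alpha> \<le> \<rho> powr \<alpha> \<Longrightarrow> \<phi> \<in> borel_measurable borel \<Longrightarrow>
    (\<And>y. norm (y - x) < 4 * d * (1 + \<beta>) * \<rho> \<Longrightarrow> \<phi> y = 0) \<Longrightarrow>
    (jump_op D (stable_jump.trunc j \<rho>) ^^ n) \<phi> x
      \<le> ennreal (C2 * (real n * \<epsilon> powr \<alpha> * \<rho> powr (- \<alpha> - d))) * (\<integral>\<^sup>+y. \<phi> y \<partial>lborel)"
    unfolding \<beta>_def d_def by (rule off_diagonal_bound_trunc[of \<alpha> m a]) (use assms in blast)+
  \<comment> \<open>The ratio of the support radius to the truncation length in
    \<open>off_diagonal_bound_trunc\<close>; rescaling by it costs
    \<open>c powr (\<alpha> + d)\<close>.\<close>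
  define c where "c = 4 * d * (1 + \<beta>)"
  have c: "c > 0" using b by (simp add: c_def d_def)
  define C where "C = (C1 + C2 + m) * c powr (\<alpha> + d)"
  show thesis
  proof (rule that[of C])
    show "C > 0" using C1 C2 assms c by (simp add: C_def add_pos_pos)
    fix D :: "real ^ 'n \<Rightarrow> ennreal" and j \<epsilon> r n and \<phi> :: "real ^ 'n \<Rightarrow> ennreal" and x :: "real ^ 'n"
    assume sj: "stable_jump D j \<alpha> m a \<epsilon>" and r: "0 < r" and [measurable]: "\<phi> \<in> borel_measurable borel"
      and supp: "\<And>y. norm (y - x) < r \<Longrightarrow> \<phi> y = 0"
    interpret stable_jump D j \<alpha> m a \<epsilon> by (rule sj)
    let ?J = "\<integral>\<^sup>+y. \<phi> y \<partial>lborel"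
    define \<rho> where "\<rho> = r / c"
    have rho: "\<rho> > 0" "c * \<rho> = r" using r c by (auto simp: \<rho>_def)
    define F where "F = real n * \<epsilon> powr \<alpha> * \<rho> powr (- \<alpha> - d)"
    have F: "F \<ge> 0" by (simp add: F_def)
    have "\<rho> powr (- \<alpha> - d) = c powr (\<alpha> + d) * r powr (- \<alpha> - d)"
    proof -
      have "c powr (\<alpha> + d) * c powr (- \<alpha> - d) = 1" using c by (simp flip: powr_add)
      then show ?thesis unfolding \<rho>_def powr_divide using c by (simp add: field_simps)
    qed
    then have CF: "C * (real n * \<epsilon> powr \<alpha> * r powr (- \<alpha> - d)) = (C1 + C2 + m) * F"
      by (simp add: C_def F_def mult_ac)
    have "(T ^^ n) \<phi> x \<le> ennreal ((C1 + C2 + m) * F) * ?J"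
    proof (cases "real n * \<epsilon> powr \<alpha> \<le> \<rho> powr \<alpha>")
      case True
      have "(T ^^ n) \<phi> x \<le> (R \<rho> ^^ n) \<phi> x + ennreal (m * F) * ?J"
        using Tn_le_Rn[OF rho(1), of \<phi> n x] by (simp add: F_def d_def mult_ac)
      also have "(R \<rho> ^^ n) \<phi> x \<le> ennreal (C2 * F) * ?J"
        unfolding F_def using supp rho by (intro C2(2)[OF sj rho(1) True]) (auto simp: c_def)
      also have "ennreal (C2 * F) * ?J + ennreal (m * F) * ?J = ennreal ((C2 + m) * F) * ?J"
        using C2 m F by (simp add: distrib_right ennreal_plus)
      also have "\<dots> \<le> ennreal ((C1 + C2 + m) * F) * ?J"
        using C1 F by (intro mult_right_mono ennreal_leI) auto
      finally show ?thesis by simp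
    next
      case False
      then have n: "n \<noteq> 0" by (cases n) auto
      have "(T ^^ n) \<phi> x \<le> ennreal (C1 * \<epsilon> powr (- d) * real n powr (- \<beta>)) * ?J"
        using C1(2)[OF sj, of \<phi> n x] supp[of x] r by simp
      also have "\<dots> \<le> ennreal ((C1 + C2 + m) * F) * ?J"
      proof (intro mult_right_mono ennreal_leI)
        have "1 \<le> (real n * \<epsilon> powr \<alpha> * \<rho> powr (- \<alpha>)) powr (1 + \<beta>)"
          using False rho b n eps by (intro ge_one_powr_ge_zero) (auto simp: powr_minus field_simps)
        then have "\<epsilon> powr (- d) * real n powr (- \<beta>) * 1 \<le> \<epsilon> powr (- d) * real n powr (- \<beta>) * (real n * \<epsilon> powr \<alpha> * \<rho> powr (- \<alpha>)) powr (1 + \<beta>)"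
          by (intro mult_left_mono) auto
        also have "\<dots> = (real n powr (- \<beta>) * real n powr (1 + \<beta>)) * (\<epsilon> powr (- d) * (\<epsilon> powr \<alpha>) powr (1 + \<beta>)) * (\<rho> powr (- \<alpha>)) powr (1 + \<beta>)"
          by (simp only: powr_mult mult_ac)
        also have "real n powr (- \<beta>) * real n powr (1 + \<beta>) = real n" using n by (simp flip: powr_add)
        also have "\<epsilon> powr (- d) * (\<epsilon> powr \<alpha>) powr (1 + \<beta>) = \<epsilon> powr \<alpha>"
          by (simp add: powr_powr distrib_left ab flip: powr_add)
        also have "(\<rho> powr (- \<alpha>)) powr (1 + \<beta>) = \<rho> powr (- \<alpha> - d)"
          unfolding powr_powr by (simp add: algebra_simps ab)
        finally have "C1 * (\<epsilon> powr (- d) * real n powr (- \<beta>)) \<le> C1 * F"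
          using C1 by (intro mult_left_mono) (auto simp: F_def)
        also have "\<dots> \<le> (C1 + C2 + m) * F" using C2 m F by (intro mult_right_mono) auto
        finally show "C1 * \<epsilon> powr (- d) * real n powr (- \<beta>) \<le> (C1 + C2 + m) * F" by (simp add: mult.assoc)
      qed simp
      finally show ?thesis .
    qed
    then show "(T ^^ n) \<phi> x \<le> ennreal (C * (real n * \<epsilon> powr \<alpha> * r powr (- \<alpha> - real CARD('n)))) * ?J"
      using CF by (simp add: d_def)
  qed
qed

text \<open>The off-diagonal bound sees only the distance to the support of a function. Cutting
  \<phi> into dyadic annuli about x turns it into a pointwise kernel, because the distance varies by
  at most a factor 2 on each piece and the powers of T are countably additive.\<close>

lemma chain_bound:
  fixes \<alpha> m a :: real
  assumes "0 < \<alpha>" "\<alpha> < 2" "0 < m" "0 < a" "a \<le> 1 / 2"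
  obtains C where "C > 0" "\<And>(D :: real ^ 'n \<Rightarrow> ennreal) j \<epsilon> \<phi> n x. stable_jump D j \<alpha> m a \<epsilon> \<Longrightarrow>
    \<phi> \<in> borel_measurable borel \<Longrightarrow>
    (jump_op D j ^^ n) \<phi> x \<le> D x ^ n * \<phi> x + ennreal C * (\<integral>\<^sup>+y. \<phi> y *
      ennreal (min (\<epsilon> powr (- real CARD('n)) * real n powr (- (real CARD('n) / \<alpha>)))
        (real n * \<epsilon> powr \<alpha> * norm (y - x) powr (- \<alpha> - real CARD('n)))) \<partial>lborel)"
proof -
  define d where "d = real CARD('n)"
  define \<beta> where "\<beta> = d / \<alpha>"
  have b: "\<beta> > 0" using assms by (simp add: \<beta>_def d_def)
  have ab: "\<alpha> * \<beta> = d" using assms by (simp add: \<beta>_def)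
  obtain C1 where C1: "C1 > 0" "\<And>(D :: real ^ 'n \<Rightarrow> ennreal) j \<epsilon> \<phi> n x. stable_jump D j \<alpha> m a \<epsilon> \<Longrightarrow> \<phi> \<in> borel_measurable borel \<Longrightarrow>
    (jump_op D j ^^ n) \<phi> x \<le> D x ^ n * \<phi> x + ennreal (C1 * \<epsilon> powr (- d) * real n powr (- \<beta>)) * (\<integral>\<^sup>+y. \<phi> y \<partial>lborel)"
    unfolding \<beta>_def d_def by (rule on_diagonal_bound[of \<alpha> m a]) (use assms in blast)+
  obtain C2 where C2: "C2 > 0" "\<And>(D :: real ^ 'n \<Rightarrow> ennreal) j \<epsilon> r \<phi> n x. stable_jump D j \<alpha> m a \<epsilon> \<Longrightarrow> 0 < r \<Longrightarrow>
    \<phi> \<in> borel_measurable borel \<Longrightarrow> (\<And>y. norm (y - x) < r \<Longrightarrow> \<phi> y = 0) \<Longrightarrow>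
    (jump_op D j ^^ n) \<phi> x \<le> ennreal (C2 * (real n * \<epsilon> powr \<alpha> * r powr (- \<alpha> - d))) * (\<integral>\<^sup>+y. \<phi> y \<partial>lborel)"
    unfolding d_def by (rule off_diagonal_bound[of \<alpha> m a]) (use assms in blast)+
  define C where "C = C1 + C2 * 2 powr (\<alpha> + d)"
  have C: "C > 0" "C1 \<le> C" "C2 * 2 powr (\<alpha> + d) \<le> C" using C1 C2 by (auto simp: C_def add_pos_pos)
  show thesis
  proof (rule that[of C])
    fix D :: "real ^ 'n \<Rightarrow> ennreal" and j \<epsilon> n and \<phi> :: "real ^ 'n \<Rightarrow> ennreal" and x :: "real ^ 'n"
    assume sj: "stable_jump D j \<alpha> m a \<epsilon>" and [measurable]: "\<phi> \<in> borel_measurable borel"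
    interpret stable_jump D j \<alpha> m a \<epsilon> by (rule sj)
    define g where "g y = min (\<epsilon> powr (- d) * real n powr (- \<beta>)) (real n * \<epsilon> powr \<alpha> * norm (y - x) powr (- \<alpha> - d))" for y
    have g0: "g y \<ge> 0" for y by (simp add: g_def)
    have [measurable]: "g \<in> borel_measurable borel" unfolding g_def by measurable
    have "(T ^^ n) \<phi> x \<le> D x ^ n * \<phi> x + ennreal C * (\<integral>\<^sup>+y. \<phi> y * ennreal (g y) \<partial>lborel)"
    proof (cases "n = 0")
      case False
      \<comment> \<open>The radius at which the two members of the minimum coincide, as
        \<open>r_powr\<close> shows.\<close>
      define r where "r = \<epsilon> * real n powr (1 / \<alpha>)"
      have r: "r > 0" using eps False by (simp add: r_def)
      have r_powr: "real n * \<epsilon> powr \<alpha> * r powr (- \<alpha> - d) = \<epsilon> powr (- d) * real n powr (- \<beta>)"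
      proof -
        have e: "1 / \<alpha> * (- \<alpha> - d) = - 1 - \<beta>" using alpha by (simp add: \<beta>_def field_simps)
        have "real n * \<epsilon> powr \<alpha> * r powr (- \<alpha> - d) = (real n powr 1 * real n powr (- 1 - \<beta>)) * (\<epsilon> powr \<alpha> * \<epsilon> powr (- \<alpha> - d))"
          unfolding r_def powr_mult powr_powr e using False by simp
        also have "real n powr 1 * real n powr (- 1 - \<beta>) = real n powr (- \<beta>)"
          unfolding powr_add[symmetric] by simp
        also have "\<epsilon> powr \<alpha> * \<epsilon> powr (- \<alpha> - d) = \<epsilon> powr (- d)" by (simp flip: powr_add)
        finally show ?thesis by (simp only: mult.commute)
      qed
      \<comment> \<open>Index 0 is the inner ball, treated by the on-diagonal bound; index
        \<open>Suc k\<close> is the annulus from 2 ^ k * r to 2 ^ Suc k * r.\<close>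
      define N where "N y = (if norm (y - x) < r then 0 else Suc (nat \<lfloor>log 2 (norm (y - x) / r)\<rfloor>))" for y
      have [measurable]: "N \<in> borel \<rightarrow>\<^sub>M count_space UNIV" unfolding N_def by measurable
      define \<psi> where "\<psi> i y = \<phi> y * indicator {y. N y = i} y" for i y
      have [measurable]: "\<psi> i \<in> borel_measurable borel" for i unfolding \<psi>_def by measurable
      have split: "(\<Sum>i. \<psi> i y) = \<phi> y" for y
      proof -
        have "(\<lambda>i. \<psi> i y) sums \<psi> (N y) y"
          using sums_single[of "N y" "\<lambda>i. \<psi> i y"] by (rule back_subst[of "\<lambda>f. f sums \<psi> (N y) y"]) (auto simp: \<psi>_def)
        then show ?thesis by (simp add: sums_iff \<psi>_def)
      qed
      have piece: "(T ^^ n) (\<psi> i) x \<le> D x ^ n * \<psi> i x + ennreal C * (\<integral>\<^sup>+y. \<psi> i y * ennreal (g y) \<partial>lborel)" for i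
      proof (cases i)
        case 0
        have "(T ^^ n) (\<psi> i) x \<le> D x ^ n * \<psi> i x + ennreal (C1 * \<epsilon> powr (- d) * real n powr (- \<beta>)) * (\<integral>\<^sup>+y. \<psi> i y \<partial>lborel)"
          by (rule C1(2)[OF sj]) measurable
        also have "ennreal (C1 * \<epsilon> powr (- d) * real n powr (- \<beta>)) * (\<integral>\<^sup>+y. \<psi> i y \<partial>lborel)
            = (\<integral>\<^sup>+y. ennreal (C1 * \<epsilon> powr (- d) * real n powr (- \<beta>)) * \<psi> i y \<partial>lborel)"
          by (rule nn_integral_cmult[symmetric]) measurable
        also have "\<dots> \<le> (\<integral>\<^sup>+y. ennreal C * (\<psi> i y * ennreal (g y)) \<partial>lborel)"
        \<comment> \<open>The point y = x must be discarded: there \<open>0 powr _ = 0\<close> makes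
          g vanish.\<close>
        proof (rule nn_integral_mono_AE)
          have "AE y in lborel. y \<noteq> x" by (rule AE_lborel_singleton)
          then show "AE y in lborel. ennreal (C1 * \<epsilon> powr (- d) * real n powr (- \<beta>)) * \<psi> i y \<le> ennreal C * (\<psi> i y * ennreal (g y))"
          proof eventually_elim
            fix y assume "y \<noteq> x"
            show "ennreal (C1 * \<epsilon> powr (- d) * real n powr (- \<beta>)) * \<psi> i y \<le> ennreal C * (\<psi> i y * ennreal (g y))"
            proof (cases "N y = i")
              case True
              then have y: "norm (y - x) < r" using 0 by (auto simp: N_def split: if_splits)
              have "r powr (- \<alpha> - d) \<le> norm (y - x) powr (- \<alpha> - d)"
                using \<open>y \<noteq> x\<close> y alpha by (intro powr_mono2') (auto simp: d_def)
              then have "real n * \<epsilon> powr \<alpha> * r powr (- \<alpha> - d) \<le> real n * \<epsilon> powr \<alpha> * norm (y - x) powr (- \<alpha> - d)"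
                by (intro mult_left_mono) auto
              then have g: "g y = \<epsilon> powr (- d) * real n powr (- \<beta>)" unfolding r_powr by (simp add: g_def)
              have "C1 * \<epsilon> powr (- d) * real n powr (- \<beta>) \<le> C * g y"
                unfolding g mult.assoc using C by (intro mult_right_mono) auto
              then have "ennreal (C1 * \<epsilon> powr (- d) * real n powr (- \<beta>)) * \<psi> i y \<le> ennreal (C * g y) * \<psi> i y"
                by (intro mult_right_mono ennreal_leI) auto
              then show ?thesis using C g0 by (simp add: ennreal_mult mult_ac)
            qed (simp add: \<psi>_def)
          qed
        qed
        also have "\<dots> = ennreal C * (\<integral>\<^sup>+y. \<psi> i y * ennreal (g y) \<partial>lborel)"
          by (rule nn_integral_cmult) measurable
        finally show ?thesis by (simp add: add_left_mono)
      next
        case (Suc k)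
        define s where "s = 2 ^ k * r"
        have s: "s > 0" using r by (simp add: s_def)
        have far: "s \<le> norm (y - x)" "norm (y - x) < 2 * s" if "N y = i" for y
        proof -
          have y: "r \<le> norm (y - x)" "k = nat \<lfloor>log 2 (norm (y - x) / r)\<rfloor>"
            using that Suc by (auto simp: N_def split: if_splits)
          then have "1 \<le> norm (y - x) / r" using r by simp
          from dyadic_bracket[OF this] show "s \<le> norm (y - x)" "norm (y - x) < 2 * s"
            unfolding y(2)[symmetric] using r by (auto simp: s_def field_simps)
        qed
        have "(T ^^ n) (\<psi> i) x \<le> ennreal (C2 * (real n * \<epsilon> powr \<alpha> * s powr (- \<alpha> - d))) * (\<integral>\<^sup>+y. \<psi> i y \<partial>lborel)"
        proof (rule C2(2)[OF sj s])
          show "\<psi> i y = 0" if "norm (y - x) < s" for y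
            using far[of y] that by (auto simp: \<psi>_def indicator_def)
        qed measurable
        also have "\<dots> = (\<integral>\<^sup>+y. ennreal (C2 * (real n * \<epsilon> powr \<alpha> * s powr (- \<alpha> - d))) * \<psi> i y \<partial>lborel)"
          by (rule nn_integral_cmult[symmetric]) measurable
        also have "\<dots> \<le> (\<integral>\<^sup>+y. ennreal C * (\<psi> i y * ennreal (g y)) \<partial>lborel)"
        proof (rule nn_integral_mono)
          fix y
          show "ennreal (C2 * (real n * \<epsilon> powr \<alpha> * s powr (- \<alpha> - d))) * \<psi> i y \<le> ennreal C * (\<psi> i y * ennreal (g y))"
          proof (cases "N y = i")
            case True
            note y = far[OF True]
            have e: "2 powr (\<alpha> + d) * 2 powr (- \<alpha> - d) = (1 :: real)" by (simp flip: powr_add)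
            have "r \<le> s" using r by (simp add: s_def)
            then have "norm (y - x) powr (- \<alpha> - d) \<le> r powr (- \<alpha> - d)"
              using r y alpha by (intro powr_mono2') (auto simp: d_def)
            then have "real n * \<epsilon> powr \<alpha> * norm (y - x) powr (- \<alpha> - d) \<le> real n * \<epsilon> powr \<alpha> * r powr (- \<alpha> - d)"
              by (intro mult_left_mono) auto
            then have g: "g y = real n * \<epsilon> powr \<alpha> * norm (y - x) powr (- \<alpha> - d)" unfolding r_powr by (simp add: g_def)
            have "s powr (- \<alpha> - d) = 2 powr (\<alpha> + d) * (2 * s) powr (- \<alpha> - d)"
              unfolding powr_mult using e by simp
            also have "\<dots> \<le> 2 powr (\<alpha> + d) * norm (y - x) powr (- \<alpha> - d)"
              using y s alpha by (intro mult_left_mono powr_mono2') (auto simp: d_def)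
            finally have "C2 * (real n * \<epsilon> powr \<alpha> * s powr (- \<alpha> - d)) \<le> C2 * (real n * \<epsilon> powr \<alpha> * (2 powr (\<alpha> + d) * norm (y - x) powr (- \<alpha> - d)))"
              using C2 by (intro mult_left_mono) auto
            also have "\<dots> = (C2 * 2 powr (\<alpha> + d)) * g y" by (simp add: g)
            also have "\<dots> \<le> C * g y" using C g0 by (intro mult_right_mono) auto
            finally have "ennreal (C2 * (real n * \<epsilon> powr \<alpha> * s powr (- \<alpha> - d))) * \<psi> i y \<le> ennreal (C * g y) * \<psi> i y"
              by (intro mult_right_mono ennreal_leI) auto
            then show ?thesis using C g0 by (simp add: ennreal_mult mult_ac)
          qed (simp add: \<psi>_def)
        qed
        also have "\<dots> = ennreal C * (\<integral>\<^sup>+y. \<psi> i y * ennreal (g y) \<partial>lborel)"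
          by (rule nn_integral_cmult) measurable
        finally show ?thesis by (simp add: add_increasing)
      qed
      have "(T ^^ n) \<phi> x = (T ^^ n) (\<lambda>y. \<Sum>i. \<psi> i y) x" by (simp add: split)
      also have "\<dots> = (\<Sum>i. (T ^^ n) (\<psi> i) x)" by (rule Tn_suminf) measurable
      also have "\<dots> \<le> (\<Sum>i. D x ^ n * \<psi> i x + ennreal C * (\<integral>\<^sup>+y. \<psi> i y * ennreal (g y) \<partial>lborel))"
        by (intro suminf_le piece summableI)
      also have "\<dots> = D x ^ n * (\<Sum>i. \<psi> i x) + ennreal C * (\<Sum>i. \<integral>\<^sup>+y. \<psi> i y * ennreal (g y) \<partial>lborel)"
        by (subst suminf_add[symmetric]) (auto intro: summableI)
      also have "(\<Sum>i. \<integral>\<^sup>+y. \<psi> i y * ennreal (g y) \<partial>lborel) = (\<integral>\<^sup>+y. (\<Sum>i. \<psi> i y * ennreal (g y)) \<partial>lborel)"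
        by (rule nn_integral_suminf[symmetric]) measurable
      finally show ?thesis by (simp add: split)
    qed simp
    then show "(T ^^ n) \<phi> x \<le> D x ^ n * \<phi> x + ennreal C * (\<integral>\<^sup>+y. \<phi> y *
      ennreal (min (\<epsilon> powr (- real CARD('n)) * real n powr (- (real CARD('n) / \<alpha>)))
        (real n * \<epsilon> powr \<alpha> * norm (y - x) powr (- \<alpha> - real CARD('n)))) \<partial>lborel)"
      by (simp add: g_def \<beta>_def d_def)
  qed (fact C)
qed

section \<open>Exponential of the generator\<close>

text \<open>Pascal's rule: the sum is the forward difference of order \<open>Suc m\<close> of s at
  0, hence the difference of two forward differences of order m.\<close>

lemma binomial_difference:
  fixes s :: "nat \<Rightarrow> real"
  shows "(\<Sum>k\<le>Suc m. real (Suc m choose k) * (- 1) ^ (Suc m - k) * s k)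
    = (\<Sum>k\<le>m. real (m choose k) * (- 1) ^ (m - k) * s (Suc k)) - (\<Sum>k\<le>m. real (m choose k) * (- 1) ^ (m - k) * s k)"
proof -
  have "(\<Sum>k\<le>m. real (m choose k) * (- 1) ^ (m - k) * s k) = - (\<Sum>k\<le>Suc m. real (m choose k) * (- 1) ^ (Suc m - k) * s k)"
    by (auto simp: Suc_diff_le sum_negf[symmetric] intro!: sum.cong)
  also have "\<dots> = - ((- 1) ^ Suc m * s 0 + (\<Sum>k\<le>m. real (m choose Suc k) * (- 1) ^ (m - k) * s (Suc k)))"
    by (subst sum.atMost_Suc_shift) simp
  finally have *: "(\<Sum>k\<le>m. real (m choose k) * (- 1) ^ (m - k) * s k) = \<dots>" .
  have "(\<Sum>k\<le>Suc m. real (Suc m choose k) * (- 1) ^ (Suc m - k) * s k)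
      = (- 1) ^ Suc m * s 0 + (\<Sum>k\<le>m. real (Suc m choose Suc k) * (- 1) ^ (m - k) * s (Suc k))"
    by (subst sum.atMost_Suc_shift) simp
  also have "\<dots> = (- 1) ^ Suc m * s 0 + ((\<Sum>k\<le>m. real (m choose k) * (- 1) ^ (m - k) * s (Suc k))
      + (\<Sum>k\<le>m. real (m choose Suc k) * (- 1) ^ (m - k) * s (Suc k)))"
    by (simp add: distrib_right sum.distrib)
  finally show ?thesis unfolding * by simp
qed

text \<open>If \<open>A = \<Lambda> (S - 1)\<close> on the orbit \<open>s n = S ^ n \<phi>\<close>, then \<open>exp (t A)\<close> is a Poisson mixture of the
  powers of \<open>S\<close>.\<close>

lemma exp_op_poisson:
  fixes A :: "((real ^ 'n) \<Rightarrow> real) \<Rightarrow> real ^ 'n \<Rightarrow> real" and s :: "nat \<Rightarrow> real ^ 'n \<Rightarrow> real"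
  assumes s: "\<And>n. s n \<in> Bb" and B: "\<And>n x. \<bar>s n x\<bar> \<le> B"
    and A_Bb: "\<And>u. u \<in> Bb \<Longrightarrow> A u \<in> Bb"
    and A_linear: "\<And>c u v. u \<in> Bb \<Longrightarrow> v \<in> Bb \<Longrightarrow> A (\<lambda>x. c * (u x - v x)) = (\<lambda>x. c * (A u x - A v x))"
    and A_s: "\<And>n. A (s n) = (\<lambda>x. \<Lambda> * (s (Suc n) x - s n x))"
  shows "summable (\<lambda>n. exp (- (\<Lambda> * t)) * (\<Lambda> * t) ^ n / fact n * s n x)"
    and "exp_op t A (s 0) x = (\<Sum>n. exp (- (\<Lambda> * t)) * (\<Lambda> * t) ^ n / fact n * s n x)"
proof -
  have Am_Bb: "(A ^^ m) u \<in> Bb" if "u \<in> Bb" for m u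
    using that by (induction m) (auto intro: A_Bb)
  have Am_linear: "(A ^^ m) (\<lambda>x. c * (u x - v x)) = (\<lambda>x. c * ((A ^^ m) u x - (A ^^ m) v x))"
    if "u \<in> Bb" "v \<in> Bb" for m c u v
    using that by (induction m) (auto simp: A_linear Am_Bb)
  \<comment> \<open>A acts on the orbit as \<Lambda> times the forward difference in n, so its
    powers are iterated differences.\<close>
  have Am: "(A ^^ m) (s n) x = \<Lambda> ^ m * (\<Sum>k\<le>m. real (m choose k) * (- 1) ^ (m - k) * s (n + k) x)" for m n x
  proof (induction m arbitrary: n x)
    case (Suc m)
    have "(A ^^ Suc m) (s n) x = (A ^^ m) (A (s n)) x" by (simp add: funpow_swap1)
    also have "\<dots> = \<Lambda> * ((A ^^ m) (s (Suc n)) x - (A ^^ m) (s n) x)"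
      unfolding A_s using Am_linear[OF s s, of m \<Lambda> "Suc n" n] by simp
    also have "\<dots> = \<Lambda> ^ Suc m * (\<Sum>k\<le>Suc m. real (Suc m choose k) * (- 1) ^ (Suc m - k) * s (n + k) x)"
      unfolding binomial_difference[where s = "\<lambda>k. s (n + k) x"] Suc by (simp add: right_diff_distrib)
    finally show ?case .
  qed simp
  define \<tau> where "\<tau> = \<Lambda> * t"
  \<comment> \<open>u and w are the terms of the series for exp (t \<Lambda> S) applied to \<phi>
    and for exp (- t \<Lambda>); the terms of exp (t A) are their Cauchy products.\<close>
  define u where "u n = \<tau> ^ n / fact n * s n x" for n
  define w where "w n = (- \<tau>) ^ n / fact n" for n
  have u: "summable (\<lambda>n. norm (u n))"
  proof (rule summable_comparison_test')
    show "summable (\<lambda>n. \<bar>\<tau>\<bar> ^ n / fact n * B)"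
      using summable_exp[of "\<bar>\<tau>\<bar>"] by (intro summable_mult2) (simp add: field_simps)
    fix n
    show "norm (norm (u n)) \<le> \<bar>\<tau>\<bar> ^ n / fact n * B"
      using B[of n x] by (simp add: u_def abs_mult power_abs divide_right_mono mult_left_mono)
  qed
  have w: "summable (\<lambda>n. norm (w n))" "(\<Sum>n. w n) = exp (- \<tau>)"
  proof -
    show "summable (\<lambda>n. norm (w n))"
      using summable_norm_exp[of "- \<tau>"] by (simp add: w_def field_simps power_abs)
    show "(\<Sum>n. w n) = exp (- \<tau>)" by (simp add: w_def exp_def field_simps)
  qed
  have "t ^ m * (A ^^ m) (s 0) x / fact m = (\<Sum>k\<le>m. u k * w (m - k))" for m
  proof -
    have "t ^ m * (A ^^ m) (s 0) x / fact m = (\<Sum>k\<le>m. \<tau> ^ m / fact m * (real (m choose k) * (- 1) ^ (m - k) * s k x))"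
      unfolding Am by (simp add: \<tau>_def power_mult_distrib sum_distrib_left sum_divide_distrib mult_ac)
    also have "\<dots> = (\<Sum>k\<le>m. u k * w (m - k))"
    proof (rule sum.cong)
      fix k assume "k \<in> {..m}"
      then have k: "k \<le> m" by simp
      then have "\<tau> ^ m = \<tau> ^ k * \<tau> ^ (m - k)" by (simp flip: power_add)
      moreover have "real (m choose k) = fact m / (fact k * fact (m - k))" using k by (rule binomial_fact)
      moreover have "(- \<tau>) ^ (m - k) = (- 1) ^ (m - k) * \<tau> ^ (m - k)" by (rule power_minus)
      ultimately show "\<tau> ^ m / fact m * (real (m choose k) * (- 1) ^ (m - k) * s k x) = u k * w (m - k)"
        by (simp add: u_def w_def)
    qed simp
    finally show ?thesis .
  qed
  then have "exp_op t A (s 0) x = (\<Sum>m. \<Sum>k\<le>m. u k * w (m - k))" by (simp add: exp_op_def)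
  also have "\<dots> = (\<Sum>n. u n) * (\<Sum>n. w n)" by (rule Cauchy_product[OF u w(1), symmetric])
  also have "\<dots> = (\<Sum>n. exp (- \<tau>) * u n)"
    using summable_norm_cancel[OF u] by (subst suminf_mult) (auto simp: w(2) mult.commute)
  finally show "exp_op t A (s 0) x = (\<Sum>n. exp (- (\<Lambda> * t)) * (\<Lambda> * t) ^ n / fact n * s n x)"
    by (simp add: u_def \<tau>_def mult.assoc)
  show "summable (\<lambda>n. exp (- (\<Lambda> * t)) * (\<Lambda> * t) ^ n / fact n * s n x)"
    using summable_mult[OF summable_norm_cancel[OF u], of "exp (- \<tau>)"] by (simp add: u_def \<tau>_def mult.assoc)
qed

text \<open>L is a parameter so that it can be fixed from \<alpha>, M, a and the dimension before f
  and \<epsilon> are known. The tail bound is assumed at every radius because the chain needs it at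
  all r \<ge> \<epsilon>.\<close>

locale stable_kernel =
  fixes f :: "real ^ 'n \<Rightarrow> real ^ 'n \<Rightarrow> ennreal" and \<alpha> M a \<epsilon> L :: real
  assumes alpha: "0 < \<alpha>" "\<alpha> < 2" and M: "0 < M" and a: "0 < a" and eps: "0 < \<epsilon>"
    and f_measurable: "(\<lambda>(x, y). f x y) \<in> borel_measurable borel"
    and f_le: "\<And>x y. y \<noteq> x \<Longrightarrow> f x y \<le> ennreal (M * norm (y - x) powr (- \<alpha> - real CARD('n)))"
    and f_balance: "(\<forall>x h. f x (x + h) = f x (x - h)) \<or> \<alpha> < 1"
    and f_sym: "\<And>x y. f x y = f y x"
    and f_tail: "\<And>r x. 0 < r \<Longrightarrow> ennreal (a * r powr (- \<alpha>)) \<le> b_eps f r x"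
    and L: "2 * a \<le> L"
    and f_eps_mass: "\<And>x. (\<integral>\<^sup>+y. f_eps f \<epsilon> x y \<partial>lborel) \<le> ennreal (L * \<epsilon> powr (- \<alpha>))"
begin

definition "rate = L * \<epsilon> powr (- \<alpha>)"
definition "jmp x y = f_eps f \<epsilon> x y * ennreal (1 / rate)"
text \<open>The subtraction in \<open>ennreal\<close> does not truncate, by
  \<open>nn_integral_jmp_le\<close> below.\<close>

definition "stay x = 1 - (\<integral>\<^sup>+y. jmp x y \<partial>lborel)"

lemma L_pos: "0 < L" using L a by linarith

lemma rate_pos: "0 < rate" using L_pos eps by (simp add: rate_def)

lemma f_measurable' [measurable]: "(\<lambda>(x, y). f x y) \<in> borel_measurable (borel \<Otimes>\<^sub>M borel)"
  using f_measurable by (simp add: borel_prod)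

lemma f_eps_measurable [measurable]: "(\<lambda>(x, y). f_eps f \<epsilon> x y) \<in> borel_measurable (borel \<Otimes>\<^sub>M borel)"
  unfolding f_eps_def by measurable

lemma f_eps_measurable1 [measurable]: "f_eps f \<epsilon> x \<in> borel_measurable borel"
  using measurable_compose[OF measurable_Pair1' f_eps_measurable, of x] by simp

lemma jmp_measurable [measurable]: "(\<lambda>(x, y). jmp x y) \<in> borel_measurable (borel \<Otimes>\<^sub>M borel)"
  unfolding jmp_def by measurable

lemma nn_integral_jmp: "(\<integral>\<^sup>+y. jmp x y \<partial>lborel) = (\<integral>\<^sup>+y. f_eps f \<epsilon> x y \<partial>lborel) * ennreal (1 / rate)"
  unfolding jmp_def by (rule nn_integral_multc) simp

lemma nn_integral_jmp_le: "(\<integral>\<^sup>+y. jmp x y \<partial>lborel) \<le> 1"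
proof -
  have "(\<integral>\<^sup>+y. jmp x y \<partial>lborel) \<le> ennreal rate * ennreal (1 / rate)"
    unfolding nn_integral_jmp rate_def by (intro mult_right_mono f_eps_mass) auto
  also have "\<dots> = 1" using rate_pos by (simp flip: ennreal_mult)
  finally show ?thesis .
qed

text \<open>Division by the rate converts the bounds on f into bounds relative to \<epsilon>. The
  inequality 2 * a \<le> L gives the lower constant a / L its required bound 1 / 2.\<close>

lemma stable_jump: "stable_jump stay jmp \<alpha> (M / L) (a / L) \<epsilon>"
proof
  show "stay \<in> borel_measurable borel" unfolding stay_def by measurable
  show "(\<lambda>(x, y). jmp x y) \<in> borel_measurable (borel \<Otimes>\<^sub>M borel)" by measurable
  show "jmp x y = jmp y x" for x y by (simp add: jmp_def f_eps_def f_sym[of x y] norm_minus_commute)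
  show mass: "stay x + (\<integral>\<^sup>+y. jmp x y \<partial>lborel) = 1" for x
    unfolding stay_def using nn_integral_jmp_le by (rule diff_add_cancel_ennreal)
  then show "stay x + (\<integral>\<^sup>+y. jmp x y \<partial>lborel) \<le> 1" for x by simp
  show "0 < \<alpha>" "\<alpha> < 2" "0 < M / L" "0 < a / L" "a / L \<le> 1 / 2" "0 < \<epsilon>"
    using alpha M a L L_pos eps by (auto simp: field_simps)
  show "jmp x y = 0" if "norm (y - x) < \<epsilon>" for x y using that by (simp add: jmp_def f_eps_def)
  show "jmp x y \<le> ennreal (M / L * \<epsilon> powr \<alpha> * norm (y - x) powr (- \<alpha> - real CARD('n)))"
    if "\<epsilon> \<le> norm (y - x)" for x y
  proof -
    have "y \<noteq> x" using that eps by auto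
    then have "jmp x y \<le> ennreal (M * norm (y - x) powr (- \<alpha> - real CARD('n))) * ennreal (1 / rate)"
      using that f_le[of y x] unfolding jmp_def f_eps_def by (auto intro: mult_right_mono)
    also have "\<dots> = ennreal (M / L * \<epsilon> powr \<alpha> * norm (y - x) powr (- \<alpha> - real CARD('n)))"
      using M rate_pos L_pos by (subst ennreal_mult[symmetric]) (auto simp: rate_def powr_minus field_simps)
    finally show ?thesis .
  qed
  show "ennreal (a / L * (\<epsilon> / r) powr \<alpha>) \<le> (\<integral>\<^sup>+y\<in>{y. r < norm (y - x)}. jmp x y \<partial>lborel)"
    if r: "\<epsilon> \<le> r" for x r
  proof -
    have "a / L * (\<epsilon> / r) powr \<alpha> = a * r powr (- \<alpha>) * (1 / rate)"
      using r eps by (simp add: rate_def powr_divide powr_minus field_simps)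
    then have "ennreal (a / L * (\<epsilon> / r) powr \<alpha>) = ennreal (a * r powr (- \<alpha>)) * ennreal (1 / rate)"
      using a rate_pos by (subst ennreal_mult[symmetric]) auto
    also have "\<dots> \<le> b_eps f r x * ennreal (1 / rate)"
      using r eps by (intro mult_right_mono f_tail) auto
    also have "\<dots> = (\<integral>\<^sup>+y. f x y * indicator {y. r < norm (y - x)} y * ennreal (1 / rate) \<partial>lborel)"
    proof -
      have [measurable]: "f x \<in> borel_measurable borel"
        using measurable_compose[OF measurable_Pair1' f_measurable', of x] by simp
      show ?thesis unfolding b_eps_def by (rule nn_integral_multc[symmetric]) measurable
    qed
    also have "\<dots> = (\<integral>\<^sup>+y\<in>{y. r < norm (y - x)}. jmp x y \<partial>lborel)"
      using r by (intro nn_integral_cong) (auto simp: jmp_def f_eps_def indicator_def)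
    finally show ?thesis .
  qed
  show "(\<forall>x h. jmp x (x + h) = jmp x (x - h)) \<or> \<alpha> < 1"
    using f_balance by (auto simp: jmp_def f_eps_def)
qed

text \<open>The truncated kernel includes the sphere of radius \<epsilon>, whereas
  \<open>b_eps\<close> integrates over its open exterior. Hence \<open>b_eps\<close> is at most this
  rate, the direction that the exponential term needs.\<close>

definition "total_rate x = enn2real (\<integral>\<^sup>+y. f_eps f \<epsilon> x y \<partial>lborel)"

lemma ennreal_total_rate: "ennreal (total_rate x) = (\<integral>\<^sup>+y. f_eps f \<epsilon> x y \<partial>lborel)"
  using f_eps_mass[of x] unfolding total_rate_def by (intro ennreal_enn2real) (auto intro: le_less_trans)

lemma total_rate_bounds: "0 \<le> total_rate x" "total_rate x \<le> rate"
proof -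
  show "0 \<le> total_rate x" by (simp add: total_rate_def)
  show "total_rate x \<le> rate"
    using f_eps_mass[of x] rate_pos unfolding rate_def[symmetric] ennreal_total_rate[symmetric] by simp
qed

lemma stay_eq: "stay x = ennreal (1 - total_rate x / rate)"
proof -
  have "(\<integral>\<^sup>+y. jmp x y \<partial>lborel) = ennreal (total_rate x / rate)"
    unfolding nn_integral_jmp ennreal_total_rate[symmetric] using total_rate_bounds rate_pos by (simp flip: ennreal_mult)
  then show ?thesis unfolding stay_def using total_rate_bounds[of x] rate_pos by (simp add: ennreal_minus flip: ennreal_1)
qed

lemma f_eps_finite: "f_eps f \<epsilon> x y < top"
proof (cases "\<epsilon> \<le> norm (y - x)")
  case True
  then have "y \<noteq> x" using eps by auto
  then show ?thesis using f_le[of y x] True by (auto simp: f_eps_def intro: le_less_trans)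
qed (simp add: f_eps_def)

text \<open>The staying probability adjusts for the multiple of \<psi> x that A subtracts.
  Nonnegativity is recorded separately because \<open>ennreal\<close> sends negative reals to 0, so
  the second equation alone could not be read back in the reals.\<close>

lemma jump_op_A_eps:
  assumes psi: "\<psi> \<in> Bb" "\<And>y. 0 \<le> \<psi> y"
  shows "0 \<le> \<psi> x + A_eps f \<epsilon> \<psi> x / rate"
    and "jump_op stay jmp (\<lambda>y. ennreal (\<psi> y)) x = ennreal (\<psi> x + A_eps f \<epsilon> \<psi> x / rate)"
proof -
  obtain B where B: "\<And>y. \<bar>\<psi> y\<bar> \<le> B" using psi by (auto simp: Bb_def bounded_iff)
  have [measurable]: "\<psi> \<in> borel_measurable borel" using psi by (simp add: Bb_def)
  define k where "k y = enn2real (f_eps f \<epsilon> x y)" for y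
  have k: "k y \<ge> 0" "f_eps f \<epsilon> x y = ennreal (k y)" for y using f_eps_finite by (auto simp: k_def)
  have [measurable]: "k \<in> borel_measurable borel" unfolding k_def by measurable
  have "(\<integral>\<^sup>+y. ennreal (k y) \<partial>lborel) = ennreal (total_rate x)" unfolding ennreal_total_rate k(2) ..
  then have ik: "integrable lborel k" and total_rate_k: "total_rate x = (\<integral>y. k y \<partial>lborel)"
    using k total_rate_bounds(1)[of x] by (auto intro!: integrableI_nonneg simp: integral_eq_nn_integral)
  have ikp: "integrable lborel (\<lambda>y. k y * \<psi> y)"
  proof (rule Bochner_Integration.integrable_bound)
    show "integrable lborel (\<lambda>y. k y * B)" using ik by simp
    have "norm (k y * \<psi> y) \<le> norm (k y * B)" for y
      using B[of y] by (simp add: abs_mult mult_left_mono)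
    then show "AE y in lborel. norm (k y * \<psi> y) \<le> norm (k y * B)" by simp
  qed measurable
  define I where "I = (\<integral>y. k y * \<psi> y \<partial>lborel)"
  have I0: "I \<ge> 0" unfolding I_def using k psi by (intro integral_nonneg_AE) auto
  have A: "A_eps f \<epsilon> \<psi> x = I - total_rate x * \<psi> x"
  proof -
    have "A_eps f \<epsilon> \<psi> x = (\<integral>y. k y * \<psi> y - k y * \<psi> x \<partial>lborel)"
      unfolding A_eps_def k_def by (simp add: algebra_simps)
    also have "\<dots> = I - (\<integral>y. k y \<partial>lborel) * \<psi> x"
      using ik ikp by (subst Bochner_Integration.integral_diff) (auto simp: I_def)
    finally show ?thesis by (simp add: total_rate_k)
  qed
  have "(\<integral>\<^sup>+y. jmp x y * ennreal (\<psi> y) \<partial>lborel) = (\<integral>\<^sup>+y. ennreal (1 / rate) * ennreal (k y * \<psi> y) \<partial>lborel)"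
    unfolding jmp_def k(2) using k psi by (intro nn_integral_cong) (simp add: ennreal_mult mult_ac)
  also have "\<dots> = ennreal (1 / rate) * (\<integral>\<^sup>+y. ennreal (k y * \<psi> y) \<partial>lborel)" by (rule nn_integral_cmult) measurable
  also have "\<dots> = ennreal (1 / rate) * ennreal I"
    unfolding I_def using k psi by (subst nn_integral_eq_integral[OF ikp]) auto
  finally have "jump_op stay jmp (\<lambda>y. ennreal (\<psi> y)) x = ennreal (1 - total_rate x / rate) * ennreal (\<psi> x) + ennreal (1 / rate) * ennreal I"
    by (simp add: jump_op_def stay_eq)
  also have "\<dots> = ennreal ((1 - total_rate x / rate) * \<psi> x + 1 / rate * I)"
    using total_rate_bounds[of x] rate_pos psi(2)[of x] I0 by (subst ennreal_plus) (auto simp flip: ennreal_mult)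
  also have eq: "(1 - total_rate x / rate) * \<psi> x + 1 / rate * I = \<psi> x + A_eps f \<epsilon> \<psi> x / rate"
    unfolding A using rate_pos by (simp add: field_simps)
  finally show "jump_op stay jmp (\<lambda>y. ennreal (\<psi> y)) x = ennreal (\<psi> x + A_eps f \<epsilon> \<psi> x / rate)" .
  show "0 \<le> \<psi> x + A_eps f \<epsilon> \<psi> x / rate"
    unfolding eq[symmetric] using total_rate_bounds[of x] rate_pos psi(2)[of x] I0 by simp
qed

lemma A_eps_linear:
  assumes "u \<in> Bb" "v \<in> Bb"
  shows "A_eps f \<epsilon> (\<lambda>x. c * (u x - v x)) = (\<lambda>x. c * (A_eps f \<epsilon> u x - A_eps f \<epsilon> v x))"
proof
  fix x
  obtain K where "\<And>\<phi> x. \<phi> \<in> Bb \<Longrightarrow> integrable lborel (\<lambda>y. (\<phi> y - \<phi> x) * enn2real (f_eps f \<epsilon> x y))"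
    by (rule A_eps_bounded[of f \<alpha> M \<epsilon>]) (use f_measurable alpha M f_le eps in auto)
  note int = this[OF assms(1), of x] this[OF assms(2), of x]
  have "A_eps f \<epsilon> (\<lambda>x. c * (u x - v x)) x
      = (\<integral>y. c * ((u y - u x) * enn2real (f_eps f \<epsilon> x y) - (v y - v x) * enn2real (f_eps f \<epsilon> x y)) \<partial>lborel)"
    unfolding A_eps_def by (intro Bochner_Integration.integral_cong) (auto simp: algebra_simps)
  then show "A_eps f \<epsilon> (\<lambda>x. c * (u x - v x)) x = c * (A_eps f \<epsilon> u x - A_eps f \<epsilon> v x)"
    using int by (simp add: A_eps_def)
qed

lemma A_eps_Bb:
  assumes "u \<in> Bb"
  shows "A_eps f \<epsilon> u \<in> Bb"
proof -
  obtain K where "\<And>\<phi>. \<phi> \<in> Bb \<Longrightarrow> A_eps f \<epsilon> \<phi> \<in> Bb"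
    by (rule A_eps_bounded[of f \<alpha> M \<epsilon>]) (use f_measurable alpha M f_le eps in auto)
  with assms show ?thesis by blast
qed

lemma exp_op_A_eps:
  assumes phi: "\<phi> \<in> Bb" "\<And>y. 0 \<le> \<phi> y" and t: "t > 0"
  shows "ennreal (exp_op t (A_eps f \<epsilon>) \<phi> x) = (\<Sum>n. ennreal (exp (- (rate * t)) * (rate * t) ^ n / fact n) *
    (jump_op stay jmp ^^ n) (\<lambda>y. ennreal (\<phi> y)) x)"
proof -
  interpret stable_jump stay jmp \<alpha> "M / L" "a / L" \<epsilon> by (rule stable_jump)
  let ?p = "\<lambda>y. ennreal (\<phi> y)"
  obtain B where "\<And>y. \<bar>\<phi> y\<bar> \<le> B" using phi by (auto simp: Bb_def bounded_iff)
  then have B: "\<phi> y \<le> B" for y using abs_le_D1 by blast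
  then have B0: "B \<ge> 0" using order.trans[OF phi(2)[of 0]] by simp
  have [measurable]: "\<phi> \<in> borel_measurable borel" using phi by (simp add: Bb_def)
  define s where "s n x = enn2real ((T ^^ n) ?p x)" for n x
  have T_le: "(T ^^ n) ?p x \<le> ennreal B" for n x by (rule Tn_le_const) (rule ennreal_leI[OF B])
  have s: "0 \<le> s n x" "ennreal (s n x) = (T ^^ n) ?p x" "s n x \<le> B" for n x
  proof -
    show e: "ennreal (s n x) = (T ^^ n) ?p x"
      unfolding s_def by (rule ennreal_enn2real) (rule le_less_trans[OF T_le ennreal_less_top])
    show "0 \<le> s n x" by (simp add: s_def)
    show "s n x \<le> B" using T_le[of n x] B0 unfolding e[symmetric] by simp
  qed
  have s_Bb: "s n \<in> Bb" for n
  proof -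
    have "(T ^^ n) ?p \<in> borel_measurable borel" by measurable
    then have "s n \<in> borel_measurable borel" unfolding s_def by measurable
    moreover have "bounded (range (s n))"
      using s(1,3) by (auto simp: bounded_iff intro!: exI[of _ B])
    ultimately show ?thesis by (simp add: Bb_def)
  qed
  have A_s: "A_eps f \<epsilon> (s n) = (\<lambda>x. rate * (s (Suc n) x - s n x))" for n
  proof
    fix x
    have "ennreal (s (Suc n) x) = T (\<lambda>y. ennreal (s n y)) x" by (simp add: s(2))
    also have "\<dots> = ennreal (s n x + A_eps f \<epsilon> (s n) x / rate)"
      by (rule jump_op_A_eps(2)[OF s_Bb s(1)])
    finally have e: "ennreal (s (Suc n) x) = ennreal (s n x + A_eps f \<epsilon> (s n) x / rate)" .
    then have "s (Suc n) x = s n x + A_eps f \<epsilon> (s n) x / rate"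
      using jump_op_A_eps(1)[OF s_Bb s(1), of n x] s(1)[of "Suc n" x] by simp
    then show "A_eps f \<epsilon> (s n) x = rate * (s (Suc n) x - s n x)" using rate_pos by (simp add: field_simps)
  qed
  have s0: "s 0 = \<phi>" using phi by (simp add: s_def fun_eq_iff)
  have sb: "\<bar>s n x\<bar> \<le> B" for n x using s(1,3)[of n x] by simp
  have pn: "0 \<le> exp (- (rate * t)) * (rate * t) ^ n / fact n" for n using rate_pos t by simp
  have E: "summable (\<lambda>n. exp (- (rate * t)) * (rate * t) ^ n / fact n * s n x)"
    "exp_op t (A_eps f \<epsilon>) \<phi> x = (\<Sum>n. exp (- (rate * t)) * (rate * t) ^ n / fact n * s n x)"
    unfolding s0[symmetric]
    by (rule exp_op_poisson[of s B "A_eps f \<epsilon>" rate]; fact s_Bb sb A_eps_Bb A_eps_linear A_s)+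
  have "ennreal (exp_op t (A_eps f \<epsilon>) \<phi> x) = (\<Sum>n. ennreal (exp (- (rate * t)) * (rate * t) ^ n / fact n * s n x))"
    unfolding E(2) by (rule suminf_ennreal2[symmetric]) (intro mult_nonneg_nonneg pn s(1) E(1))+
  also have "\<dots> = (\<Sum>n. ennreal (exp (- (rate * t)) * (rate * t) ^ n / fact n) * (T ^^ n) ?p x)"
    unfolding s(2)[symmetric] using pn s(1) by (intro suminf_cong ennreal_mult) auto
  finally show ?thesis .
qed

end

text \<open>Each member of the minimum is averaged on its own. With mean \<tau> = L \<epsilon> powr
  (- \<alpha>) t, the negative moment turns \<open>\<epsilon> powr (- d)\<close> into a multiple of
  \<open>t powr (- d / \<alpha>)\<close>, and the first moment turns
  \<open>\<epsilon> powr \<alpha>\<close> into L t: \<epsilon> disappears from both.\<close>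

lemma poisson_kernel_bound:
  fixes \<alpha> L d :: real
  assumes "0 < \<alpha>" "0 < L" "0 < d"
  obtains C where "C > 0" "\<And>\<epsilon> t (w :: real). 0 < \<epsilon> \<Longrightarrow> 0 < t \<Longrightarrow> 0 \<le> w \<Longrightarrow>
    (\<Sum>n. ennreal (exp (- (L * \<epsilon> powr (- \<alpha>) * t)) * (L * \<epsilon> powr (- \<alpha>) * t) ^ n / fact n) *
      ennreal (min (\<epsilon> powr (- d) * real n powr (- (d / \<alpha>))) (real n * \<epsilon> powr \<alpha> * w)))
    \<le> ennreal (C * min (t powr (- d / \<alpha>)) (t * w))"
proof -
  define \<beta> where "\<beta> = d / \<alpha>"
  have b: "\<beta> > 0" "\<alpha> * \<beta> = d" using assms by (auto simp: \<beta>_def)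
  obtain Cp where Cp: "Cp > 0" "\<And>s. s > 0 \<Longrightarrow> summable (\<lambda>n. exp (- s) * s ^ n / fact n * real n powr (- \<beta>))"
    "\<And>s. s > 0 \<Longrightarrow> (\<Sum>n. exp (- s) * s ^ n / fact n * real n powr (- \<beta>)) \<le> Cp * s powr (- \<beta>)"
    by (rule poisson_negative_moment[OF b(1)]) blast
  define C where "C = Cp * L powr (- \<beta>) + L"
  have C: "C > 0" "Cp * L powr (- \<beta>) \<le> C" "L \<le> C" using Cp assms by (auto simp: C_def add_pos_pos)
  show thesis
  proof (rule that[of C])
    fix \<epsilon> t w :: real assume eps: "0 < \<epsilon>" and t: "0 < t" and w: "0 \<le> w"
    define \<tau> where "\<tau> = L * \<epsilon> powr (- \<alpha>) * t"
    have tau: "\<tau> > 0" using assms eps t by (simp add: \<tau>_def)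
    define p where "p n = exp (- \<tau>) * \<tau> ^ n / fact n" for n
    have p: "p n \<ge> 0" for n using tau by (simp add: p_def)
    define u where "u n = \<epsilon> powr (- d) * real n powr (- \<beta>)" for n :: nat
    define v where "v n = real n * \<epsilon> powr \<alpha> * w" for n :: nat
    have uv: "u n \<ge> 0" "v n \<ge> 0" for n using w by (auto simp: u_def v_def)
    let ?S = "\<Sum>n. ennreal (p n) * ennreal (min (u n) (v n))"
    have "?S \<le> (\<Sum>n. ennreal (\<epsilon> powr (- d) * (p n * real n powr (- \<beta>))))"
    proof (intro suminf_le summableI)
      fix n
      have "p n * min (u n) (v n) \<le> p n * u n" using p by (intro mult_left_mono) auto
      also have "\<dots> = \<epsilon> powr (- d) * (p n * real n powr (- \<beta>))" by (simp add: u_def mult_ac)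
      finally show "ennreal (p n) * ennreal (min (u n) (v n)) \<le> ennreal (\<epsilon> powr (- d) * (p n * real n powr (- \<beta>)))"
        using p uv by (simp add: ennreal_leI flip: ennreal_mult)
    qed
    also have "\<dots> = ennreal (\<epsilon> powr (- d) * (\<Sum>n. p n * real n powr (- \<beta>)))"
      using p Cp(2)[OF tau] unfolding p_def[symmetric]
      by (subst suminf_ennreal2) (auto intro: summable_mult simp: suminf_mult)
    also have "\<dots> \<le> ennreal (\<epsilon> powr (- d) * (Cp * \<tau> powr (- \<beta>)))"
      using Cp(3)[OF tau] by (intro ennreal_leI mult_left_mono) (auto simp: p_def)
    also have "\<epsilon> powr (- d) * (Cp * \<tau> powr (- \<beta>)) = Cp * L powr (- \<beta>) * t powr (- \<beta>)"
    proof -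
      have "(\<epsilon> powr (- \<alpha>)) powr (- \<beta>) = \<epsilon> powr d" using b by (simp add: powr_powr)
      moreover have "\<epsilon> powr (- d) * \<epsilon> powr d = 1" using eps by (simp flip: powr_add)
      ultimately show ?thesis unfolding \<tau>_def powr_mult by (simp add: mult_ac)
    qed
    also have "\<dots> \<le> C * t powr (- \<beta>)" using C by (intro mult_right_mono) auto
    finally have S1: "?S \<le> ennreal (C * t powr (- \<beta>))" by (simp add: ennreal_leI)
    have "?S \<le> (\<Sum>n. ennreal (p n * real n * (\<epsilon> powr \<alpha> * w)))"
    proof (intro suminf_le summableI)
      fix n
      have "p n * min (u n) (v n) \<le> p n * v n" using p by (intro mult_left_mono) auto
      then show "ennreal (p n) * ennreal (min (u n) (v n)) \<le> ennreal (p n * real n * (\<epsilon> powr \<alpha> * w))"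
        using p uv by (simp add: v_def ennreal_leI mult.assoc flip: ennreal_mult)
    qed
    also have "\<dots> = ennreal (\<tau> * (\<epsilon> powr \<alpha> * w))"
    proof -
      have S: "(\<lambda>n. p n * real n * (\<epsilon> powr \<alpha> * w)) sums (\<tau> * (\<epsilon> powr \<alpha> * w))"
        unfolding p_def by (intro sums_mult2 poisson_mean)
      then show ?thesis using p w by (subst suminf_ennreal2) (auto simp: sums_iff)
    qed
    also have "\<tau> * (\<epsilon> powr \<alpha> * w) = L * (t * w)"
      using eps by (simp add: \<tau>_def powr_minus field_simps)
    also have "ennreal (L * (t * w)) \<le> ennreal (C * (t * w))"
      using C t w by (intro ennreal_leI mult_right_mono) auto
    finally have S2: "?S \<le> ennreal (C * (t * w))" .
    have "?S \<le> ennreal (C * min (t powr (- \<beta>)) (t * w))" using S1 S2 by (simp add: min_def)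
    then show "(\<Sum>n. ennreal (exp (- (L * \<epsilon> powr (- \<alpha>) * t)) * (L * \<epsilon> powr (- \<alpha>) * t) ^ n / fact n) *
      ennreal (min (\<epsilon> powr (- d) * real n powr (- (d / \<alpha>))) (real n * \<epsilon> powr \<alpha> * w)))
      \<le> ennreal (C * min (t powr (- d / \<alpha>)) (t * w))"
      by (simp add: p_def u_def v_def \<tau>_def \<beta>_def)
  qed (fact C)
qed

section \<open>Poisson averaging of the chain bound\<close>

theorem theorem1:
  fixes \<alpha> M a :: real
  assumes "0 < \<alpha>" and "\<alpha> < 2" and "0 < M" and "0 < a"
  shows "\<exists>C :: real. \<forall>f :: real ^ 'n \<Rightarrow> real ^ 'n \<Rightarrow> ennreal.
    (\<lambda>(x, y). f x y) \<in> borel_measurable borel \<longrightarrow>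
    (\<forall>x y. y \<noteq> x \<longrightarrow> f x y \<le> ennreal (M * norm (y - x) powr (- \<alpha> - real CARD('n)))) \<longrightarrow>
    ((\<forall>x h. f x (x + h) = f x (x - h)) \<or> \<alpha> < 1) \<longrightarrow>
    (\<forall>x y. f x y = f y x) \<longrightarrow>
    (\<forall>\<epsilon>>0. (INF x. b_eps f \<epsilon> x) \<ge> ennreal (a * \<epsilon> powr (- \<alpha>))) \<longrightarrow>
    (\<forall>\<phi>\<in>Bb. (\<forall>y. 0 \<le> \<phi> y) \<longrightarrow> (\<forall>\<epsilon>>0. \<forall>t>0. \<forall>x.
      exp_op t (A_eps f \<epsilon>) \<phi> x
        \<le> C * (\<integral>y. \<phi> y * min (t powr (- real CARD('n) / \<alpha>))
                              (t / norm (y - x) powr (\<alpha> + real CARD('n))) \<partial>lborel)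
          + exp (- t * enn2real (b_eps f \<epsilon> x)) * \<phi> x))"
proof -
  define d where "d = real CARD('n)"
  have d: "d > 0" by (simp add: d_def)
  obtain K where K: "K > 0"
    "\<And>r. r > 0 \<Longrightarrow> (\<integral>\<^sup>+z\<in>{z :: real ^ 'n. r \<le> norm z}. ennreal (norm z powr (- \<alpha> - d)) \<partial>lborel)
      \<le> ennreal (K * r powr (- \<alpha>))"
    unfolding d_def using tail_powr_integral[OF assms(1)] by blast
  \<comment> \<open>M * K dominates the mass of the truncated kernel; 2 * a brings a / L below 1 /
    2.\<close>
  define L where "L = M * K + 2 * a"
  have L: "0 < L" "2 * a \<le> L" "M * K \<le> L" using assms K by (auto simp: L_def intro: add_pos_pos)
  have mL: "0 < M / L" "0 < a / L" "a / L \<le> 1 / 2" using assms L by (auto simp: field_simps)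
  obtain C1 where C1: "C1 > 0" "\<And>(D :: real ^ 'n \<Rightarrow> ennreal) j \<epsilon> \<phi> n x. stable_jump D j \<alpha> (M / L) (a / L) \<epsilon> \<Longrightarrow>
    \<phi> \<in> borel_measurable borel \<Longrightarrow>
    (jump_op D j ^^ n) \<phi> x \<le> D x ^ n * \<phi> x + ennreal C1 * (\<integral>\<^sup>+y. \<phi> y *
      ennreal (min (\<epsilon> powr (- d) * real n powr (- (d / \<alpha>)))
        (real n * \<epsilon> powr \<alpha> * norm (y - x) powr (- \<alpha> - d))) \<partial>lborel)"
    unfolding d_def by (rule chain_bound[OF assms(1,2) mL]) blast
  obtain C2 where C2: "C2 > 0" "\<And>\<epsilon> t (w :: real). 0 < \<epsilon> \<Longrightarrow> 0 < t \<Longrightarrow> 0 \<le> w \<Longrightarrow>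
    (\<Sum>n. ennreal (exp (- (L * \<epsilon> powr (- \<alpha>) * t)) * (L * \<epsilon> powr (- \<alpha>) * t) ^ n / fact n) *
      ennreal (min (\<epsilon> powr (- d) * real n powr (- (d / \<alpha>))) (real n * \<epsilon> powr \<alpha> * w)))
    \<le> ennreal (C2 * min (t powr (- d / \<alpha>)) (t * w))"
    by (rule poisson_kernel_bound[OF assms(1) L(1) d]) blast
  show ?thesis
  proof (intro exI[of _ "C1 * C2"] allI impI ballI)
    fix f :: "real ^ 'n \<Rightarrow> real ^ 'n \<Rightarrow> ennreal" and \<phi> :: "real ^ 'n \<Rightarrow> real" and \<epsilon> t :: real and x
    assume meas: "(\<lambda>(x, y). f x y) \<in> borel_measurable borel"
      and ub: "\<forall>x y. y \<noteq> x \<longrightarrow> f x y \<le> ennreal (M * norm (y - x) powr (- \<alpha> - real CARD('n)))"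
      and bal: "(\<forall>x h. f x (x + h) = f x (x - h)) \<or> \<alpha> < 1"
      and sym: "\<forall>x y. f x y = f y x"
      and tail: "\<forall>\<epsilon>>0. (INF x. b_eps f \<epsilon> x) \<ge> ennreal (a * \<epsilon> powr (- \<alpha>))"
      and phi: "\<phi> \<in> Bb" "\<forall>y. 0 \<le> \<phi> y" and eps: "0 < \<epsilon>" and t: "0 < t"
    have [measurable]: "\<phi> \<in> borel_measurable borel" using phi by (simp add: Bb_def)
    interpret stable_kernel f \<alpha> M a \<epsilon> L
    proof
      show "ennreal (a * r powr (- \<alpha>)) \<le> b_eps f r x" if "0 < r" for r x
        using tail that by (auto simp: le_INF_iff)
      show "(\<integral>\<^sup>+y. f_eps f \<epsilon> x y \<partial>lborel) \<le> ennreal (L * \<epsilon> powr (- \<alpha>))" for x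
      proof -
        let ?g = "\<lambda>z :: real ^ 'n. ennreal (norm z powr (- \<alpha> - d)) * indicator {z. \<epsilon> \<le> norm z} z"
        have "f_eps f \<epsilon> x y \<le> ennreal M * ?g (y - x)" for y
        proof (cases "\<epsilon> \<le> norm (y - x)")
          case True
          then have "y \<noteq> x" using eps by auto
          then show ?thesis using ub[rule_format, of y x] True assms(3) by (simp add: f_eps_def d_def ennreal_mult)
        qed (simp add: f_eps_def)
        then have "(\<integral>\<^sup>+y. f_eps f \<epsilon> x y \<partial>lborel) \<le> (\<integral>\<^sup>+y. ennreal M * ?g (y - x) \<partial>lborel)"
          by (rule nn_integral_mono)
        also have "\<dots> = ennreal M * (\<integral>\<^sup>+y. ?g (y - x) \<partial>lborel)" by (rule nn_integral_cmult) measurable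
        also have "(\<integral>\<^sup>+y. ?g (y - x) \<partial>lborel) = (\<integral>\<^sup>+z. ?g z \<partial>lborel)"
          by (subst nn_integral_lborel_shift[of _ x, symmetric]) auto
        also have "ennreal M * \<dots> \<le> ennreal M * ennreal (K * \<epsilon> powr (- \<alpha>))"
          by (intro mult_left_mono K eps) simp
        also have "\<dots> = ennreal (M * K * \<epsilon> powr (- \<alpha>))"
          using assms K by (simp add: ennreal_mult mult.assoc)
        also have "\<dots> \<le> ennreal (L * \<epsilon> powr (- \<alpha>))"
          using L by (intro ennreal_leI mult_right_mono) auto
        finally show ?thesis .
      qed
    qed (use assms eps meas ub bal sym L in auto)
    define p where "p n = exp (- (rate * t)) * (rate * t) ^ n / fact n" for n
    have p0: "0 \<le> p n" for n using rate_pos t by (simp add: p_def)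
    define g where "g n y = min (\<epsilon> powr (- d) * real n powr (- (d / \<alpha>))) (real n * \<epsilon> powr \<alpha> * norm (y - x) powr (- \<alpha> - d))" for n :: nat and y :: "real ^ 'n"
    have [measurable]: "g n \<in> borel_measurable borel" for n unfolding g_def by measurable
    define h where "h y = min (t powr (- d / \<alpha>)) (t * norm (y - x) powr (- \<alpha> - d))" for y :: "real ^ 'n"
    have h0: "0 \<le> h y" for y using t by (simp add: h_def)
    \<comment> \<open>The two forms agree also at y = x, where both vanish by the conventions for
      \<open>0 powr _\<close> and division by 0.\<close>
    have h_eq: "h y = min (t powr (- real CARD('n) / \<alpha>)) (t / norm (y - x) powr (\<alpha> + real CARD('n)))" for y
    proof -
      have "norm (y - x) powr (- \<alpha> - d) = 1 / norm (y - x) powr (\<alpha> + d)"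
        using powr_minus_divide[of "norm (y - x)" "\<alpha> + d"] by simp
      then show ?thesis by (simp add: h_def d_def)
    qed
    define I where "I = (\<integral>y. \<phi> y * h y \<partial>lborel)"
    have I0: "0 \<le> I" unfolding I_def using phi h0 by (intro integral_nonneg_AE) auto
    have I: "(\<integral>\<^sup>+y. ennreal (\<phi> y * h y) \<partial>lborel) = ennreal I"
    proof -
      have "integrable lborel (\<lambda>y. \<phi> y * h y)"
        unfolding h_eq by (rule integrable_stable_kernel[OF assms(1) t phi(1)])
      then show ?thesis unfolding I_def using phi h0 by (intro nn_integral_eq_integral) auto
    qed
    \<comment> \<open>The Poisson generating function: the mean of \<delta> ^ n is exp (- rate * t *
      (1 - \<delta>)), and rate * (1 - \<delta>) is the total rate at x.\<close>
    have D_sum: "(\<Sum>n. ennreal (p n) * (stay x ^ n * ennreal (\<phi> x))) \<le> ennreal (exp (- t * enn2real (b_eps f \<epsilon> x)) * \<phi> x)"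
    proof -
      define \<delta> where "\<delta> = 1 - total_rate x / rate"
      have \<delta>: "0 \<le> \<delta>" using total_rate_bounds[of x] rate_pos by (simp add: \<delta>_def)
      have e1: "(\<lambda>n. exp (- (rate * t)) * (exp (rate * t * \<delta>) * (exp (- (rate * t * \<delta>)) * (rate * t * \<delta>) ^ n / fact n) * \<phi> x)) sums
        (exp (- (rate * t)) * (exp (rate * t * \<delta>) * 1 * \<phi> x))"
        by (intro sums_mult sums_mult2 poisson_sums)
      have e2: "exp (- (rate * t)) * (exp (rate * t * \<delta>) * (exp (- (rate * t * \<delta>)) * (rate * t * \<delta>) ^ n / fact n) * \<phi> x) = p n * (\<delta> ^ n * \<phi> x)" for n
        by (simp add: p_def power_mult_distrib exp_minus field_simps)
      have e3: "exp (- (rate * t)) * (exp (rate * t * \<delta>) * 1 * \<phi> x) = exp (- t * total_rate x) * \<phi> x"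
      proof -
        have "- (rate * t) + rate * t * \<delta> = - t * total_rate x" using rate_pos by (simp add: \<delta>_def field_simps)
        then have "exp (- (rate * t)) * exp (rate * t * \<delta>) = exp (- t * total_rate x)" by (simp flip: exp_add)
        then show ?thesis by simp
      qed
      have S: "(\<lambda>n. p n * (\<delta> ^ n * \<phi> x)) sums (exp (- t * total_rate x) * \<phi> x)"
        using e1 unfolding e2 e3 .
      have "(\<Sum>n. ennreal (p n) * (stay x ^ n * ennreal (\<phi> x))) = (\<Sum>n. ennreal (p n * (\<delta> ^ n * \<phi> x)))"
        using p0 \<delta> phi by (intro suminf_cong) (simp add: stay_eq \<delta>_def[symmetric] ennreal_mult ennreal_power)
      also have "\<dots> = ennreal (exp (- t * total_rate x) * \<phi> x)"
        using S p0 \<delta> phi by (subst suminf_ennreal2) (auto simp: sums_iff)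
      also have "\<dots> \<le> ennreal (exp (- t * enn2real (b_eps f \<epsilon> x)) * \<phi> x)"
      proof -
        have "b_eps f \<epsilon> x \<le> ennreal (total_rate x)"
          unfolding ennreal_total_rate b_eps_def by (intro nn_integral_mono) (auto simp: f_eps_def indicator_def)
        then have "enn2real (b_eps f \<epsilon> x) \<le> total_rate x" using total_rate_bounds by (intro enn2real_leI) auto
        then have "t * enn2real (b_eps f \<epsilon> x) \<le> t * total_rate x" using t by (intro mult_left_mono) auto
        then show ?thesis using phi by (intro ennreal_leI mult_right_mono) auto
      qed
      finally show ?thesis .
    qed
    have g_sum: "(\<Sum>n. ennreal (p n) * ennreal (g n y)) \<le> ennreal (C2 * h y)" for y
      unfolding p_def g_def h_def rate_def by (rule C2(2)[OF eps t]) simp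
    have "(\<Sum>n. \<integral>\<^sup>+y. ennreal (p n) * (ennreal (\<phi> y) * ennreal (g n y)) \<partial>lborel)
        = (\<integral>\<^sup>+y. (\<Sum>n. ennreal (p n) * (ennreal (\<phi> y) * ennreal (g n y))) \<partial>lborel)"
      by (rule nn_integral_suminf[symmetric]) measurable
    also have "\<dots> \<le> (\<integral>\<^sup>+y. ennreal C2 * ennreal (\<phi> y * h y) \<partial>lborel)"
    proof (rule nn_integral_mono)
      fix y
      have "(\<Sum>n. ennreal (p n) * (ennreal (\<phi> y) * ennreal (g n y))) = ennreal (\<phi> y) * (\<Sum>n. ennreal (p n) * ennreal (g n y))"
        by (simp add: mult.left_commute)
      also have "\<dots> \<le> ennreal (\<phi> y) * ennreal (C2 * h y)" by (intro mult_left_mono g_sum) simp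
      also have "\<dots> = ennreal C2 * ennreal (\<phi> y * h y)"
        using phi h0[of y] C2(1) by (simp add: ennreal_mult mult_ac)
      finally show "(\<Sum>n. ennreal (p n) * (ennreal (\<phi> y) * ennreal (g n y))) \<le> \<dots>" .
    qed
    also have "\<dots> = ennreal (C2 * I)"
    proof -
      have [measurable]: "h \<in> borel_measurable borel" unfolding h_def by measurable
      have "(\<integral>\<^sup>+y. ennreal C2 * ennreal (\<phi> y * h y) \<partial>lborel) = ennreal C2 * ennreal I"
        unfolding I[symmetric] by (rule nn_integral_cmult) measurable
      then show ?thesis using C2(1) I0 by (simp add: ennreal_mult)
    qed
    finally have kernel_sum: "(\<Sum>n. \<integral>\<^sup>+y. ennreal (p n) * (ennreal (\<phi> y) * ennreal (g n y)) \<partial>lborel) \<le> ennreal (C2 * I)" .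
    have "ennreal (exp_op t (A_eps f \<epsilon>) \<phi> x) = (\<Sum>n. ennreal (p n) * (jump_op stay jmp ^^ n) (\<lambda>y. ennreal (\<phi> y)) x)"
      unfolding p_def by (rule exp_op_A_eps[OF phi(1) phi(2)[rule_format] t])
    also have "\<dots> \<le> (\<Sum>n. ennreal (p n) * (stay x ^ n * ennreal (\<phi> x)) + ennreal C1 * (\<integral>\<^sup>+y. ennreal (p n) * (ennreal (\<phi> y) * ennreal (g n y)) \<partial>lborel))"
    proof (intro suminf_le summableI)
      fix n
      have "ennreal (p n) * (jump_op stay jmp ^^ n) (\<lambda>y. ennreal (\<phi> y)) x
          \<le> ennreal (p n) * (stay x ^ n * ennreal (\<phi> x) + ennreal C1 * (\<integral>\<^sup>+y. ennreal (\<phi> y) * ennreal (g n y) \<partial>lborel))"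
        unfolding g_def by (intro mult_left_mono C1(2) stable_jump) auto
      also have "\<dots> = ennreal (p n) * (stay x ^ n * ennreal (\<phi> x)) + ennreal C1 * (\<integral>\<^sup>+y. ennreal (p n) * (ennreal (\<phi> y) * ennreal (g n y)) \<partial>lborel)"
        by (subst nn_integral_cmult) (auto simp: distrib_left mult.left_commute)
      finally show "ennreal (p n) * (jump_op stay jmp ^^ n) (\<lambda>y. ennreal (\<phi> y)) x \<le> \<dots>" .
    qed
    also have "\<dots> = (\<Sum>n. ennreal (p n) * (stay x ^ n * ennreal (\<phi> x))) + ennreal C1 * (\<Sum>n. \<integral>\<^sup>+y. ennreal (p n) * (ennreal (\<phi> y) * ennreal (g n y)) \<partial>lborel)"
      by (subst suminf_add[symmetric]) (auto intro: summableI)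
    also have "\<dots> \<le> ennreal (exp (- t * enn2real (b_eps f \<epsilon> x)) * \<phi> x) + ennreal C1 * ennreal (C2 * I)"
      by (intro add_mono mult_left_mono D_sum kernel_sum) simp
    also have "\<dots> = ennreal (C1 * C2 * I + exp (- t * enn2real (b_eps f \<epsilon> x)) * \<phi> x)"
      using C1(1) C2(1) I0 phi by (simp add: ennreal_mult ennreal_plus mult.assoc add.commute)
    finally have "exp_op t (A_eps f \<epsilon>) \<phi> x \<le> C1 * C2 * I + exp (- t * enn2real (b_eps f \<epsilon> x)) * \<phi> x"
      using C1(1) C2(1) I0 phi by (subst (asm) ennreal_le_iff) auto
    then show "exp_op t (A_eps f \<epsilon>) \<phi> x
        \<le> C1 * C2 * (\<integral>y. \<phi> y * min (t powr (- real CARD('n) / \<alpha>))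
                              (t / norm (y - x) powr (\<alpha> + real CARD('n))) \<partial>lborel)
          + exp (- t * enn2real (b_eps f \<epsilon> x)) * \<phi> x"
      by (simp add: I_def h_eq)
  qed
qed

end
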